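(* Let $\mathcal{I}$ be a normed ideal of a $\sigma$-finite, semifinite von Neumann algebra factor $\mathcal{B}$, with ideal norm $\|\cdot\|_{\mathcal{I}}$, endowed with a trace $\tau_{\mathcal{I}}:\mathcal{I}\to\mathbb{C}$ that is positive and $\|\cdot\|_{\mathcal{I}}$-bounded. Let $V\in\mathcal{I}$ and assume that $H_0\in\mathcal{B}$ and $H_0+V$ are unitary. Let $\mathcal{F}$ be the set of all functions $f$ on the unit circle $\mathbb{T}$ such that $f(z)=\sum_{k=-\infty}^\infty\hat f(k)z^k$ for all $z\in\mathbb{T}$ and $\sum_{k=-\infty}^\infty|k(k-1)\hat f(k)|<\infty$. Then there is a (countably additive, complex) measure $\mu_{H_0,V}$ on $\mathbb{T}$ such that for all $f\in\mathcal{F}$, $$\tau_{\mathcal{I}}\big(f(H_0+V)-f(H_0)\big)=\int_{\mathbb{T}}f'(\lambda)\,\mu_{H_0,V}(d\lambda),$$ and its total variation is bounded by $\|\mu_{H_0,V}\|\le\frac{\pi}{2}\,\|\tau_{\mathcal{I}}\|_{\mathcal{I}^*}\,\|V\|_{\mathcal{I}}$.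
   Context: An ideal of $\mathcal{B}$ means a two-sided ideal. A normed ideal is an ideal $\mathcal{I}$ of $\mathcal{B}$ with an ideal norm, i.e. a norm $\|\cdot\|_{\mathcal{I}}$ on $\mathcal{I}$ such that: (a) $A\in\mathcal{B}$, $B\in\mathcal{I}$, $0\le A\le B$ implies $\|A\|_{\mathcal{I}}\le\|B\|_{\mathcal{I}}$; (b) there is $K>0$ with $\|B\|\le K\|B\|_{\mathcal{I}}$ for all $B\in\mathcal{I}$; (c) $\|ABC\|_{\mathcal{I}}\le\|A\|\,\|B\|_{\mathcal{I}}\,\|C\|$ for $A,C\in\mathcal{B}$, $B\in\mathcal{I}$. A trace on $\mathcal{I}$ is a linear functional $\tau_{\mathcal{I}}:\mathcal{I}\to\mathbb{C}$ with $\tau_{\mathcal{I}}(AB)=\tau_{\mathcal{I}}(BA)$ for $A\in\mathcal{I}$, $B\in\mathcal{B}$; it is positive if $\tau_{\mathcal{I}}(A)\ge 0$ for $0\le A\in\mathcal{I}$, and $\|\cdot\|_{\mathcal{I}}$-bounded if there is $M>0$ with $|\tau_{\mathcal{I}}(A)|\le M\|A\|_{\mathcal{I}}$ for all $A\in\mathcal{I}$; the infimum of such $M$ is $\|\tau_{\mathcal{I}}\|_{\mathcal{I}^*}$. For $f\in\mathcal{F}$ and a unitary $U$, $f(U)=\sum_{k=-\infty}^\infty\hat f(k)U^k$, and $f'(z)=\sum_{k=-\infty}^\infty k\hat f(k)z^{k-1}$ for $z\in\mathbb{T}$.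
   Formalization: The ideal need not be complete, so f(H_0+V)-f(H_0) may lie outside it; the trace formula is stated for all f in F if the ideal is complete, and otherwise for those f for which the series of \hat f(k)((H_0+V)^k-H_0^k) converges to it in ideal norm. *)

theory Defs
  imports "HOL-Analysis.Analysis"
begin

section \<open>Complex Hilbert spaces and their bounded operators\<close>

text \<open>
  The real Hilbert space structure (norm, topology, completeness) is the library's; the complex
  inner product, conjugate-linear in its first argument, refines the real one.
\<close>

class complex_hilbert = real_inner + banach +
  fixes scaleC :: "complex \<Rightarrow> 'a \<Rightarrow> 'a" (infixr "*\<^sub>C" 75)
    and cinner :: "'a \<Rightarrow> 'a \<Rightarrow> complex"
  assumes scaleC_add_right: "c *\<^sub>C (x + y) = c *\<^sub>C x + c *\<^sub>C y"
    and scaleC_add_left: "(c + d) *\<^sub>C x = c *\<^sub>C x + d *\<^sub>C x"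
    and scaleC_scaleC: "c *\<^sub>C (d *\<^sub>C x) = (c * d) *\<^sub>C x"
    and scaleR_scaleC: "r *\<^sub>R x = complex_of_real r *\<^sub>C x"
    and cinner_add_right: "cinner x (y + z) = cinner x y + cinner x z"
    and cinner_scaleC_right: "cinner x (c *\<^sub>C y) = c * cinner x y"
    and cinner_commute: "cinner y x = cnj (cinner x y)"
    and inner_eq_Re_cinner: "inner x y = Re (cinner x y)"

instantiation complex :: complex_hilbert
begin

definition scaleC_complex :: "complex \<Rightarrow> complex \<Rightarrow> complex"
  where "scaleC_complex c x = c * x"

definition cinner_complex :: "complex \<Rightarrow> complex \<Rightarrow> complex"
  where "cinner_complex x y = cnj x * y"

instance
  by standard
    (auto simp: scaleC_complex_def cinner_complex_def algebra_simps scaleR_conv_of_real inner_complex_def)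

end

lemma norm_scaleC: "norm (c *\<^sub>C x) = cmod c * norm (x :: 'h::complex_hilbert)"
proof -
  have sq: "complex_of_real ((norm y)\<^sup>2) = cinner y y" for y :: 'h
  proof (rule complex_eqI)
    show "Re (complex_of_real ((norm y)\<^sup>2)) = Re (cinner y y)"
      by (simp add: inner_eq_Re_cinner[symmetric] power2_norm_eq_inner)
    have "Im (cinner y y) = - Im (cinner y y)"
      by (subst cinner_commute) simp
    then show "Im (complex_of_real ((norm y)\<^sup>2)) = Im (cinner y y)" by simp
  qed
  have left: "cinner (c *\<^sub>C x) y = cnj c * cinner x y" for y :: 'h
    by (metis cinner_commute cinner_scaleC_right complex_cnj_mult)
  have "complex_of_real ((norm (c *\<^sub>C x))\<^sup>2) = c * (cnj c * cinner x x)"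
    by (simp only: sq cinner_scaleC_right left)
  also have "\<dots> = complex_of_real ((cmod c * norm x)\<^sup>2)"
    by (simp only: sq[symmetric] mult.assoc[symmetric] complex_norm_square[symmetric]
        of_real_mult[symmetric] power_mult_distrib)
  finally have "(norm (c *\<^sub>C x))\<^sup>2 = (cmod c * norm x)\<^sup>2"
    using of_real_eq_iff by blast
  then show ?thesis by (simp add: power2_eq_iff_nonneg)
qed

text \<open>
  The type \<open>'h \<Rightarrow>\<^sub>L 'h\<close> consists of the bounded \<^emph>\<open>real\<close>-linear operators; \<open>B(H)\<close> is its subset
  \<open>bounded_ops\<close>.
\<close>

type_synonym 'h oper = "'h \<Rightarrow>\<^sub>L 'h"

definition bounded_ops :: "'h::complex_hilbert oper set"
  where "bounded_ops = {A. \<forall>c x. blinfun_apply A (c *\<^sub>C x) = c *\<^sub>C blinfun_apply A x}"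

lift_definition scaleC_op :: "complex \<Rightarrow> 'h::complex_hilbert oper \<Rightarrow> 'h oper" (infixr "*\<^sub>o" 75)
  is "\<lambda>c A x. c *\<^sub>C A x"
proof -
  fix c :: complex and A :: "'h \<Rightarrow> 'h"
  assume A: "bounded_linear A"
  have "bounded_linear (\<lambda>x :: 'h. c *\<^sub>C x)"
    by (rule bounded_linear_intro[where K = "cmod c"])
      (simp_all add: scaleC_add_right scaleR_scaleC scaleC_scaleC mult.commute norm_scaleC)
  from bounded_linear_compose[OF this A] show "bounded_linear (\<lambda>x. c *\<^sub>C A x)" .
qed

definition adj :: "'h::complex_hilbert oper \<Rightarrow> 'h oper"
  where "adj A =
    (THE B. \<forall>x y. cinner (blinfun_apply A x) y = cinner x (blinfun_apply B y))"

definition positive_op :: "'h::complex_hilbert oper \<Rightarrow> bool"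
  where "positive_op A \<longleftrightarrow>
    A \<in> bounded_ops \<and> (\<forall>x. cinner x (blinfun_apply A x) \<in> \<real>\<^sub>\<ge>\<^sub>0)"

definition op_le :: "'h::complex_hilbert oper \<Rightarrow> 'h oper \<Rightarrow> bool" (infix "\<le>\<^sub>o" 50)
  where "A \<le>\<^sub>o B \<longleftrightarrow> positive_op (B - A)"

definition unitary :: "'h::complex_hilbert oper \<Rightarrow> bool"
  where "unitary U \<longleftrightarrow> U \<in> bounded_ops \<and>
    adj U o\<^sub>L U = id_blinfun \<and> U o\<^sub>L adj U = id_blinfun"

text \<open>Integer powers; the inverse of a unitary is its adjoint.\<close>

definition unitary_powi :: "'h::complex_hilbert oper \<Rightarrow> int \<Rightarrow> 'h oper"
  where "unitary_powi U k =
    (if 0 \<le> k then ((\<lambda>X. U o\<^sub>L X) ^^ nat k) id_blinfun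
     else ((\<lambda>X. adj U o\<^sub>L X) ^^ nat (- k)) id_blinfun)"


section \<open>Von Neumann algebras\<close>

definition commutant :: "'h::complex_hilbert oper set \<Rightarrow> 'h oper set"
  where "commutant S = {A \<in> bounded_ops. \<forall>X\<in>S. A o\<^sub>L X = X o\<^sub>L A}"

text \<open>
  A self-adjoint set of bounded operators that is its own bicommutant; being a commutant,
  it is automatically a unital subalgebra of \<open>B(H)\<close>.
\<close>

definition von_neumann_algebra :: "'h::complex_hilbert oper set \<Rightarrow> bool"
  where "von_neumann_algebra \<B> \<longleftrightarrow>
    \<B> \<subseteq> bounded_ops \<and> (\<forall>A\<in>\<B>. adj A \<in> \<B>) \<and> commutant (commutant \<B>) = \<B>"

definition vn_center :: "'h::complex_hilbert oper set \<Rightarrow> 'h oper set"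
  where "vn_center \<B> = \<B> \<inter> commutant \<B>"

definition vn_factor :: "'h::complex_hilbert oper set \<Rightarrow> bool"
  where "vn_factor \<B> \<longleftrightarrow>
    von_neumann_algebra \<B> \<and> vn_center \<B> = range (\<lambda>c. c *\<^sub>o id_blinfun)"

definition projections :: "'h::complex_hilbert oper set \<Rightarrow> 'h oper set"
  where "projections \<B> = {P \<in> \<B>. adj P = P \<and> P o\<^sub>L P = P}"

definition sigma_finite_vn :: "'h::complex_hilbert oper set \<Rightarrow> bool"
  where "sigma_finite_vn \<B> \<longleftrightarrow>
    (\<forall>\<P>. \<P> \<subseteq> projections \<B> - {0} \<and> (\<forall>P\<in>\<P>. \<forall>Q\<in>\<P>. P \<noteq> Q \<longrightarrow> P o\<^sub>L Q = 0)
       \<longrightarrow> countable \<P>)"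

text \<open>Murray--von Neumann equivalence, implemented by a partial isometry in the algebra.\<close>

definition mvn_equiv :: "'h::complex_hilbert oper set \<Rightarrow> 'h oper \<Rightarrow> 'h oper \<Rightarrow> bool"
  where "mvn_equiv \<B> P Q \<longleftrightarrow> (\<exists>W\<in>\<B>. adj W o\<^sub>L W = P \<and> W o\<^sub>L adj W = Q)"

definition finite_projection :: "'h::complex_hilbert oper set \<Rightarrow> 'h oper \<Rightarrow> bool"
  where "finite_projection \<B> P \<longleftrightarrow> P \<in> projections \<B> \<and>
    (\<forall>Q\<in>projections \<B>. Q \<le>\<^sub>o P \<and> mvn_equiv \<B> Q P \<longrightarrow> Q = P)"

definition semifinite_vn :: "'h::complex_hilbert oper set \<Rightarrow> bool"
  where "semifinite_vn \<B> \<longleftrightarrow>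
    (\<forall>Z \<in> projections \<B> \<inter> vn_center \<B>. Z \<noteq> 0 \<longrightarrow>
       (\<exists>P. finite_projection \<B> P \<and> P \<noteq> 0 \<and> P \<le>\<^sub>o Z))"


section \<open>Normed ideals and traces\<close>

definition two_sided_ideal :: "'h::complex_hilbert oper set \<Rightarrow> 'h oper set \<Rightarrow> bool"
  where "two_sided_ideal \<B> \<I> \<longleftrightarrow>
    \<I> \<subseteq> \<B> \<and> 0 \<in> \<I> \<and> (\<forall>X\<in>\<I>. \<forall>Y\<in>\<I>. X + Y \<in> \<I>) \<and> (\<forall>c. \<forall>X\<in>\<I>. c *\<^sub>o X \<in> \<I>) \<and>
    (\<forall>A\<in>\<B>. \<forall>X\<in>\<I>. A o\<^sub>L X \<in> \<I> \<and> X o\<^sub>L A \<in> \<I>)"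

definition norm_on :: "'h::complex_hilbert oper set \<Rightarrow> ('h oper \<Rightarrow> real) \<Rightarrow> bool"
  where "norm_on \<I> N \<longleftrightarrow>
    (\<forall>X\<in>\<I>. 0 \<le> N X \<and> (N X = 0 \<longleftrightarrow> X = 0)) \<and>
    (\<forall>c. \<forall>X\<in>\<I>. N (c *\<^sub>o X) = cmod c * N X) \<and>
    (\<forall>X\<in>\<I>. \<forall>Y\<in>\<I>. N (X + Y) \<le> N X + N Y)"

definition ideal_norm ::
    "'h::complex_hilbert oper set \<Rightarrow> 'h oper set \<Rightarrow> ('h oper \<Rightarrow> real) \<Rightarrow> bool"
  where "ideal_norm \<B> \<I> N \<longleftrightarrow> norm_on \<I> N \<and>
    (\<forall>A\<in>\<B>. \<forall>X\<in>\<I>. 0 \<le>\<^sub>o A \<and> A \<le>\<^sub>o X \<longrightarrow> N A \<le> N X) \<and>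
    (\<exists>K>0. \<forall>X\<in>\<I>. norm X \<le> K * N X) \<and>
    (\<forall>A\<in>\<B>. \<forall>X\<in>\<I>. \<forall>C\<in>\<B>. N (A o\<^sub>L X o\<^sub>L C) \<le> norm A * N X * norm C)"

definition normed_ideal ::
    "'h::complex_hilbert oper set \<Rightarrow> 'h oper set \<Rightarrow> ('h oper \<Rightarrow> real) \<Rightarrow> bool"
  where "normed_ideal \<B> \<I> N \<longleftrightarrow> two_sided_ideal \<B> \<I> \<and> ideal_norm \<B> \<I> N"

definition trace_on ::
    "'h::complex_hilbert oper set \<Rightarrow> 'h oper set \<Rightarrow> ('h oper \<Rightarrow> complex) \<Rightarrow> bool"
  where "trace_on \<B> \<I> \<tau> \<longleftrightarrow>
    (\<forall>X\<in>\<I>. \<forall>Y\<in>\<I>. \<tau> (X + Y) = \<tau> X + \<tau> Y) \<and>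
    (\<forall>c. \<forall>X\<in>\<I>. \<tau> (c *\<^sub>o X) = c * \<tau> X) \<and>
    (\<forall>X\<in>\<I>. \<forall>A\<in>\<B>. \<tau> (X o\<^sub>L A) = \<tau> (A o\<^sub>L X))"

definition positive_trace :: "'h::complex_hilbert oper set \<Rightarrow> ('h oper \<Rightarrow> complex) \<Rightarrow> bool"
  where "positive_trace \<I> \<tau> \<longleftrightarrow> (\<forall>X\<in>\<I>. 0 \<le>\<^sub>o X \<longrightarrow> \<tau> X \<in> \<real>\<^sub>\<ge>\<^sub>0)"

definition bounded_trace ::
    "'h::complex_hilbert oper set \<Rightarrow> ('h oper \<Rightarrow> real) \<Rightarrow> ('h oper \<Rightarrow> complex) \<Rightarrow> bool"
  where "bounded_trace \<I> N \<tau> \<longleftrightarrow> (\<exists>M>0. \<forall>X\<in>\<I>. cmod (\<tau> X) \<le> M * N X)"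

definition trace_norm ::
    "'h::complex_hilbert oper set \<Rightarrow> ('h oper \<Rightarrow> real) \<Rightarrow> ('h oper \<Rightarrow> complex) \<Rightarrow> real"
  where "trace_norm \<I> N \<tau> = Inf {M. 0 < M \<and> (\<forall>X\<in>\<I>. cmod (\<tau> X) \<le> M * N X)}"


text \<open>
  An ideal norm need not be complete. The next two notions say when a series of elements of the
  ideal has a sum in the ideal with respect to the ideal norm, rather than merely in operator norm.
\<close>

definition complete_ideal :: "'h::complex_hilbert oper set \<Rightarrow> ('h oper \<Rightarrow> real) \<Rightarrow> bool"
  where "complete_ideal \<I> N \<longleftrightarrow>
    (\<forall>X :: nat \<Rightarrow> 'h oper. range X \<subseteq> \<I> \<and> (\<forall>e>0. \<exists>n0. \<forall>m\<ge>n0. \<forall>n\<ge>n0. N (X m - X n) < e)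
       \<longrightarrow> (\<exists>Y\<in>\<I>. (\<lambda>n. N (X n - Y)) \<longlonglongrightarrow> 0))"

definition ideal_has_sum ::
    "'h::complex_hilbert oper set \<Rightarrow> ('h oper \<Rightarrow> real) \<Rightarrow> (int \<Rightarrow> 'h oper) \<Rightarrow> 'h oper \<Rightarrow> bool"
  where "ideal_has_sum \<I> N X Y \<longleftrightarrow> range X \<subseteq> \<I> \<and> Y \<in> \<I> \<and>
    ((\<lambda>F. N (sum X F - Y)) \<longlongrightarrow> 0) (finite_subsets_at_top UNIV)"


section \<open>Functions on the unit circle\<close>

abbreviation unit_circle :: "complex set" ("\<T>")
  where "\<T> \<equiv> sphere 0 1"

definition fourier_coeff :: "(complex \<Rightarrow> complex) \<Rightarrow> int \<Rightarrow> complex"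
  where "fourier_coeff f k =
    complex_of_real (1 / (2 * pi)) * integral {0..2 * pi} (\<lambda>t. f (cis t) * cis (- (of_int k * t)))"

text \<open>Only the values on the circle matter; off the circle \<open>f\<close> is arbitrary.\<close>

definition fun_class :: "(complex \<Rightarrow> complex) set" ("\<F>")
  where "\<F> = {f.
    (\<forall>z\<in>\<T>. ((\<lambda>k::int. fourier_coeff f k * z powi k) has_sum f z) UNIV) \<and>
    (\<lambda>k::int. cmod (of_int (k * (k - 1)) * fourier_coeff f k)) summable_on UNIV}"

text \<open>
  For \<open>f\<close> in \<open>\<F>\<close> the Fourier series of \<open>f\<close> and its formal derivative converge absolutely,
  so the unordered sums below agree with the two-sided series.
\<close>

definition circle_deriv :: "(complex \<Rightarrow> complex) \<Rightarrow> complex \<Rightarrow> complex"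
  where "circle_deriv f z = (\<Sum>\<^sub>\<infinity>k::int. of_int k * fourier_coeff f k * z powi (k - 1))"

definition fun_calc :: "(complex \<Rightarrow> complex) \<Rightarrow> 'h::complex_hilbert oper \<Rightarrow> 'h oper"
  where "fun_calc f U = (\<Sum>\<^sub>\<infinity>k::int. fourier_coeff f k *\<^sub>o unitary_powi U k)"


text \<open>
  The operator \<open>f(H\<^sub>0 + V) - f(H\<^sub>0)\<close> must be known to lie in the ideal for its trace to be meaningful:
  for finite-rank operators with the trace norm this can fail for non-polynomial \<open>f\<close>. The requirement
  is that the ideal is complete, or at least that, with \<open>U = H\<^sub>0 + V\<close> and
  \<open>c\<^sub>k\<close> the Fourier coefficients of \<open>f\<close>, the series \<open>\<Sum>k. c\<^sub>k (U\<^sup>k - H\<^sub>0\<^sup>k)\<close> sums in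
  ideal norm.
\<close>

definition trace_admissible ::
    "'h::complex_hilbert oper set \<Rightarrow> ('h oper \<Rightarrow> real) \<Rightarrow> 'h oper \<Rightarrow> 'h oper \<Rightarrow> (complex \<Rightarrow> complex) \<Rightarrow> bool"
  where "trace_admissible \<I> N U H\<^sub>0 f \<longleftrightarrow> complete_ideal \<I> N \<or>
    ideal_has_sum \<I> N (\<lambda>k. fourier_coeff f k *\<^sub>o (unitary_powi U k - unitary_powi H\<^sub>0 k))
      (fun_calc f U - fun_calc f H\<^sub>0)"


section \<open>Complex measures\<close>

text \<open>In this section \<open>M\<close> serves only as a measurable space.\<close>

definition complex_measure :: "'a measure \<Rightarrow> ('a set \<Rightarrow> complex) \<Rightarrow> bool"
  where "complex_measure M \<mu> \<longleftrightarrow>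
    (\<forall>A :: nat \<Rightarrow> 'a set. range A \<subseteq> sets M \<and> disjoint_family A \<longrightarrow>
       (\<lambda>n. \<mu> (A n)) sums \<mu> (\<Union>n. A n))"

definition total_variation :: "'a measure \<Rightarrow> ('a set \<Rightarrow> complex) \<Rightarrow> ennreal"
  where "total_variation M \<mu> =
    (SUP \<P> \<in> {\<P>. finite \<P> \<and> \<P> \<subseteq> sets M \<and> disjoint \<P>}. \<Sum>E\<in>\<P>. ennreal (cmod (\<mu> E)))"

text \<open>
  The positive part of the Jordan decomposition of a finite signed measure. The choice \<open>A = {}\<close>
  makes the supremum nonnegative, so it is harmless that \<open>ennreal\<close> sends negative reals to 0.
\<close>

definition positive_part :: "'a measure \<Rightarrow> ('a set \<Rightarrow> real) \<Rightarrow> 'a measure"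
  where "positive_part M \<nu> =
    measure_of (space M) (sets M) (\<lambda>E. SUP A \<in> {A \<in> sets M. A \<subseteq> E}. ennreal (\<nu> A))"

definition complex_integral ::
    "'a measure \<Rightarrow> ('a set \<Rightarrow> complex) \<Rightarrow> ('a \<Rightarrow> complex) \<Rightarrow> complex"
  where "complex_integral M \<mu> g =
    (integral\<^sup>L (positive_part M (\<lambda>E. Re (\<mu> E))) g - integral\<^sup>L (positive_part M (\<lambda>E. - Re (\<mu> E))) g)
    + \<i> * (integral\<^sup>L (positive_part M (\<lambda>E. Im (\<mu> E))) g - integral\<^sup>L (positive_part M (\<lambda>E. - Im (\<mu> E))) g)"

end

theory Submission
  imports Defs "HOL-Probability.Probability"
begin

text \<open>
  Let \<open>U\<^sub>0 = H\<^sub>0\<close> and \<open>W = (H\<^sub>0 + V) H\<^sub>0\<^sup>*\<close>, a unitary of the algebra with \<open>W - 1\<close> in the ideal. The von Neumann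
  algebra contains a self-adjoint \<open>A\<close> with \<open>W = e\<^sup>i\<^sup>A\<close> and \<open>\<bar>A\<bar> \<le> \<pi>\<close>, and \<open>U\<^sub>s = e\<^sup>i\<^sup>s\<^sup>A U\<^sub>0\<close> is a path of unitaries from \<open>H\<^sub>0\<close>
  to \<open>H\<^sub>0 + V\<close>. Cyclicity of the trace gives \<open>d/ds \<tau> (U\<^sub>s\<^sup>k - U\<^sub>0\<^sup>k) = i k \<tau> (A U\<^sub>s\<^sup>k)\<close> for every integer \<open>k\<close>, so that
  \<open>\<tau> ((H\<^sub>0 + V)\<^sup>k - H\<^sub>0\<^sup>k)\<close> is \<open>i k\<close> times the integral of \<open>\<tau> (A U\<^sub>s\<^sup>k)\<close> over \<open>0 \<le> s \<le> 1\<close> (\<open>tau_upow_difference\<close>).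

  Decompose \<open>A\<close> into its positive and negative parts. For a positive \<open>T\<close> in the ideal the integral of
  \<open>\<tau> (T U\<^sub>s\<^sup>k)\<close> is a positive definite function of \<open>k\<close>, because the trace is positive and cyclic
  (\<open>moment_positive_definite\<close>). By the theorem of Herglotz it is the sequence of moments of a positive
  measure of mass \<open>\<tau> T\<close> on the circle. If \<open>\<nu>1\<close> and \<open>\<nu>2\<close> belong to the two parts of \<open>A\<close>, then \<open>i z (\<nu>1 - \<nu>2)\<close>
  represents the trace for monomials, hence for absolutely convergent series, and its total variation is
  at most \<open>\<tau> \<bar>A\<bar>\<close> (\<open>exists_spectral_measure\<close>). The trace is not assumed to be normal, which is why the measure
  is produced by weak compactness and not from spectral projections of \<open>U\<^sub>s\<close>.

  The constant comes from comparing arc and chord: \<open>\<bar>W - 1\<bar> = 2 sin (\<bar>A\<bar>/2)\<close>, and \<open>arcsin u \<le> (\<pi>/2) u\<close> on the unit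
  interval. Since \<open>arcsin u / u\<close> is continuous, \<open>\<bar>A\<bar>\<close> is the product of \<open>\<bar>W - 1\<bar>\<close> with an element of the algebra of
  norm at most \<open>\<pi>/2\<close>; therefore \<open>\<bar>A\<bar>\<close> lies in the ideal and its ideal norm is at most \<open>\<pi>/2\<close> times that of \<open>W - 1\<close>,
  hence of \<open>V\<close> (\<open>\<Theta>_I\<close>, \<open>\<Theta>_N\<close>).

  The logarithm has a jump at \<open>-1\<close> that no continuous function of \<open>W\<close> can reproduce. Its absolute value is
  continuous, though, and comes from a functional calculus for positive contractions built from Bernstein
  polynomials. The remaining sign is the symmetry in the polar decomposition of the imaginary part \<open>S\<close> of \<open>W\<close>:
  the projection onto the kernel of \<open>\<bar>S\<bar> + S\<close> belongs to the algebra because it commutes with the commutant.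
\<close>

section \<open>Orthogonal projections and adjoints\<close>

text \<open>A minimising sequence is Cauchy by the parallelogram law; the midpoint of two near-minimisers
  lies in the subspace, so it cannot be much closer to \<open>x\<close> than they are.\<close>

lemma closest_point_in_subspace:
  fixes K :: "'a::{real_inner,banach} set"
  assumes "closed K" "subspace K"
  obtains y where "y \<in> K" "\<And>z. z \<in> K \<Longrightarrow> norm (x - y) \<le> norm (x - z)"
proof -
  define D where "D = infdist x K"
  have K0: "K \<noteq> {}" using assms(2) subspace_0 by auto
  have Dle: "D \<le> norm (x - z)" if "z \<in> K" for z
    using infdist_le[OF that, of x] by (simp add: D_def dist_norm)
  have D0: "D \<ge> 0" by (simp add: D_def infdist_nonneg)
  have "\<exists>y. y \<in> K \<and> (norm (x - y))\<^sup>2 < D\<^sup>2 + 1 / Suc n" for n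
  proof -
    have "D < sqrt (D\<^sup>2 + 1 / Suc n)"
      by (rule real_less_rsqrt) auto
    then obtain y where y: "y \<in> K" "dist x y < sqrt (D\<^sup>2 + 1 / Suc n)"
      unfolding D_def infdist_notempty[OF K0]
      using cINF_less_iff[of K "dist x" "sqrt (D\<^sup>2 + 1 / Suc n)"] K0
      by (auto simp: D_def infdist_def intro!: bdd_belowI[where m=0])
    have "(norm (x - y))\<^sup>2 < (sqrt (D\<^sup>2 + 1 / Suc n))\<^sup>2"
      using y(2) by (intro power_strict_mono) (auto simp: dist_norm)
    then show ?thesis using y(1) by (intro exI[of _ y]) (simp add: D0)
  qed
  then obtain y where yK: "\<And>n. y n \<in> K" and y: "\<And>n. (norm (x - y n))\<^sup>2 < D\<^sup>2 + 1 / Suc n"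
    by metis
  have par: "(norm (y m - y n))\<^sup>2 \<le> 2 / Suc m + 2 / Suc n" for m n
  proof -
    have "D\<^sup>2 \<le> (norm (x - (1/2) *\<^sub>R (y m + y n)))\<^sup>2"
      using D0 Dle[of "(1/2) *\<^sub>R (y m + y n)"] yK assms(2)
      by (intro power_mono) (auto intro: subspace_scale subspace_add)
    moreover have "(norm (y m - y n))\<^sup>2 + 4 * (norm (x - (1/2) *\<^sub>R (y m + y n)))\<^sup>2
        = 2 * (norm (x - y m))\<^sup>2 + 2 * (norm (x - y n))\<^sup>2"
      by (simp add: power2_norm_eq_inner inner_diff_left inner_diff_right inner_add_left
          inner_add_right inner_commute algebra_simps)
    ultimately show ?thesis using y[of m] y[of n] by linarith
  qed
  have "Cauchy y"
  proof (rule CauchyI)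
    fix e :: real assume e: "e > 0"
    obtain M where M: "1 / real (Suc M) < e\<^sup>2 / 4"
      using reals_Archimedean[of "e\<^sup>2/4"] e by (auto simp: inverse_eq_divide)
    have "norm (y m - y n) < e" if "m \<ge> M" "n \<ge> M" for m n
    proof -
      have "1 / real (Suc m) \<le> 1 / real (Suc M)" "1 / real (Suc n) \<le> 1 / real (Suc M)"
        using that by (auto intro!: divide_left_mono)
      with par[of m n] M have "(norm (y m - y n))\<^sup>2 < e\<^sup>2" by linarith
      then show ?thesis using e by (simp add: power2_less_imp_less)
    qed
    then show "\<exists>M. \<forall>m\<ge>M. \<forall>n\<ge>M. norm (y m - y n) < e" by blast
  qed
  then obtain l where l: "y \<longlonglongrightarrow> l" using Cauchy_convergent_iff convergent_def by blast
  have "l \<in> K" using closed_sequentially[OF assms(1)] yK l by blast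
  moreover have "norm (x - l) \<le> norm (x - z)" if "z \<in> K" for z
  proof -
    have "(\<lambda>n. (norm (x - y n))\<^sup>2) \<longlonglongrightarrow> (norm (x - l))\<^sup>2"
      by (intro tendsto_intros l)
    moreover have "(\<lambda>n. D\<^sup>2 + 1 / real (Suc n)) \<longlonglongrightarrow> D\<^sup>2 + 0"
      by (intro tendsto_intros LIMSEQ_inverse_real_of_nat[unfolded inverse_eq_divide])
    ultimately have "(norm (x - l))\<^sup>2 \<le> D\<^sup>2 + 0"
      by (rule LIMSEQ_le) (use y less_imp_le in blast)
    then have "norm (x - l) \<le> D" using D0 by (simp add: power2_le_iff_abs_le)
    then show ?thesis using Dle[OF that] by linarith
  qed
  ultimately show ?thesis using that by blast
qed

text \<open>At the closest point the first variation of the squared distance vanishes in every direction of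
  the subspace.\<close>

lemma orthogonal_decomposition:
  fixes K :: "'a::{real_inner,banach} set"
  assumes "closed K" "subspace K"
  obtains y where "y \<in> K" "\<And>z. z \<in> K \<Longrightarrow> inner (x - y) z = 0"
proof -
  obtain y where y: "y \<in> K" "\<And>z. z \<in> K \<Longrightarrow> norm (x - y) \<le> norm (x - z)"
    using closest_point_in_subspace[OF assms, of x] by blast
  have "inner (x - y) z = 0" if z: "z \<in> K" for z
  proof (cases "z = 0")
    case False
    define t where "t = inner (x - y) z / (norm z)\<^sup>2"
    have "y + t *\<^sub>R z \<in> K" using y(1) z assms(2) by (auto intro: subspace_add subspace_scale)
    then have "norm (x - y) \<le> norm (x - y - t *\<^sub>R z)" using y(2) by (simp add: diff_diff_eq)
    then have "(norm (x - y))\<^sup>2 \<le> (norm (x - y - t *\<^sub>R z))\<^sup>2" by (intro power_mono) auto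
    also have "\<dots> = (norm (x - y))\<^sup>2 - 2 * t * inner (x - y) z + t\<^sup>2 * (norm z)\<^sup>2"
      unfolding power2_norm_eq_inner inner_diff_left[of "x - y" "t *\<^sub>R z"]
        inner_diff_right[of _ "x - y" "t *\<^sub>R z"]
      by (simp add: power2_eq_square inner_commute)
    also have "\<dots> = (norm (x - y))\<^sup>2 - (inner (x - y) z)\<^sup>2 / (norm z)\<^sup>2"
      using False by (simp add: t_def power2_eq_square field_simps)
    finally have "(inner (x - y) z)\<^sup>2 / (norm z)\<^sup>2 \<le> 0" by simp
    then show ?thesis using False by (simp add: divide_le_0_iff zero_le_power2)
  qed simp
  then show ?thesis using y(1) that by blast
qed

text \<open>A functional is determined by its kernel and its value on a vector orthogonal to the kernel.\<close>

lemma Riesz_representation: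
  fixes f :: "'a::{real_inner,banach} \<Rightarrow> real"
  assumes f: "bounded_linear f"
  obtains y where "\<And>x. f x = inner x y"
proof -
  interpret bounded_linear f by fact
  have cl: "closed {x. f x = 0}"
    by (intro closed_Collect_eq continuous_intros linear_continuous_on f)
  have sub: "subspace {x. f x = 0}" by (auto simp: subspace_def add scaleR zero)
  show ?thesis
  proof (cases "\<forall>x. f x = 0")
    case True then show ?thesis by (intro that[of 0]) simp
  next
    case False
    then obtain z where z: "f z \<noteq> 0" by blast
    obtain p where p: "p \<in> {x. f x = 0}" "\<And>k. k \<in> {x. f x = 0} \<Longrightarrow> inner (z - p) k = 0"
      using orthogonal_decomposition[OF cl sub, of z] by blast
    define w where "w = z - p"
    have fw: "f w = f z" using p(1) by (simp add: w_def diff)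
    then have w0: "w \<noteq> 0" using z zero by auto
    have "f x = inner x ((f w / inner w w) *\<^sub>R w)" for x
    proof -
      have "f (x - (f x / f w) *\<^sub>R w) = 0" using z fw by (simp add: diff scaleR)
      then have "inner w (x - (f x / f w) *\<^sub>R w) = 0" using p(2) by (simp add: w_def)
      then show ?thesis using w0 z fw by (simp add: inner_diff_right inner_commute field_simps)
    qed
    then show ?thesis using that by blast
  qed
qed

lemma cinner_add_left: "cinner (x + y) (z::'h::complex_hilbert) = cinner x z + cinner y z"
  by (metis cinner_add_right cinner_commute complex_cnj_add)

lemma cinner_scaleC_left: "cinner (c *\<^sub>C x) (y::'h::complex_hilbert) = cnj c * cinner x y"
  by (metis cinner_commute cinner_scaleC_right complex_cnj_mult)

text \<open>Statements about the complex inner product reduce in this way to the real one, for complex-linear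
  operators.\<close>

lemma cinner_eq_inner: "cinner x (y::'h::complex_hilbert) = Complex (inner x y) (inner (\<i> *\<^sub>C x) y)"
  by (simp add: complex_eq_iff inner_eq_Re_cinner cinner_scaleC_left)

lemma cinner_diff_left: "cinner (x - y) (z::'h::complex_hilbert) = cinner x z - cinner y z"
  by (metis add_diff_cancel cinner_add_left diff_add_cancel)

lemma cinner_diff_right: "cinner z (x - y :: 'h::complex_hilbert) = cinner z x - cinner z y"
  by (metis add_diff_cancel cinner_add_right diff_add_cancel)

lemma cinner_ext:
  fixes y z :: "'h::complex_hilbert"
  assumes "\<And>x. cinner x y = cinner x z" shows "y = z"
proof -
  have "inner (y - z) (y - z) = 0"
    by (simp add: inner_eq_Re_cinner cinner_diff_right assms)
  then show ?thesis by simp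
qed

lemma blinfun_scaleC_apply [simp]: "blinfun_apply (c *\<^sub>o A) x = c *\<^sub>C blinfun_apply A x"
  by (simp add: scaleC_op.rep_eq)

text \<open>Calculations exhibit adjoints explicitly, so a relation is more convenient than \<open>adj\<close>, which is a
  definite description.\<close>

definition adjoint_pair :: "'h::complex_hilbert oper \<Rightarrow> 'h oper \<Rightarrow> bool"
  where "adjoint_pair A B \<longleftrightarrow> (\<forall>x y. cinner (A x) y = cinner x (B y))"

lemma adjoint_pair_unique: "adjoint_pair A B \<Longrightarrow> adjoint_pair A C \<Longrightarrow> B = C"
  unfolding adjoint_pair_def by (metis blinfun_eqI cinner_ext)

lemma adj_eqI: assumes "adjoint_pair A B" shows "adj A = B"
proof -
  have "(THE C. adjoint_pair A C) = B"
    by (rule the_equality) (use assms adjoint_pair_unique in blast)+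
  then show ?thesis by (simp add: adj_def adjoint_pair_def)
qed

lemma adjoint_pair_sym: "adjoint_pair A B \<Longrightarrow> adjoint_pair B A"
  unfolding adjoint_pair_def by (metis cinner_commute)

text \<open>Existence of adjoints, from the Riesz representation in the underlying real Hilbert space;
  complex linearity of \<open>A\<close> then carries the identity over to the complex inner product.\<close>

lemma adjoint_pair_adj:
  fixes A :: "'h::complex_hilbert oper"
  assumes A: "A \<in> bounded_ops"
  shows "adjoint_pair A (adj A)"
proof -
  have "\<exists>z. \<forall>x. inner (A x) y = inner x z" for y
  proof -
    have "bounded_linear (\<lambda>x. inner (A x) y)"
      by (intro bounded_linear_intros)
    from Riesz_representation[OF this] show ?thesis by metis
  qed
  then obtain B where B: "\<And>x y. inner (A x) y = inner x (B y)" by metis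
  have ext: "u = v" if "\<And>x. inner x u = inner x v" for u v :: 'h
  proof -
    have "inner (u - v) (u - v) = 0" using that[of "u - v"] by (simp add: inner_diff_right)
    then show ?thesis by simp
  qed
  have nB: "norm (B y) \<le> norm A * norm y" for y
  proof (cases "B y = 0")
    case False
    have "(norm (B y))\<^sup>2 = inner (A (B y)) y" using B by (simp add: power2_norm_eq_inner)
    also have "\<dots> \<le> norm A * norm (B y) * norm y"
      by (meson norm_cauchy_schwarz mult_right_mono norm_blinfun norm_ge_zero order_trans)
    finally show ?thesis using False by (simp add: power2_eq_square mult.commute mult.left_commute)
  qed simp
  have "bounded_linear B"
  proof (rule bounded_linear_intro[where K = "norm A"])
    show "B (x + y) = B x + B y" for x y
      by (rule ext) (simp add: inner_add_right flip: B)
    show "B (r *\<^sub>R x) = r *\<^sub>R B x" for r x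
      by (rule ext) (simp flip: B)
    show "norm (B x) \<le> norm x * norm A" for x
      using nB[of x] by (simp add: mult.commute)
  qed
  then have "blinfun_apply (Blinfun B) = B" by (simp add: bounded_linear_Blinfun_apply)
  moreover have "cinner (A x) y = cinner x (B y)" for x y
  proof -
    have "A (\<i> *\<^sub>C x) = \<i> *\<^sub>C A x" using A by (simp add: bounded_ops_def)
    then show ?thesis using B[of x y] B[of "\<i> *\<^sub>C x" y] by (simp add: cinner_eq_inner)
  qed
  ultimately have "adjoint_pair A (Blinfun B)" by (simp add: adjoint_pair_def)
  then show ?thesis using adj_eqI by metis
qed

section \<open>Algebra of bounded operators\<close>

interpretation opc: bounded_bilinear "(o\<^sub>L) :: 'h::real_normed_vector \<Rightarrow>\<^sub>L 'h \<Rightarrow> _"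
  by (rule bounded_bilinear_blinfun_compose)

lemma scaleC_diff_right: "c *\<^sub>C (x - y) = c *\<^sub>C x - c *\<^sub>C (y::'h::complex_hilbert)"
  by (metis add_diff_cancel diff_add_cancel scaleC_add_right)

lemma scaleC_one [simp]: "1 *\<^sub>C (x::'h::complex_hilbert) = x"
  by (metis of_real_1 scaleR_one scaleR_scaleC)

lemma scaleC_zero_left [simp]: "0 *\<^sub>C (x::'h::complex_hilbert) = 0"
  by (metis of_real_0 scaleR_zero_left scaleR_scaleC)

lemma scaleC_zero_right [simp]: "c *\<^sub>C (0::'h::complex_hilbert) = 0"
  by (metis add_cancel_right_right scaleC_add_right)

lemma scaleC_minus_right: "c *\<^sub>C (- y) = - (c *\<^sub>C (y::'h::complex_hilbert))"
  using scaleC_diff_right[of c 0 y] by simp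

lemma scaleC_minus_left: "(- c) *\<^sub>C y = - (c *\<^sub>C (y::'h::complex_hilbert))"
  by (metis add.right_inverse add_eq_0_iff scaleC_add_left scaleC_zero_left)

lemma scaleC_scaleR: "c *\<^sub>C (r *\<^sub>R x) = r *\<^sub>R (c *\<^sub>C (x::'h::complex_hilbert))"
  by (simp add: scaleR_scaleC scaleC_scaleC mult.commute)

lemma op_comp_assoc: "(A o\<^sub>L B) o\<^sub>L C = A o\<^sub>L (B o\<^sub>L C)"
  by (rule blinfun_eqI) simp

lemma op_id [simp]: "id_blinfun o\<^sub>L A = A" "A o\<^sub>L id_blinfun = A"
  by (auto intro: blinfun_eqI)

lemma scaleC_op_add: "c *\<^sub>o (A + B) = c *\<^sub>o A + c *\<^sub>o B"
  by (rule blinfun_eqI) (simp add: blinfun.add_left scaleC_add_right)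

lemma scaleC_op_diff: "c *\<^sub>o (A - B) = c *\<^sub>o A - c *\<^sub>o B"
  by (rule blinfun_eqI) (simp add: blinfun.diff_left scaleC_diff_right)

lemma scaleC_op_minus: "c *\<^sub>o (- A) = - (c *\<^sub>o A)"
  by (rule blinfun_eqI) (simp add: blinfun.minus_left scaleC_minus_right)

lemma scaleC_op_minus_left: "(- c) *\<^sub>o A = - (c *\<^sub>o A)"
  by (rule blinfun_eqI) (simp add: blinfun.minus_left scaleC_minus_left)

lemma scaleC_op_scaleC: "c *\<^sub>o d *\<^sub>o A = (c * d) *\<^sub>o A"
  by (rule blinfun_eqI) (simp add: scaleC_scaleC)

lemma scaleC_op_add_left: "(c + d) *\<^sub>o A = c *\<^sub>o A + d *\<^sub>o A"
  by (rule blinfun_eqI) (simp add: scaleC_add_left blinfun.add_left)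

lemma scaleR_op_conv: "r *\<^sub>R A = complex_of_real r *\<^sub>o A"
  by (rule blinfun_eqI) (simp add: blinfun.scaleR_left scaleR_scaleC)

lemma scaleC_op_one [simp]: "1 *\<^sub>o A = A"
  by (rule blinfun_eqI) simp

lemma scaleC_op_zero [simp]: "0 *\<^sub>o A = 0" "c *\<^sub>o 0 = 0"
  by (auto intro: blinfun_eqI)

lemma scaleC_op_comp_left: "(c *\<^sub>o A) o\<^sub>L B = c *\<^sub>o (A o\<^sub>L B)"
  by (rule blinfun_eqI) simp

lemma scaleC_op_comp_right:
  assumes "A \<in> bounded_ops" shows "A o\<^sub>L (c *\<^sub>o B) = c *\<^sub>o (A o\<^sub>L B)"
  using assms by (intro blinfun_eqI) (simp add: bounded_ops_def)

lemma norm_scaleC_op: "norm (c *\<^sub>o A) = cmod c * norm A"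
proof -
  have le: "norm (c *\<^sub>o A) \<le> cmod c * norm A" for c and A :: "'h::complex_hilbert oper"
    by (rule norm_blinfun_bound)
      (auto simp: norm_scaleC mult.assoc intro!: mult_left_mono norm_blinfun)
  show ?thesis
  proof (cases "c = 0")
    case False
    have "norm A = norm (inverse c *\<^sub>o c *\<^sub>o A)" using False by (simp add: scaleC_op_scaleC)
    also have "\<dots> \<le> inverse (cmod c) * norm (c *\<^sub>o A)" using le norm_inverse by metis
    finally have "cmod c * norm A \<le> norm (c *\<^sub>o A)" using False by (simp add: field_simps)
    then show ?thesis using le[of c A] by simp
  qed simp
qed

lemmas op_distrib = opc.add_left opc.add_right opc.diff_left opc.diff_right opc.minus_left
  opc.minus_right opc.scaleR_left opc.scaleR_right op_comp_assoc

lemma bounded_opsI: "(\<And>c x. blinfun_apply A (c *\<^sub>C x) = c *\<^sub>C blinfun_apply A x) \<Longrightarrow> A \<in> bounded_ops"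
  by (simp add: bounded_ops_def)

lemma bounded_opsD: "A \<in> bounded_ops \<Longrightarrow> A (c *\<^sub>C x) = c *\<^sub>C A x"
  by (simp add: bounded_ops_def)

named_theorems bops

lemma bounded_ops_id [bops]: "id_blinfun \<in> bounded_ops" by (simp add: bounded_ops_def)
lemma bounded_ops_0 [bops]: "0 \<in> bounded_ops" by (simp add: bounded_ops_def)
lemma bounded_ops_add [bops]: "A \<in> bounded_ops \<Longrightarrow> B \<in> bounded_ops \<Longrightarrow> A + B \<in> bounded_ops"
  by (simp add: bounded_ops_def blinfun.add_left scaleC_add_right)
lemma bounded_ops_diff [bops]: "A \<in> bounded_ops \<Longrightarrow> B \<in> bounded_ops \<Longrightarrow> A - B \<in> bounded_ops"
  by (simp add: bounded_ops_def blinfun.diff_left scaleC_diff_right)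
lemma bounded_ops_scaleR [bops]: "A \<in> bounded_ops \<Longrightarrow> r *\<^sub>R A \<in> bounded_ops"
  by (simp add: bounded_ops_def blinfun.scaleR_left scaleC_scaleR)
lemma bounded_ops_scaleC [bops]: "A \<in> bounded_ops \<Longrightarrow> c *\<^sub>o A \<in> bounded_ops"
  by (simp add: bounded_ops_def scaleC_scaleC mult.commute)
lemma bounded_ops_comp [bops]: "A \<in> bounded_ops \<Longrightarrow> B \<in> bounded_ops \<Longrightarrow> A o\<^sub>L B \<in> bounded_ops"
  by (simp add: bounded_ops_def)
lemma bounded_ops_sum [bops]: "(\<And>i. i \<in> I \<Longrightarrow> f i \<in> bounded_ops) \<Longrightarrow> sum f I \<in> bounded_ops"
  by (induction I rule: infinite_finite_induct) (simp_all add: bops)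

lemma adjoint_pairD: "adjoint_pair A B \<Longrightarrow> cinner (A x) y = cinner x (B y)"
  by (simp add: adjoint_pair_def)

lemma cinner_scaleR_left: "cinner (r *\<^sub>R x) (y::'h::complex_hilbert) = r * cinner x y"
  by (simp add: scaleR_scaleC cinner_scaleC_left)
lemma cinner_scaleR_right: "cinner x (r *\<^sub>R (y::'h::complex_hilbert)) = r * cinner x y"
  by (simp add: scaleR_scaleC cinner_scaleC_right)

named_theorems adjp

lemma adjoint_pair_id [adjp]: "adjoint_pair id_blinfun id_blinfun" by (simp add: adjoint_pair_def)
lemma adjoint_pair_add [adjp]:
  "adjoint_pair A A' \<Longrightarrow> adjoint_pair B B' \<Longrightarrow> adjoint_pair (A + B) (A' + B')"
  by (simp add: adjoint_pair_def blinfun.add_left cinner_add_left cinner_add_right)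
lemma adjoint_pair_diff [adjp]:
  "adjoint_pair A A' \<Longrightarrow> adjoint_pair B B' \<Longrightarrow> adjoint_pair (A - B) (A' - B')"
  by (simp add: adjoint_pair_def blinfun.diff_left cinner_diff_left cinner_diff_right)
lemma adjoint_pair_scaleR [adjp]: "adjoint_pair A A' \<Longrightarrow> adjoint_pair (r *\<^sub>R A) (r *\<^sub>R A')"
  by (simp add: adjoint_pair_def blinfun.scaleR_left cinner_scaleR_left cinner_scaleR_right)
lemma adjoint_pair_scaleC: "adjoint_pair A A' \<Longrightarrow> adjoint_pair (c *\<^sub>o A) (cnj c *\<^sub>o A')"
  by (simp add: adjoint_pair_def cinner_scaleC_left cinner_scaleC_right)
lemma adjoint_pair_comp [adjp]:
  "adjoint_pair A A' \<Longrightarrow> adjoint_pair B B' \<Longrightarrow> adjoint_pair (A o\<^sub>L B) (B' o\<^sub>L A')"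
  by (simp add: adjoint_pair_def)
lemma adjoint_pair_0 [adjp]: "adjoint_pair 0 0"
  by (simp add: adjoint_pair_def cinner_eq_inner)

definition hermitian :: "'h::complex_hilbert oper \<Rightarrow> bool"
  where "hermitian A \<longleftrightarrow> A \<in> bounded_ops \<and> adjoint_pair A A"

text \<open>Real quadratic forms suffice to express positivity because self-adjointness is kept
  separately; this makes the order accessible to real inner product lemmas.\<close>

definition nonneg_op :: "'h::complex_hilbert oper \<Rightarrow> bool"
  where "nonneg_op A \<longleftrightarrow> hermitian A \<and> (\<forall>x. 0 \<le> inner x (A x))"

named_theorems herm

lemma hermitian_id [herm]: "hermitian id_blinfun" by (simp add: hermitian_def adjp bops)
lemma hermitian_0 [herm]: "hermitian 0" by (simp add: hermitian_def adjp bops)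
lemma hermitian_add [herm]: "hermitian A \<Longrightarrow> hermitian B \<Longrightarrow> hermitian (A + B)"
  by (simp add: hermitian_def adjp bops)
lemma hermitian_diff [herm]: "hermitian A \<Longrightarrow> hermitian B \<Longrightarrow> hermitian (A - B)"
  by (simp add: hermitian_def adjp bops)
lemma hermitian_scaleR [herm]: "hermitian A \<Longrightarrow> hermitian (r *\<^sub>R A)"
  by (simp add: hermitian_def adjp bops)
lemma hermitian_comp: "hermitian A \<Longrightarrow> hermitian B \<Longrightarrow> A o\<^sub>L B = B o\<^sub>L A \<Longrightarrow> hermitian (A o\<^sub>L B)"
  by (metis adjoint_pair_comp bounded_ops_comp hermitian_def)

lemma hermitian_inner: "hermitian A \<Longrightarrow> inner (A x) y = inner x (A y)"
  by (simp add: hermitian_def adjoint_pair_def inner_eq_Re_cinner)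

lemma nonneg_op_hermitian: "nonneg_op A \<Longrightarrow> hermitian A" by (simp add: nonneg_op_def)

lemma nonneg_op_imp_positive_op:
  assumes "nonneg_op A" shows "positive_op A"
proof -
  have "cinner x (A x) \<in> \<real>\<^sub>\<ge>\<^sub>0" for x
  proof -
    have "cnj (cinner x (A x)) = cinner x (A x)"
      using assms by (metis adjoint_pairD cinner_commute hermitian_def nonneg_op_def)
    then have "Im (cinner x (A x)) = 0" by (metis Reals_cnj_iff complex_is_Real_iff)
    moreover have "Re (cinner x (A x)) \<ge> 0"
      using assms by (simp add: nonneg_op_def inner_eq_Re_cinner)
    ultimately show ?thesis by (simp add: complex_nonneg_Reals_iff)
  qed
  then show ?thesis using assms by (simp add: positive_op_def nonneg_op_def hermitian_def)
qed

lemma nonneg_op_add: "nonneg_op A \<Longrightarrow> nonneg_op B \<Longrightarrow> nonneg_op (A + B)"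
  by (simp add: nonneg_op_def herm blinfun.add_left inner_add_right)
lemma nonneg_op_scaleR: "nonneg_op A \<Longrightarrow> r \<ge> 0 \<Longrightarrow> nonneg_op (r *\<^sub>R A)"
  by (simp add: nonneg_op_def herm blinfun.scaleR_left)
lemma nonneg_op_0: "nonneg_op 0" by (simp add: nonneg_op_def herm)
lemma nonneg_op_id: "nonneg_op id_blinfun" by (simp add: nonneg_op_def herm)

lemma nonneg_op_conj:
  assumes "adjoint_pair B B'" "B \<in> bounded_ops" "B' \<in> bounded_ops" "nonneg_op A"
  shows "nonneg_op (B' o\<^sub>L A o\<^sub>L B)"
proof -
  have "inner x (B' (A (B x))) = inner (B x) (A (B x))" for x
    using assms(1) by (simp add: inner_eq_Re_cinner adjoint_pairD)
  moreover have "adjoint_pair (B' o\<^sub>L A o\<^sub>L B) (B' o\<^sub>L (A o\<^sub>L B))"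
    using assms(4) by (intro adjoint_pair_comp assms(1) adjoint_pair_sym[OF assms(1)])
      (simp add: nonneg_op_def hermitian_def)
  ultimately show ?thesis using assms
    by (simp add: nonneg_op_def hermitian_def bops op_comp_assoc)
qed

lemma nonneg_op_sandwich: "hermitian Q \<Longrightarrow> nonneg_op A \<Longrightarrow> nonneg_op (Q o\<^sub>L A o\<^sub>L Q)"
  by (rule nonneg_op_conj) (simp_all add: hermitian_def)

text \<open>By polarisation the quadratic form of a self-adjoint operator controls its norm.\<close>

lemma hermitian_norm_le:
  assumes D: "hermitian D" and e: "\<And>x. \<bar>inner x (D x)\<bar> \<le> e * (norm x)\<^sup>2" and "e \<ge> 0"
  shows "norm D \<le> e"
proof (rule norm_blinfun_bound)
  fix x
  show "norm (D x) \<le> e * norm x"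
  proof (cases "D x = 0 \<or> x = 0")
    case False
    define t where "t = norm x / norm (D x)"
    define y where "y = t *\<^sub>R D x"
    have ny: "norm y = norm x" using False by (simp add: y_def t_def)
    have "4 * inner y (D x) = inner (x + y) (D (x + y)) - inner (x - y) (D (x - y))"
      using hermitian_inner[OF D, of x y] hermitian_inner[OF D, of y x]
      by (simp add: blinfun.add_right blinfun.diff_right inner_add_left inner_add_right
          inner_diff_left inner_diff_right inner_commute)
    also have "\<dots> \<le> e * ((norm (x + y))\<^sup>2 + (norm (x - y))\<^sup>2)"
      using e[of "x + y"] e[of "x - y"] by (simp add: distrib_left)
    also have "(norm (x + y))\<^sup>2 + (norm (x - y))\<^sup>2 = 4 * (norm x)\<^sup>2"
      using ny[THEN arg_cong[where f = "\<lambda>u. u\<^sup>2"]] unfolding power2_norm_eq_inner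
      by (simp add: inner_add_left inner_add_right inner_diff_left inner_diff_right inner_commute)
    finally have "inner y (D x) \<le> e * (norm x)\<^sup>2" by simp
    also have "inner y (D x) = norm x * norm (D x)"
      using False by (simp add: y_def t_def dot_square_norm power2_eq_square)
    finally show ?thesis using False by (simp add: power2_eq_square mult.left_commute)
  qed (use assms(3) in auto)
qed fact

lemma nonneg_sandwich_norm_le:
  assumes "nonneg_op (e *\<^sub>R id_blinfun - D)" "nonneg_op (e *\<^sub>R id_blinfun + D)" "e \<ge> 0"
  shows "norm D \<le> e"
proof (rule hermitian_norm_le)
  have "hermitian ((e *\<^sub>R id_blinfun + D) - e *\<^sub>R id_blinfun)"
    by (intro hermitian_diff[OF nonneg_op_hermitian[OF assms(2)] hermitian_scaleR[OF hermitian_id]])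
  then show "hermitian D" by simp
  fix x
  have "0 \<le> inner x ((e *\<^sub>R id_blinfun - D) x)" "0 \<le> inner x ((e *\<^sub>R id_blinfun + D) x)"
    using assms by (auto simp: nonneg_op_def)
  then show "\<bar>inner x (D x)\<bar> \<le> e * (norm x)\<^sup>2"
    by (simp add: blinfun.add_left blinfun.diff_left blinfun.scaleR_left inner_add_right
        inner_diff_right power2_norm_eq_inner)
qed fact

lemma bounded_ops_lim:
  assumes "X \<longlonglongrightarrow> L" "\<And>n. X n \<in> bounded_ops" shows "L \<in> bounded_ops"
proof (rule bounded_opsI)
  fix c x
  have bl: "bounded_linear (\<lambda>x::'a. c *\<^sub>C x)"
    by (rule bounded_linear_intro[where K = "cmod c"])
      (simp_all add: scaleC_add_right scaleC_scaleR mult.commute norm_scaleC)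
  have "(\<lambda>n. X n (c *\<^sub>C x)) \<longlonglongrightarrow> L (c *\<^sub>C x)" by (intro tendsto_intros assms)
  moreover have "(\<lambda>n. c *\<^sub>C X n x) \<longlonglongrightarrow> c *\<^sub>C L x"
    by (intro bounded_linear.tendsto[OF bl] tendsto_intros assms)
  ultimately show "L (c *\<^sub>C x) = c *\<^sub>C L x"
    using assms(2) LIMSEQ_unique by (simp add: bounded_opsD)
qed

lemma hermitian_lim:
  assumes "X \<longlonglongrightarrow> L" "\<And>n. hermitian (X n)" shows "hermitian L"
proof -
  have "cinner (L x) y = cinner x (L y)" for x y
  proof -
    have "inner (L x) y = inner x (L y)" for x y
    proof -
      have "(\<lambda>n. inner (X n x) y) \<longlonglongrightarrow> inner (L x) y" by (intro tendsto_intros assms)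
      moreover have "(\<lambda>n. inner x (X n y)) \<longlonglongrightarrow> inner x (L y)" by (intro tendsto_intros assms)
      ultimately show ?thesis using assms(2) LIMSEQ_unique by (simp add: hermitian_inner)
    qed
    moreover have "L \<in> bounded_ops" using bounded_ops_lim assms by (metis hermitian_def)
    ultimately show ?thesis by (metis bounded_opsD cinner_eq_inner)
  qed
  then show ?thesis using bounded_ops_lim assms by (metis adjoint_pair_def hermitian_def)
qed

lemma nonneg_op_lim:
  assumes "X \<longlonglongrightarrow> L" "\<And>n. nonneg_op (X n)" shows "nonneg_op L"
proof -
  have "0 \<le> inner x (L x)" for x
  proof -
    have "(\<lambda>n. inner x (X n x)) \<longlonglongrightarrow> inner x (L x)" by (intro tendsto_intros assms)
    then show ?thesis by (rule LIMSEQ_le_const) (use assms(2) in \<open>auto simp: nonneg_op_def\<close>)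
  qed
  then show ?thesis using hermitian_lim assms by (metis nonneg_op_def)
qed

lemma isometry_norm_le:
  fixes A :: "'h::real_normed_vector \<Rightarrow>\<^sub>L 'h"
  shows "(\<And>x. norm (A x) = norm x) \<Longrightarrow> norm A \<le> 1"
  by (rule norm_blinfun_bound) auto

text \<open>An isometry has norm at most one. Equality can fail on the zero space, so only the inequality is
  ever available.\<close>

lemma adjoint_left_inverse_norm:
  assumes "adjoint_pair A B" "B o\<^sub>L A = id_blinfun" shows "norm A \<le> 1"
proof (rule isometry_norm_le)
  fix x
  have "inner (A x) (A x) = inner x ((B o\<^sub>L A) x)"
    using assms(1) by (simp add: inner_eq_Re_cinner adjoint_pairD)
  then show "norm (A x) = norm x" by (simp add: assms(2) norm_eq_sqrt_inner)
qed

section \<open>Continuous functional calculus\<close>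

definition op_poly :: "'h::complex_hilbert oper \<Rightarrow> real poly \<Rightarrow> 'h oper"
  where "op_poly T p = fold_coeffs (\<lambda>a S. a *\<^sub>R id_blinfun + (T o\<^sub>L S)) p 0"

lemma op_poly_0 [simp]: "op_poly T 0 = 0" by (simp add: op_poly_def)

lemma op_poly_pCons: "op_poly T (pCons a p) = a *\<^sub>R id_blinfun + (T o\<^sub>L op_poly T p)"
  by (cases "p = 0"; cases "a = 0") (simp_all add: op_poly_def)

lemma op_poly_add: "op_poly T (p + q) = op_poly T p + op_poly T q"
proof (induction p arbitrary: q)
  case (pCons a p)
  obtain b r where "q = pCons b r" by (cases q)
  then show ?case using pCons.IH by (simp add: op_poly_pCons op_distrib scaleR_add_left)
qed simp

lemma op_poly_smult: "op_poly T (smult c p) = c *\<^sub>R op_poly T p"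
  by (induction p) (simp_all add: op_poly_pCons op_distrib scaleR_add_right)

lemma op_poly_diff: "op_poly T (p - q) = op_poly T p - op_poly T q"
  using op_poly_add[of T "p - q" q] by (simp add: algebra_simps)

lemma op_poly_mult: "op_poly T (p * q) = op_poly T p o\<^sub>L op_poly T q"
  by (induction p) (simp_all add: op_poly_add op_poly_smult op_poly_pCons op_distrib)

lemma op_poly_1 [simp]: "op_poly T 1 = id_blinfun"
  by (simp add: one_pCons op_poly_pCons)

lemma op_poly_X [simp]: "op_poly T [:0, 1:] = T"
  by (simp add: op_poly_pCons)

lemma op_poly_1mX [simp]: "op_poly T [:1, -1:] = id_blinfun - T"
  by (simp add: op_poly_pCons op_distrib)

lemma op_poly_commute: "A o\<^sub>L T = T o\<^sub>L A \<Longrightarrow> A o\<^sub>L op_poly T p = op_poly T p o\<^sub>L A"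
  by (induction p) (simp_all add: op_poly_pCons op_distrib, metis op_comp_assoc)

lemma hermitian_op_poly: "hermitian T \<Longrightarrow> hermitian (op_poly T p)"
  by (induction p) (auto simp: op_poly_pCons op_poly_commute[symmetric] intro!: herm hermitian_comp)

lemma smult_sum_right: "smult c (sum f I) = (\<Sum>i\<in>I. smult c (f i))"
  by (induction I rule: infinite_finite_induct) (simp_all add: smult_add_right)

text \<open>Bernstein polynomials are taken as formal polynomials, so that the first two moments of the
  binomial distribution become operator identities through evaluation at an operator.\<close>

definition bern :: "nat \<Rightarrow> nat \<Rightarrow> real poly"
  where "bern n k = smult (of_nat (n choose k)) ([:0,1:]^k * [:1,-1:]^(n-k))"

lemma poly_bern: "poly (bern n k) x = Bernstein n k x"
  by (simp add: bern_def Bernstein_def mult.assoc)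

lemma bern_sum: "(\<Sum>k\<le>n. bern n k) = 1"
  by (intro poly_eq_poly_eq_iff[THEN iffD1] ext) (simp add: poly_sum poly_bern)

lemma bern_sum1: "n > 0 \<Longrightarrow> (\<Sum>k\<le>n. smult (k / n) (bern n k)) = [:0,1:]"
proof (intro poly_eq_poly_eq_iff[THEN iffD1] ext)
  fix x :: real assume "n > 0"
  have "poly (\<Sum>k\<le>n. smult (k / n) (bern n k)) x = (\<Sum>k\<le>n. real k * Bernstein n k x) / n"
    by (simp only: poly_sum poly_bern poly_smult sum_divide_distrib times_divide_eq_left)
  also have "\<dots> = poly [:0,1:] x" unfolding sum_k_Bernstein using \<open>n > 0\<close> by simp
  finally show "poly (\<Sum>k\<le>n. smult (k / n) (bern n k)) x = poly [:0,1:] x" .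
qed

lemma bern_sum2:
  "n > 0 \<Longrightarrow> (\<Sum>k\<le>n. smult ((k / n)\<^sup>2) (bern n k)) = [:0,1:]^2 + smult (1 / n) ([:0,1:] * [:1,-1:])"
proof (intro poly_eq_poly_eq_iff[THEN iffD1] ext)
  fix x :: real assume n: "n > 0"
  have "poly (\<Sum>k\<le>n. smult ((k / n)\<^sup>2) (bern n k)) x
      = (\<Sum>k\<le>n. real k * (real k - 1) * Bernstein n k x + real k * Bernstein n k x) / n\<^sup>2"
    by (simp add: poly_sum poly_bern sum_divide_distrib power_divide power2_eq_square algebra_simps)
  also have "\<dots> = (real n * (real n - 1) * x\<^sup>2 + real n * x) / n\<^sup>2"
    by (simp only: sum.distrib sum_kk_Bernstein sum_k_Bernstein)
  also have "\<dots> = poly ([:0,1:]^2 + smult (1 / n) ([:0,1:] * [:1,-1:])) x"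
    using n by (simp add: power2_eq_square field_simps)
  finally show "poly (\<Sum>k\<le>n. smult ((k / n)\<^sup>2) (bern n k)) x
    = poly ([:0,1:]^2 + smult (1 / n) ([:0,1:] * [:1,-1:])) x" .
qed

text \<open>Uniform continuity in a form adapted to Chebyshev's inequality: far from the diagonal the quadratic
  term dominates the oscillation of \<open>f\<close>.\<close>

lemma modulus_quadratic:
  fixes f :: "real \<Rightarrow> real"
  assumes f: "continuous_on {0..1} f" and e: "e > 0"
  obtains M where "M \<ge> 0" "\<And>x y. x \<in> {0..1} \<Longrightarrow> y \<in> {0..1} \<Longrightarrow> \<bar>f x - f y\<bar> \<le> e + M * (x - y)\<^sup>2"
proof -
  have "compact (f ` {0..1})" by (rule compact_continuous_image[OF f]) simp
  then obtain F where F: "\<And>x. x \<in> {0..1} \<Longrightarrow> \<bar>f x\<bar> \<le> F"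
    using compact_imp_bounded bounded_iff by (metis image_eqI real_norm_def)
  have F0: "F \<ge> 0" using F[of 0] by simp
  obtain d where d: "d > 0" "\<And>x y. x \<in> {0..1} \<Longrightarrow> y \<in> {0..1} \<Longrightarrow> dist y x < d \<Longrightarrow> dist (f y) (f x) < e"
    using compact_uniformly_continuous[OF f] e unfolding uniformly_continuous_on_def
    by (metis compact_Icc)
  show ?thesis
  proof (rule that[of "2 * F / d\<^sup>2"])
    fix x y :: real assume xy: "x \<in> {0..1}" "y \<in> {0..1}"
    show "\<bar>f x - f y\<bar> \<le> e + 2 * F / d\<^sup>2 * (x - y)\<^sup>2"
    proof (cases "\<bar>x - y\<bar> < d")
      case True
      then have "\<bar>f x - f y\<bar> < e" using d(2)[OF xy(2) xy(1)] by (simp add: dist_real_def)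
      moreover have "0 \<le> 2 * F / d\<^sup>2 * (x - y)\<^sup>2" using F0 by simp
      ultimately show ?thesis by linarith
    next
      case False
      then have "d\<^sup>2 \<le> \<bar>x - y\<bar>\<^sup>2" using d(1) by (intro power_mono) auto
      then have "d\<^sup>2 \<le> (x - y)\<^sup>2" by simp
      then have "2 * F * 1 \<le> 2 * F * ((x - y)\<^sup>2 / d\<^sup>2)" using F0 d(1) by (intro mult_left_mono) auto
      moreover have "\<bar>f x - f y\<bar> \<le> 2 * F" using F[OF xy(1)] F[OF xy(2)] by linarith
      ultimately show ?thesis using e by simp
    qed
  qed (use F0 in simp)
qed

lemma unit_grid: "k \<le> n \<Longrightarrow> real k / real n \<in> {0..1}"
  by (cases "n = 0") (auto simp: field_simps)

text \<open>The continuous functional calculus of an operator \<open>0 \<le> T \<le> 1\<close> is the limit of the Bernstein sums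
  \<open>\<Sum>k\<le>n. f (k/n) b\<^sub>n\<^sub>,\<^sub>k(T)\<close>. All \<open>T\<^sup>a (1 - T)\<^sup>b\<close> are positive, so these sums behave like expectations with
  operator-valued weights, and the probabilistic proof of the Weierstrass theorem goes through in
  operator norm. Spectral measures do not enter.\<close>

locale interval_op =
  fixes T :: "'h::complex_hilbert oper"
  assumes T_nonneg: "nonneg_op T" and T_le_id: "nonneg_op (id_blinfun - T)"
begin

lemma T_hermitian: "hermitian T" using T_nonneg by (rule nonneg_op_hermitian)

definition pos_poly :: "real poly \<Rightarrow> bool" where "pos_poly p \<longleftrightarrow> nonneg_op (op_poly T p)"

lemma pos_poly_add: "pos_poly p \<Longrightarrow> pos_poly q \<Longrightarrow> pos_poly (p + q)"
  by (simp add: pos_poly_def op_poly_add nonneg_op_add)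

lemma pos_poly_smult: "pos_poly p \<Longrightarrow> c \<ge> 0 \<Longrightarrow> pos_poly (smult c p)"
  by (simp add: pos_poly_def op_poly_smult nonneg_op_scaleR)

lemma pos_poly_sum: "(\<And>i. i \<in> I \<Longrightarrow> pos_poly (f i)) \<Longrightarrow> pos_poly (sum f I)"
  by (induction I rule: infinite_finite_induct) (simp_all add: pos_poly_add, simp_all add: pos_poly_def nonneg_op_0)

lemma pos_poly_square_mult: "pos_poly p \<Longrightarrow> pos_poly (q * q * p)"
proof -
  assume "pos_poly p"
  then have "pos_poly (q * p * q)"
    unfolding pos_poly_def op_poly_mult
    by (intro nonneg_op_sandwich hermitian_op_poly T_hermitian)
  then show ?thesis by (simp add: mult.commute mult.left_commute)
qed

lemma pos_poly_1: "pos_poly 1" by (simp add: pos_poly_def nonneg_op_id)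
lemma pos_poly_X: "pos_poly [:0,1:]" by (simp add: pos_poly_def T_nonneg)
lemma pos_poly_1mX: "pos_poly [:1,-1:]" by (simp add: pos_poly_def T_le_id)

text \<open>A product of commuting positive operators, exhibited as a sum of sandwiched positive ones.\<close>

lemma pos_poly_X1mX: "pos_poly ([:0,1:] * [:1,-1:])"
proof -
  have "[:0,1:] * [:1,-1::real:] = [:1,-1:] * [:1,-1:] * [:0,1:] + [:0,1:] * [:0,1:] * [:1,-1:]"
    by simp
  then show ?thesis
    using pos_poly_add pos_poly_square_mult pos_poly_X pos_poly_1mX by presburger
qed

text \<open>Even powers are absorbed into a square; what remains is one of \<open>1\<close>, \<open>T\<close>, \<open>1 - T\<close>, \<open>T (1 - T)\<close>.\<close>

lemma pos_poly_monomial: "pos_poly ([:0,1:]^a * [:1,-1:]^b)"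
proof -
  define q where "q = [:0,1::real:]^(a div 2) * [:1,-1:]^(b div 2)"
  have half: "p ^ n = p^(n div 2) * p^(n div 2) * p^(n mod 2)" for p :: "real poly" and n
    by (metis mult_2 mult_div_mod_eq power_add)
  have "[:0,1::real:]^a * [:1,-1:]^b = q * q * ([:0,1:]^(a mod 2) * [:1,-1:]^(b mod 2))"
    unfolding q_def by (subst half[of _ a], subst half[of _ b]) (simp only: ac_simps)
  moreover have "pos_poly ([:0,1:]^(a mod 2) * [:1,-1:]^(b mod 2))"
    by (cases "even a"; cases "even b")
      (simp_all add: mod_2_eq_odd pos_poly_1 pos_poly_X pos_poly_1mX pos_poly_X1mX[simplified])
  ultimately show ?thesis by (simp add: pos_poly_square_mult)
qed

lemma pos_poly_bern: "pos_poly (bern n k)"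
  unfolding bern_def by (intro pos_poly_smult pos_poly_monomial) simp

lemma pos_poly_bern2: "pos_poly (bern n k * bern m l)"
proof -
  have "bern n k * bern m l = smult (of_nat (n choose k) * of_nat (m choose l))
      ([:0,1:]^(k + l) * [:1,-1:]^((n-k) + (m-l)))"
    by (simp add: bern_def power_add ac_simps)
  then show ?thesis by (simp only:) (intro pos_poly_smult pos_poly_monomial, simp)
qed

lemma op_poly_norm_le:
  assumes "pos_poly (smult e 1 - p)" "pos_poly (smult e 1 + p)" "e \<ge> 0"
  shows "norm (op_poly T p) \<le> e"
  using assms by (intro nonneg_sandwich_norm_le)
    (simp_all only: pos_poly_def op_poly_add op_poly_diff op_poly_smult op_poly_1)

text \<open>A double Bernstein sum concentrates near the diagonal: with weights \<open>(k/n - l/m)\<^sup>2\<close> it equals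
  \<open>(1/n + 1/m) T (1 - T)\<close>.  Convergence and multiplicativity of the functional calculus both
  reduce to this bound.\<close>

lemma bern_double_norm_le:
  assumes n: "n > 0" and m: "m > 0" and e: "e \<ge> 0" and M: "M \<ge> 0"
    and a: "\<And>k l. k \<le> n \<Longrightarrow> l \<le> m \<Longrightarrow> \<bar>a k l\<bar> \<le> e + M * (k / n - l / m)\<^sup>2"
  shows "norm (op_poly T (\<Sum>k\<le>n. \<Sum>l\<le>m. smult (a k l) (bern n k * bern m l))) \<le> e + M * (1/n + 1/m)"
    (is "norm (op_poly T ?P) \<le> ?b")
proof -
  define c where "c k l = e + M * (real k / n - real l / m)\<^sup>2" for k l
  define w where "w k l = bern n k * bern m l" for k l
  define Q where "Q = (\<Sum>k\<le>n. \<Sum>l\<le>m. smult (c k l) (w k l))"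
  define X where "X = [:0, 1::real:]"
  define Y where "Y = [:1, -1::real:]"
  have w1: "(\<Sum>k\<le>n. \<Sum>l\<le>m. w k l) = 1"
    by (simp add: w_def bern_sum flip: sum_distrib_left)
  have "(\<Sum>k\<le>n. \<Sum>l\<le>m. smult ((real k / n)\<^sup>2) (w k l)) = (\<Sum>k\<le>n. smult ((real k / n)\<^sup>2) (bern n k)) * (\<Sum>l\<le>m. bern m l)"
    by (simp add: w_def sum_product)
  then have w2: "(\<Sum>k\<le>n. \<Sum>l\<le>m. smult ((real k / n)\<^sup>2) (w k l)) = X^2 + smult (1/n) (X * Y)"
    by (simp only: bern_sum2[OF n] bern_sum X_def Y_def mult_1_right)
  have "(\<Sum>k\<le>n. \<Sum>l\<le>m. smult ((real l / m)\<^sup>2) (w k l)) = (\<Sum>k\<le>n. bern n k) * (\<Sum>l\<le>m. smult ((real l / m)\<^sup>2) (bern m l))"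
    by (simp add: w_def sum_product)
  then have w3: "(\<Sum>k\<le>n. \<Sum>l\<le>m. smult ((real l / m)\<^sup>2) (w k l)) = X^2 + smult (1/m) (X * Y)"
    by (simp only: bern_sum2[OF m] bern_sum X_def Y_def mult_1_left)
  have "(\<Sum>k\<le>n. \<Sum>l\<le>m. smult ((real k / n) * (real l / m)) (w k l))
      = (\<Sum>k\<le>n. smult (real k / n) (bern n k)) * (\<Sum>l\<le>m. smult (real l / m) (bern m l))"
    unfolding w_def sum_product by (intro sum.cong refl) (simp add: mult.commute)
  then have w4: "(\<Sum>k\<le>n. \<Sum>l\<le>m. smult ((real k / n) * (real l / m)) (w k l)) = X^2"
    by (simp only: bern_sum1[OF n] bern_sum1[OF m] X_def power2_eq_square)
  have "smult (c k l) (w k l) = smult e (w k l) + smult M (smult ((real k / n)\<^sup>2) (w k l)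
      + smult ((real l / m)\<^sup>2) (w k l) - smult 2 (smult ((real k / n) * (real l / m)) (w k l)))" for k l
    by (simp add: c_def power2_diff algebra_simps smult_add_left smult_diff_left smult_add_right smult_diff_right)
  then have "Q = smult e (\<Sum>k\<le>n. \<Sum>l\<le>m. w k l)
      + smult M ((\<Sum>k\<le>n. \<Sum>l\<le>m. smult ((real k / n)\<^sup>2) (w k l))
      + (\<Sum>k\<le>n. \<Sum>l\<le>m. smult ((real l / m)\<^sup>2) (w k l))
      - smult 2 (\<Sum>k\<le>n. \<Sum>l\<le>m. smult ((real k / n) * (real l / m)) (w k l)))"
    by (simp only: Q_def sum.distrib sum_subtractf smult_sum_right[symmetric])
  then have Q0: "Q = smult e 1 + smult M (X^2 + smult (1/n) (X * Y) + (X^2 + smult (1/m) (X * Y)) - smult 2 (X^2))"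
    unfolding w1 w2 w3 w4 .
  have Q: "Q = smult e 1 + smult (M * (1/n + 1/m)) (X * Y)"
  proof (intro poly_eq_poly_eq_iff[THEN iffD1] ext)
    fix x
    show "poly Q x = poly (smult e 1 + smult (M * (1/n + 1/m)) (X * Y)) x"
      unfolding Q0 poly_add poly_diff poly_smult poly_mult poly_power poly_1 by algebra
  qed
  have pw: "pos_poly (w k l)" for k l unfolding w_def by (rule pos_poly_bern2)
  have "pos_poly (1 - X * Y)"
  proof -
    have eq: "1 - X * Y = Y + X * X * 1" by (simp add: X_def Y_def one_pCons)
    show ?thesis unfolding eq unfolding Y_def
      by (rule pos_poly_add[OF pos_poly_1mX pos_poly_square_mult[OF pos_poly_1]])
  qed
  then have "pos_poly (smult (M * (1/n + 1/m)) (1 - X * Y))" by (rule pos_poly_smult) (use M in simp)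
  moreover have "smult ?b 1 - Q = smult (M * (1/n + 1/m)) (1 - X * Y)"
  proof (intro poly_eq_poly_eq_iff[THEN iffD1] ext)
    fix x
    show "poly (smult ?b 1 - Q) x = poly (smult (M * (1/n + 1/m)) (1 - X * Y)) x"
      unfolding Q poly_add poly_diff poly_smult poly_mult poly_1 by algebra
  qed
  ultimately have bQ: "pos_poly (smult ?b 1 - Q)" by simp
  have "pos_poly (\<Sum>k\<le>n. \<Sum>l\<le>m. smult (c k l - a k l) (w k l))"
  proof (intro pos_poly_sum pos_poly_smult pw)
    fix k l assume "k \<in> {..n}" "l \<in> {..m}"
    then show "0 \<le> c k l - a k l" using a[of k l] by (auto simp: c_def abs_le_iff)
  qed
  then have 1: "pos_poly (Q - ?P)"
    by (simp only: Q_def w_def smult_diff_left sum_subtractf)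
  have "pos_poly (\<Sum>k\<le>n. \<Sum>l\<le>m. smult (c k l + a k l) (w k l))"
  proof (intro pos_poly_sum pos_poly_smult pw)
    fix k l assume "k \<in> {..n}" "l \<in> {..m}"
    then show "0 \<le> c k l + a k l" using a[of k l] by (auto simp: c_def abs_le_iff)
  qed
  then have 2: "pos_poly (Q + ?P)"
    by (simp only: Q_def w_def smult_add_left sum.distrib)
  show ?thesis
  proof (rule op_poly_norm_le)
    show "pos_poly (smult ?b 1 - ?P)" using pos_poly_add[OF bQ 1] by simp
    show "pos_poly (smult ?b 1 + ?P)" using pos_poly_add[OF bQ 2] by simp
    show "0 \<le> ?b" using e M by simp
  qed
qed

definition bernp :: "nat \<Rightarrow> (real \<Rightarrow> real) \<Rightarrow> real poly"
  where "bernp n f = (\<Sum>k\<le>n. smult (f (k / n)) (bern n k))"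

text \<open>The index starts at \<open>1\<close> because the grid \<open>k/n\<close> degenerates for \<open>n = 0\<close>.\<close>

definition fcalc :: "(real \<Rightarrow> real) \<Rightarrow> 'h oper"
  where "fcalc f = lim (\<lambda>n. op_poly T (bernp (Suc n) f))"

lemma bernp_norm_le:
  assumes "n > 0" "\<And>x. 0 \<le> x \<Longrightarrow> x \<le> 1 \<Longrightarrow> \<bar>f x\<bar> \<le> c"
  shows "norm (op_poly T (bernp n f)) \<le> c"
proof -
  have c: "\<bar>f (real k / n)\<bar> \<le> c" if "k \<le> n" for k
    using assms(2)[of "real k / n"] unit_grid[OF that] by simp
  have d: "smult c 1 = (\<Sum>k\<le>n. smult c (bern n k))"
    by (simp add: bern_sum flip: smult_sum_right)
  show ?thesis
  proof (rule op_poly_norm_le)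
    have "pos_poly (\<Sum>k\<le>n. smult (c - f (k/n)) (bern n k))"
      using c by (intro pos_poly_sum pos_poly_smult pos_poly_bern) (auto simp: abs_le_iff)
    then show "pos_poly (smult c 1 - bernp n f)"
      by (simp only: d bernp_def smult_diff_left sum_subtractf)
    have "pos_poly (\<Sum>k\<le>n. smult (c + f (k/n)) (bern n k))"
    proof (intro pos_poly_sum pos_poly_smult pos_poly_bern)
      fix k assume "k \<in> {..n}"
      then show "0 \<le> c + f (k/n)" using c[of k] by (auto simp: abs_le_iff)
    qed
    then show "pos_poly (smult c 1 + bernp n f)"
      by (simp only: d bernp_def smult_add_left sum.distrib)
    show "0 \<le> c" using c[of 0] by simp
  qed
qed

text \<open>Both partitions of unity are inserted, so that two Bernstein sums differ by a double sum with
  coefficients \<open>f (k/n) - f (l/m)\<close>, which are small near the diagonal.\<close>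

lemma fcalc_Cauchy:
  assumes f: "continuous_on {0..1} f"
  shows "Cauchy (\<lambda>n. op_poly T (bernp (Suc n) f))"
proof (rule CauchyI)
  fix e :: real assume e: "e > 0"
  obtain M where M: "M \<ge> 0" "\<And>x y. x \<in> {0..1} \<Longrightarrow> y \<in> {0..1} \<Longrightarrow> \<bar>f x - f y\<bar> \<le> e/2 + M * (x - y)\<^sup>2"
    using modulus_quadratic[OF f, of "e/2"] e by auto
  obtain K where K: "(M + 1) * (2 / real (Suc K)) < e / 2"
  proof -
    obtain K where "inverse (real (Suc K)) < e / (4 * (M + 1))"
      using reals_Archimedean[of "e / (4 * (M + 1))"] e M(1) by auto
    then show ?thesis using M(1) by (intro that[of K]) (simp add: field_simps)
  qed
  have "norm (op_poly T (bernp (Suc n) f) - op_poly T (bernp (Suc m) f)) < e" if "n \<ge> K" "m \<ge> K" for n m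
  proof -
    let ?N = "Suc n" and ?M = "Suc m"
    have "bernp ?N f = bernp ?N f * (\<Sum>l\<le>?M. bern ?M l)"
      "bernp ?M f = (\<Sum>k\<le>?N. bern ?N k) * bernp ?M f"
      by (simp_all only: bern_sum mult_1_left mult_1_right)
    then have "bernp ?N f - bernp ?M f =
        (\<Sum>k\<le>?N. \<Sum>l\<le>?M. smult (f (k/?N)) (bern ?N k * bern ?M l)) - (\<Sum>k\<le>?N. \<Sum>l\<le>?M. smult (f (l/?M)) (bern ?N k * bern ?M l))"
      by (simp only: bernp_def sum_product mult_smult_left mult_smult_right)
    also have "\<dots> = (\<Sum>k\<le>?N. \<Sum>l\<le>?M. smult (f (k/?N) - f (l/?M)) (bern ?N k * bern ?M l))"
      by (simp only: smult_diff_left sum_subtractf)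
    finally have "norm (op_poly T (bernp ?N f) - op_poly T (bernp ?M f)) \<le> e/2 + M * (1/?N + 1/?M)"
      unfolding op_poly_diff[symmetric]
      using M e by (simp only:) (intro bern_double_norm_le, auto intro!: M(2) unit_grid simp del: of_nat_Suc)
    also have "\<dots> \<le> e/2 + (M + 1) * (2 / real (Suc K))"
    proof -
      have "1/?N \<le> 1/real (Suc K)" "1/?M \<le> 1/real (Suc K)" using that by (auto intro!: divide_left_mono)
      then have "1/?N + 1/?M \<le> 2 / real (Suc K)" by linarith
      then show ?thesis using M(1) by (intro add_left_mono mult_mono) auto
    qed
    finally show ?thesis using K by linarith
  qed
  then show "\<exists>K. \<forall>m\<ge>K. \<forall>n\<ge>K. norm (op_poly T (bernp (Suc m) f) - op_poly T (bernp (Suc n) f)) < e"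
    by blast
qed

lemma fcalc_LIMSEQ:
  assumes "continuous_on {0..1} f"
  shows "(\<lambda>n. op_poly T (bernp (Suc n) f)) \<longlonglongrightarrow> fcalc f"
  using fcalc_Cauchy[OF assms] unfolding fcalc_def Cauchy_convergent_iff convergent_LIMSEQ_iff .

lemma bernp_cong: "(\<And>x. x \<in> {0..1} \<Longrightarrow> f x = g x) \<Longrightarrow> bernp n f = bernp n g"
proof -
  assume *: "\<And>x. x \<in> {0..1} \<Longrightarrow> f x = g x"
  show ?thesis
    unfolding bernp_def
  proof (intro sum.cong refl)
    fix k assume "k \<in> {..n}"
    then have "f (k / n) = g (k / n)" by (intro * unit_grid) simp
    then show "smult (f (k / n)) (bern n k) = smult (g (k / n)) (bern n k)" by simp
  qed
qed

lemma fcalc_cong: "(\<And>x. x \<in> {0..1} \<Longrightarrow> f x = g x) \<Longrightarrow> fcalc f = fcalc g"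
  unfolding fcalc_def by (metis bernp_cong)

lemma fcalc_hermitian: "continuous_on {0..1} f \<Longrightarrow> hermitian (fcalc f)"
  by (rule hermitian_lim[OF fcalc_LIMSEQ]) (auto intro: hermitian_op_poly T_hermitian)

lemma fcalc_nonneg:
  assumes "continuous_on {0..1} f" "\<And>x. x \<in> {0..1} \<Longrightarrow> f x \<ge> 0"
  shows "nonneg_op (fcalc f)"
proof (rule nonneg_op_lim[OF fcalc_LIMSEQ[OF assms(1)]])
  fix n
  have "pos_poly (bernp (Suc n) f)"
    unfolding bernp_def by (intro pos_poly_sum pos_poly_smult pos_poly_bern assms(2) unit_grid) auto
  then show "nonneg_op (op_poly T (bernp (Suc n) f))" by (simp add: pos_poly_def)
qed

lemma fcalc_norm_le:
  assumes "continuous_on {0..1} f" "\<And>x. x \<in> {0..1} \<Longrightarrow> \<bar>f x\<bar> \<le> c"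
  shows "norm (fcalc f) \<le> c"
proof (rule Lim_norm_ubound[OF _ fcalc_LIMSEQ[OF assms(1)]])
  show "\<forall>\<^sub>F n in sequentially. norm (op_poly T (bernp (Suc n) f)) \<le> c"
    using assms(2) by (intro always_eventually allI bernp_norm_le) auto
qed simp

lemma fcalc_add:
  assumes "continuous_on {0..1} f" "continuous_on {0..1} g"
  shows "fcalc (\<lambda>x. f x + g x) = fcalc f + fcalc g"
proof -
  have "(\<lambda>n. op_poly T (bernp (Suc n) f) + op_poly T (bernp (Suc n) g)) \<longlonglongrightarrow> fcalc f + fcalc g"
    by (intro tendsto_add fcalc_LIMSEQ assms)
  moreover have "op_poly T (bernp n f) + op_poly T (bernp n g) = op_poly T (bernp n (\<lambda>x. f x + g x))" for n
    by (simp add: bernp_def smult_add_left sum.distrib op_poly_add)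
  moreover have "(\<lambda>n. op_poly T (bernp (Suc n) (\<lambda>x. f x + g x))) \<longlonglongrightarrow> fcalc (\<lambda>x. f x + g x)"
    by (intro fcalc_LIMSEQ continuous_intros assms)
  ultimately show ?thesis using LIMSEQ_unique by auto
qed

lemma fcalc_scaleR:
  assumes "continuous_on {0..1} f"
  shows "fcalc (\<lambda>x. c * f x) = c *\<^sub>R fcalc f"
proof -
  have "(\<lambda>n. c *\<^sub>R op_poly T (bernp (Suc n) f)) \<longlonglongrightarrow> c *\<^sub>R fcalc f"
    by (intro tendsto_intros fcalc_LIMSEQ assms)
  moreover have "c *\<^sub>R op_poly T (bernp n f) = op_poly T (bernp n (\<lambda>x. c * f x))" for n
    by (simp add: bernp_def smult_sum_right flip: op_poly_smult)
  moreover have "(\<lambda>n. op_poly T (bernp (Suc n) (\<lambda>x. c * f x))) \<longlonglongrightarrow> fcalc (\<lambda>x. c * f x)"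
    by (intro fcalc_LIMSEQ continuous_intros assms)
  ultimately show ?thesis using LIMSEQ_unique by auto
qed

lemma fcalc_diff:
  assumes "continuous_on {0..1} f" "continuous_on {0..1} g"
  shows "fcalc (\<lambda>x. f x - g x) = fcalc f - fcalc g"
proof -
  have "fcalc (\<lambda>x. f x + (-1) * g x) = fcalc f + (-1) *\<^sub>R fcalc g"
    using fcalc_scaleR[OF assms(2), of "-1"] fcalc_add[OF assms(1), of "\<lambda>x. (-1) * g x"] assms(2)
    by (simp add: continuous_on_minus)
  then show ?thesis by simp
qed

text \<open>The product of two Bernstein sums and the Bernstein sum of the product differ by a double sum with
  coefficients \<open>f (k/n) (g (l/n) - g (k/n))\<close>, again small near the diagonal.\<close>

lemma fcalc_mult:
  assumes f: "continuous_on {0..1} f" and g: "continuous_on {0..1} g"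
  shows "fcalc (\<lambda>x. f x * g x) = fcalc f o\<^sub>L fcalc g"
proof -
  let ?D = "\<lambda>n. (op_poly T (bernp (Suc n) f) o\<^sub>L op_poly T (bernp (Suc n) g)) - op_poly T (bernp (Suc n) (\<lambda>x. f x * g x))"
  have "compact (f ` {0..1})" by (rule compact_continuous_image[OF f]) simp
  then obtain F where F: "\<And>x. x \<in> {0..1} \<Longrightarrow> \<bar>f x\<bar> \<le> F"
    using compact_imp_bounded bounded_iff by (metis image_eqI real_norm_def)
  have F0: "F \<ge> 0" using F[of 0] by simp
  have lim: "?D \<longlonglongrightarrow> (fcalc f o\<^sub>L fcalc g) - fcalc (\<lambda>x. f x * g x)"
    by (intro tendsto_diff opc.tendsto fcalc_LIMSEQ continuous_intros f g)
  have "norm ((fcalc f o\<^sub>L fcalc g) - fcalc (\<lambda>x. f x * g x)) \<le> F * e" if e: "e > 0" for e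
  proof -
    obtain M where M: "M \<ge> 0" "\<And>x y. x \<in> {0..1} \<Longrightarrow> y \<in> {0..1} \<Longrightarrow> \<bar>g x - g y\<bar> \<le> e + M * (x - y)\<^sup>2"
      using modulus_quadratic[OF g e] by auto
    have b: "norm (?D n) \<le> F * e + F * M * (2 / real (Suc n))" for n
    proof -
      let ?N = "Suc n"
      let ?h = "\<lambda>x. f x * g x"
      have "bernp ?N f * bernp ?N g - bernp ?N ?h = bernp ?N f * bernp ?N g - bernp ?N ?h * (\<Sum>l\<le>?N. bern ?N l)"
        by (simp only: bern_sum mult_1_right)
      also have "\<dots> = (\<Sum>k\<le>?N. \<Sum>l\<le>?N. smult (f (k/?N) * g (l/?N)) (bern ?N k * bern ?N l))
           - (\<Sum>k\<le>?N. \<Sum>l\<le>?N. smult (?h (k/?N)) (bern ?N k * bern ?N l))"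
        by (simp only: bernp_def sum_product mult_smult_left mult_smult_right smult_smult)
          (simp only: mult.commute[of "g _" "f _"])
      also have "\<dots> = (\<Sum>k\<le>?N. \<Sum>l\<le>?N. smult (f (k/?N) * g (l/?N) - ?h (k/?N)) (bern ?N k * bern ?N l))"
        by (simp only: smult_diff_left sum_subtractf)
      finally have eq: "?D n = op_poly T \<dots>" by (simp only: op_poly_diff[symmetric] op_poly_mult[symmetric])
      have "norm (?D n) \<le> F * e + F * M * (1/?N + 1/?N)"
        unfolding eq
      proof (rule bern_double_norm_le)
        fix k l assume kl: "k \<le> ?N" "l \<le> ?N"
        have "\<bar>f (k/?N) * g (l/?N) - ?h (k/?N)\<bar> = \<bar>f (k/?N)\<bar> * \<bar>g (k/?N) - g (l/?N)\<bar>"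
          by (metis abs_minus_commute abs_mult right_diff_distrib)
        also have "\<dots> \<le> F * (e + M * (k/?N - l/?N)\<^sup>2)"
          by (intro mult_mono F M(2) unit_grid kl F0 abs_ge_zero)
        finally show "\<bar>f (k/?N) * g (l/?N) - ?h (k/?N)\<bar> \<le> F * e + F * M * (k/?N - l/?N)\<^sup>2"
          by (simp only: distrib_left mult.assoc)
      qed (use F0 M e in auto)
      then show ?thesis by (simp add: mult.assoc)
    qed
    have "(\<lambda>n. F * e + F * M * (2 * (1 / real (Suc n)))) \<longlonglongrightarrow> F * e + F * M * (2 * 0)"
      by (intro tendsto_intros LIMSEQ_inverse_real_of_nat[unfolded inverse_eq_divide])
    then have "norm ((fcalc f o\<^sub>L fcalc g) - fcalc (\<lambda>x. f x * g x)) \<le> F * e + F * M * (2 * 0)"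
      by (rule LIMSEQ_le[OF tendsto_norm[OF lim]]) (use b in auto)
    then show ?thesis by simp
  qed
  then have "norm ((fcalc f o\<^sub>L fcalc g) - fcalc (\<lambda>x. f x * g x)) \<le> 0"
  proof -
    assume *: "\<And>e. e > 0 \<Longrightarrow> norm ((fcalc f o\<^sub>L fcalc g) - fcalc (\<lambda>x. f x * g x)) \<le> F * e"
    show ?thesis
    proof (rule field_le_epsilon)
      fix e :: real assume "e > 0"
      then have "F * (e / (F + 1)) \<le> e" using F0 by (simp add: field_simps)
      then show "norm ((fcalc f o\<^sub>L fcalc g) - fcalc (\<lambda>x. f x * g x)) \<le> 0 + e"
        using *[of "e / (F + 1)"] F0 \<open>e > 0\<close> by simp
    qed
  qed
  then show ?thesis by simp
qed

lemma fcalc_const: "fcalc (\<lambda>x. c) = c *\<^sub>R id_blinfun"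
proof -
  have "op_poly T (bernp n (\<lambda>x. c)) = c *\<^sub>R id_blinfun" for n
    by (simp add: bernp_def bern_sum op_poly_pCons flip: smult_sum_right)
  then show ?thesis by (simp add: fcalc_def)
qed

lemma fcalc_ident: "fcalc (\<lambda>x. x) = T"
proof -
  have "op_poly T (bernp (Suc n) (\<lambda>x. x)) = T" for n
    by (simp only: bernp_def bern_sum1 op_poly_X zero_less_Suc)
  then show ?thesis by (simp add: fcalc_def)
qed

lemma fcalc_commute:
  assumes "continuous_on {0..1} f" "A o\<^sub>L T = T o\<^sub>L A"
  shows "A o\<^sub>L fcalc f = fcalc f o\<^sub>L A"
proof -
  have "(\<lambda>n. A o\<^sub>L op_poly T (bernp (Suc n) f)) \<longlonglongrightarrow> (A o\<^sub>L fcalc f)"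
    by (intro opc.tendsto tendsto_const fcalc_LIMSEQ assms)
  moreover have "(\<lambda>n. op_poly T (bernp (Suc n) f) o\<^sub>L A) \<longlonglongrightarrow> (fcalc f o\<^sub>L A)"
    by (intro opc.tendsto tendsto_const fcalc_LIMSEQ assms)
  ultimately show ?thesis unfolding op_poly_commute[OF assms(2)] by (rule LIMSEQ_unique)
qed

end

section \<open>The trigonometric moment problem\<close>

definition positive_definite :: "(int \<Rightarrow> complex) \<Rightarrow> bool"
  where "positive_definite p \<longleftrightarrow>
    (\<forall>n c. (\<Sum>j<n. \<Sum>l<n. c j * cnj (c l) * p (int j - int l)) \<in> \<real>\<^sub>\<ge>\<^sub>0)"

lemma integral_cis:
  "set_lebesgue_integral lborel {0..2*pi} (\<lambda>t. cis (of_int m * t)) = (if m = 0 then 2 * pi else 0)"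
proof -
  have "set_lebesgue_integral lborel {0..2*pi} (\<lambda>t. cis (of_int m * t)) = integral {0..2*pi} (\<lambda>t. cis (of_int m * t))"
    by (intro set_borel_integral_eq_integral borel_integrable_atLeastAtMost' continuous_intros)
  also have "\<dots> = (if m = 0 then 2 * pi else 0)"
  proof (cases "m = 0")
    case False
    have "((\<lambda>t. cis (of_int m * t)) has_integral
        (cis (of_int m * (2*pi)) / (\<i> * of_int m) - cis (of_int m * 0) / (\<i> * of_int m))) {0..2*pi}"
    proof (rule fundamental_theorem_of_calculus)
      fix x :: real
      have "((\<lambda>z. exp (\<i> * of_int m * z) / (\<i> * of_int m)) has_field_derivative
          exp (\<i> * of_int m * complex_of_real x)) (at (complex_of_real x))"
        using False by (auto intro!: derivative_eq_intros)
      from has_vector_derivative_real_field[OF this, of "{0..2*pi}"]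
      show "((\<lambda>t. cis (of_int m * t) / (\<i> * of_int m)) has_vector_derivative cis (of_int m * x)) (at x within {0..2*pi})"
        by (simp add: cis_conv_exp mult.assoc)
    qed simp
    moreover have "cis (of_int m * (2*pi)) = 1"
      using cis_multiple_2pi[of "of_int m"] by (simp add: mult.commute mult.left_commute)
    ultimately show ?thesis using False by (simp add: integral_unique)
  qed (simp add: scaleR_conv_of_real)
  finally show ?thesis .
qed

text \<open>Fejer means: averaging the Toeplitz forms turns a positive definite sequence into nonnegative
  trigonometric polynomials whose coefficients tend to the sequence.\<close>

definition fejer :: "(int \<Rightarrow> complex) \<Rightarrow> nat \<Rightarrow> real \<Rightarrow> complex"
  where "fejer p n t = (\<Sum>j<n. \<Sum>l<n. cis (- (of_int (int j - int l) * t)) * p (int j - int l)) / complex_of_real (2 * pi * real n)"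

text \<open>The Toeplitz form of \<open>p\<close> evaluated at the vector \<open>(e\<^sup>-\<^sup>i\<^sup>j\<^sup>t)\<^sub>j\<close>.\<close>

lemma fejer_nonneg: assumes "positive_definite p" shows "fejer p n t \<in> \<real>\<^sub>\<ge>\<^sub>0"
proof -
  have "(\<Sum>j<n. \<Sum>l<n. cis (- (real j * t)) * cnj (cis (- (real l * t))) * p (int j - int l)) \<in> \<real>\<^sub>\<ge>\<^sub>0"
    by (rule assms[unfolded positive_definite_def, rule_format, of "\<lambda>j. cis (- (real j * t))" n])
  moreover have "cis (- (real j * t)) * cnj (cis (- (real l * t))) = cis (- (of_int (int j - int l) * t))" for j l
    by (simp add: cis_cnj cis_mult algebra_simps)
  ultimately have "(\<Sum>j<n. \<Sum>l<n. cis (- (of_int (int j - int l) * t)) * p (int j - int l)) \<in> \<real>\<^sub>\<ge>\<^sub>0"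
    by simp
  then show ?thesis unfolding fejer_def
    by (intro nonneg_Reals_divide_I) (simp_all only: nonneg_Reals_of_real_iff, simp)
qed

lemma continuous_fejer: "continuous_on A (fejer p n)"
  unfolding fejer_def[abs_def] divide_inverse by (intro continuous_intros)

text \<open>The pairs \<open>(j, l)\<close> with \<open>j - l = k\<close> are counted by \<open>j\<close> alone, since \<open>l\<close> is then determined.\<close>

lemma fejer_moment:
  assumes "n > 0"
  shows "set_lebesgue_integral lborel {0..2*pi} (\<lambda>t. fejer p n t * cis (of_int k * t))
    = of_nat (card {j. j < n \<and> 0 \<le> int j - k \<and> int j - k < int n}) / of_nat n * p k"
proof -
  let ?I = "set_lebesgue_integral lborel {0..2*pi}"
  have int: "set_integrable lborel {0..2*pi} (\<lambda>t. c * cis (of_int m * t))" for c m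
    by (intro borel_integrable_atLeastAtMost' continuous_intros)
  have si_sum: "?I (\<lambda>t. \<Sum>j<m. g j t) = (\<Sum>j<m. ?I (g j))"
    if "\<And>j. set_integrable lborel {0..2*pi} (g j)" for m :: nat and g :: "nat \<Rightarrow> real \<Rightarrow> complex"
    using that unfolding set_lebesgue_integral_def set_integrable_def scaleR_sum_right
    by (intro Bochner_Integration.integral_sum) auto
  have si_int: "set_integrable lborel {0..2*pi} (\<lambda>t. \<Sum>j<m. g j t)"
    if "\<And>j. set_integrable lborel {0..2*pi} (g j)" for m :: nat and g :: "nat \<Rightarrow> real \<Rightarrow> complex"
    using that unfolding set_integrable_def scaleR_sum_right
    by (intro Bochner_Integration.integrable_sum) auto
  have "fejer p n t * cis (of_int k * t) =
      (\<Sum>j<n. \<Sum>l<n. (p (int j - int l) / complex_of_real (2 * pi * real n)) * cis (of_int (k - (int j - int l)) * t))" for t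
  proof -
    have "cis (of_int (k - (int j - int l)) * t) = cis (- (of_int (int j - int l) * t)) * cis (of_int k * t)" for j l
      by (simp add: cis_mult algebra_simps)
    then show ?thesis
      unfolding fejer_def sum_divide_distrib sum_distrib_right
      by (intro sum.cong refl) simp
  qed
  then have "?I (\<lambda>t. fejer p n t * cis (of_int k * t)) =
      ?I (\<lambda>t. (\<Sum>j<n. \<Sum>l<n. (p (int j - int l) / complex_of_real (2 * pi * real n)) * cis (of_int (k - (int j - int l)) * t)))"
    by simp
  also have "\<dots> = (\<Sum>j<n. \<Sum>l<n. (p (int j - int l) / complex_of_real (2 * pi * real n)) * ?I (\<lambda>t. cis (of_int (k - (int j - int l)) * t)))"
    by (simp only: si_sum int si_int set_integral_mult_right)
  also have "\<dots> = (\<Sum>j<n. \<Sum>l<n. if int l = int j - k then p k / n else 0)"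
    unfolding integral_cis by (intro sum.cong refl) (auto simp: algebra_simps, metis add_diff_cancel_right')
  also have "\<dots> = (\<Sum>j<n. if 0 \<le> int j - k \<and> int j - k < int n then p k / n else 0)"
  proof (intro sum.cong refl)
    fix j assume "j \<in> {..<n}"
    show "(\<Sum>l<n. if int l = int j - k then p k / n else 0) = (if 0 \<le> int j - k \<and> int j - k < int n then p k / n else 0)"
    proof (cases "0 \<le> int j - k \<and> int j - k < int n")
      case True
      then have "(int l = int j - k) = (l = nat (int j - k))" for l by linarith
      then show ?thesis using True by (simp add: sum.delta nat_less_iff)
    next
      case False
      then show ?thesis by (auto intro!: sum.neutral)
    qed
  qed
  also have "\<dots> = of_nat (card {j. j < n \<and> 0 \<le> int j - k \<and> int j - k < int n}) / of_nat n * p k"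
  proof -
    have "{..<n} \<inter> {j. 0 \<le> int j - k \<and> int j - k < int n} = {j. j < n \<and> 0 \<le> int j - k \<and> int j - k < int n}"
      by auto
    then show ?thesis by (simp add: sum.If_cases)
  qed
  finally show ?thesis .
qed

lemma fejer_weight_tendsto:
  "(\<lambda>n. of_nat (card {j. j < Suc n \<and> 0 \<le> int j - k \<and> int j - k < int (Suc n)}) / of_nat (Suc n) :: complex) \<longlonglongrightarrow> 1"
proof -
  let ?c = "\<lambda>n. card {j. j < n \<and> 0 \<le> int j - k \<and> int j - k < int n}"
  have up: "?c n \<le> n" for n
    using card_mono[of "{..<n}" "{j. j < n \<and> 0 \<le> int j - k \<and> int j - k < int n}"] by auto
  have lo: "n \<le> ?c n + nat \<bar>k\<bar>" for n
  proof -
    have "{..<n} \<subseteq> {j. j < n \<and> 0 \<le> int j - k \<and> int j - k < int n} \<union> (if k \<ge> 0 then {..<nat k} else {n - nat (-k)..<n})"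
      by auto
    then have "n \<le> card ({j. j < n \<and> 0 \<le> int j - k \<and> int j - k < int n} \<union> (if k \<ge> 0 then {..<nat k} else {n - nat (-k)..<n}))"
      using card_mono[of _ "{..<n}"] by fastforce
    also have "\<dots> \<le> ?c n + card (if k \<ge> 0 then {..<nat k} else {n - nat (-k)..<n})" by (rule card_Un_le)
    also have "\<dots> \<le> ?c n + nat \<bar>k\<bar>" by auto
    finally show ?thesis .
  qed
  have "(\<lambda>n. real (?c (Suc n)) / real (Suc n)) \<longlonglongrightarrow> 1"
  proof (rule tendsto_sandwich)
    show "\<forall>\<^sub>F n in sequentially. 1 - real (nat \<bar>k\<bar>) * (1 / real (Suc n)) \<le> real (?c (Suc n)) / real (Suc n)"
    proof (intro always_eventually allI)
      fix n
      have "real (Suc n) \<le> real (?c (Suc n)) + real (nat \<bar>k\<bar>)" using lo[of "Suc n"] by linarith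
      then have "(real (Suc n) - real (nat \<bar>k\<bar>)) / real (Suc n) \<le> real (?c (Suc n)) / real (Suc n)"
        by (intro divide_right_mono) simp_all
      then show "1 - real (nat \<bar>k\<bar>) * (1 / real (Suc n)) \<le> real (?c (Suc n)) / real (Suc n)"
        by (simp add: diff_divide_distrib)
    qed
    show "\<forall>\<^sub>F n in sequentially. real (?c (Suc n)) / real (Suc n) \<le> 1"
    proof (intro always_eventually allI)
      fix n
      have "real (?c (Suc n)) \<le> real (Suc n)" using up of_nat_le_iff by blast
      then show "real (?c (Suc n)) / real (Suc n) \<le> 1"
        by (subst divide_le_eq_1_pos) (simp_all only: of_nat_0_less_iff zero_less_Suc)
    qed
    have "(\<lambda>n. 1 - real (nat \<bar>k\<bar>) * (1 / real (Suc n))) \<longlonglongrightarrow> 1 - real (nat \<bar>k\<bar>) * 0"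
      by (intro tendsto_intros LIMSEQ_inverse_real_of_nat[unfolded inverse_eq_divide])
    then show "(\<lambda>n. 1 - real (nat \<bar>k\<bar>) * (1 / real (Suc n))) \<longlonglongrightarrow> 1" by simp
  qed simp
  then have "(\<lambda>n. complex_of_real (real (?c (Suc n)) / real (Suc n))) \<longlonglongrightarrow> complex_of_real 1"
    by (intro tendsto_of_real)
  then show ?thesis by simp
qed

text \<open>The Fejer means are densities of measures on \<open>[0, 2\<pi>]\<close> with common mass \<open>p 0\<close>. By Helly's theorem a
  subsequence converges weakly on the line; integrals of the bounded continuous functions \<open>e\<^sup>i\<^sup>k\<^sup>t\<close> pass to
  the limit, and the limit is pushed forward to the circle.\<close>

theorem Herglotz:
  assumes pd: "positive_definite p"
  obtains \<nu> where "finite_measure \<nu>" "sets \<nu> = sets (restrict_space borel (sphere (0::complex) 1))"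
    "\<And>k. integral\<^sup>L \<nu> (\<lambda>z. z powi k) = p k" "emeasure \<nu> (space \<nu>) = ennreal (Re (p 0))"
proof -
  let ?T = "restrict_space borel (sphere (0::complex) 1)"
  define d where "d n t = indicator {0..2*pi} t * Re (fejer p (Suc n) t)" for n t
  have d_meas [measurable]: "d n \<in> borel_measurable borel" for n
  proof -
    have [measurable]: "(\<lambda>t. Re (fejer p (Suc n) t)) \<in> borel_measurable borel"
      by (intro borel_measurable_continuous_onI continuous_intros continuous_fejer)
    show ?thesis unfolding d_def[abs_def] by measurable
  qed
  have fr: "fejer p n t = of_real (Re (fejer p n t))" for n t
    using fejer_nonneg[OF pd, of n t] by (simp add: complex_eq_iff complex_nonneg_Reals_iff)
  have d0: "d n t \<ge> 0" for n t
    using fejer_nonneg[OF pd, of "Suc n" t] by (simp add: d_def complex_nonneg_Reals_iff)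
  have mom: "(\<integral>t. d n t *\<^sub>R cis (of_int k * t) \<partial>lborel) =
     of_nat (card {j. j < Suc n \<and> 0 \<le> int j - k \<and> int j - k < int (Suc n)}) / of_nat (Suc n) * p k" for n k
  proof -
    have "(\<integral>t. d n t *\<^sub>R cis (of_int k * t) \<partial>lborel) = set_lebesgue_integral lborel {0..2*pi} (\<lambda>t. fejer p (Suc n) t * cis (of_int k * t))"
      unfolding set_lebesgue_integral_def
      by (intro Bochner_Integration.integral_cong refl) (auto simp: d_def indicator_def scaleR_conv_of_real fr[symmetric])
    then show ?thesis using fejer_moment[of "Suc n" p k] by simp
  qed
  have dint: "integrable lborel (d n)" for n
  proof -
    have "set_integrable lborel {0..2*pi} (\<lambda>t. Re (fejer p (Suc n) t))"
      by (intro borel_integrable_atLeastAtMost' continuous_intros continuous_fejer)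
    then show ?thesis by (simp add: set_integrable_def d_def[abs_def])
  qed
  have p0: "p 0 = of_real (\<integral>t. d n t \<partial>lborel)" for n
  proof -
    have "{j. j < Suc n \<and> 0 \<le> int j - 0 \<and> int j - 0 < int (Suc n)} = {..<Suc n}" by auto
    then have "(\<integral>t. d n t *\<^sub>R (1::complex) \<partial>lborel) = p 0"
      using mom[of n 0] by (simp del: of_nat_Suc)
    then show ?thesis by (simp add: scaleR_conv_of_real)
  qed
  have m0: "(\<integral>t. d n t \<partial>lborel) = Re (p 0)" for n by (subst p0[of n]) simp
  have p0_ge: "Re (p 0) \<ge> 0" unfolding m0[of 0, symmetric] by (intro Bochner_Integration.integral_nonneg d0)
  have lim_p: "(\<lambda>n. \<integral>t. d n t *\<^sub>R cis (of_int k * t) \<partial>lborel) \<longlonglongrightarrow> p k" for k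
    unfolding mom using tendsto_mult[OF fejer_weight_tendsto tendsto_const, of k "p k"] by simp
  \<comment> \<open>Helly's theorem concerns probability measures, so a vanishing mass is treated apart.\<close>
  show ?thesis
  proof (cases "Re (p 0) = 0")
    case True
    have "p k = 0" for k
    proof -
      have "norm (\<integral>t. d n t *\<^sub>R cis (of_int k * t) \<partial>lborel) \<le> (\<integral>t. d n t \<partial>lborel)" for n
        by (rule order_trans[OF integral_norm_bound]) (simp add: d0)
      then have "(\<lambda>n. \<integral>t. d n t *\<^sub>R cis (of_int k * t) \<partial>lborel) = (\<lambda>n. 0)"
        using m0 True by (simp add: fun_eq_iff)
      then show ?thesis using lim_p[of k] LIMSEQ_unique tendsto_const by metis
    qed
    then show ?thesis
      by (intro that[of "null_measure ?T"]) (auto intro!: finite_measureI)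
  next
    case False
    define c where "c = Re (p 0)"
    have c: "c > 0" using False p0_ge by (simp add: c_def)
    define D where "D n = density lborel (\<lambda>t. ennreal (d n t / c))" for n
    have em: "emeasure (D n) A = ennreal (\<integral>t. indicator A t * (d n t / c) \<partial>lborel)" if [measurable]: "A \<in> sets borel" for n A
    proof -
      have "emeasure (D n) A = (\<integral>\<^sup>+t. ennreal (indicator A t * (d n t / c)) \<partial>lborel)"
        by (simp add: D_def emeasure_density) (intro nn_integral_cong, auto simp: indicator_def)
      also have "\<dots> = ennreal (\<integral>t. indicator A t * (d n t / c) \<partial>lborel)"
      proof (rule nn_integral_eq_integral)
        show "integrable lborel (\<lambda>t. indicator A t * (d n t / c))"
          using integrable_mult_indicator[of A lborel "\<lambda>t. d n t / c"] dint by simp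
      qed (use d0 c in auto)
      finally show ?thesis .
    qed
    have D1: "emeasure (D n) {-1<..2*pi} = 1" for n
    proof -
      have ind: "(\<lambda>t. indicator {-1<..2*pi} t * (d n t / c)) = (\<lambda>t. d n t / c)"
        by (auto simp: indicator_def d_def fun_eq_iff)
      have "emeasure (D n) {-1<..2*pi} = ennreal (\<integral>t. d n t / c \<partial>lborel)"
        unfolding ind[symmetric] by (rule em) simp
      then show ?thesis using m0[of n] c by (simp add: c_def)
    qed
    have D2: "emeasure (D n) (space (D n)) = 1" for n
      using em[of UNIV n] m0[of n] c by (simp add: D_def c_def)
    have rd: "real_distribution (D n)" for n
      unfolding real_distribution_def real_distribution_axioms_def
      using D2 by (auto intro: prob_spaceI) (simp_all add: D_def)
    have "tight D"
      unfolding tight_def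
    proof (intro conjI allI impI rd)
      fix e :: real assume "e > 0"
      have "measure (D n) {-1<..2*pi} = 1" for n using D1[of n] by (simp add: measure_def)
      then show "\<exists>a b. a < b \<and> (\<forall>n. 1 - e < measure (D n) {a<..b})"
        using \<open>e > 0\<close> by (intro exI[of _ "-1"] exI[of _ "2*pi"]) (simp add: order_less_trans[of "-1" 0])
    qed
    then obtain r M where r: "strict_mono (r :: nat \<Rightarrow> nat)" and M: "real_distribution M"
      and conv: "weak_conv_m (D \<circ> id \<circ> r) M"
      using tight_imp_convergent_subsubsequence[of D id] strict_mono_id by blast
    interpret M: real_distribution M by (rule M)
    have Mk: "(\<integral>t. cis (of_int k * t) \<partial>M) = p k / c" for k
    proof -
      have "(\<lambda>n. \<integral>t. cis (of_int k * t) \<partial>D (r n)) \<longlonglongrightarrow> (\<integral>t. cis (of_int k * t) \<partial>M)"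
      proof -
        have "\<And>n. real_distribution ((D \<circ> id \<circ> r) n)" by (simp add: rd)
        moreover have "continuous_on UNIV (\<lambda>t. cis (of_int k * t))" by (intro continuous_intros)
        then have "isCont (\<lambda>t. cis (of_int k * t)) x" for x :: real
          by (simp add: continuous_on_eq_continuous_at)
        ultimately show ?thesis
          using weak_conv_imp_integral_bdd_continuous_conv[OF _ M conv, of "\<lambda>t. cis (of_int k * t)" 1]
          by simp
      qed
      moreover have "(\<integral>t. cis (of_int k * t) \<partial>D n) = (\<integral>t. d n t *\<^sub>R cis (of_int k * t) \<partial>lborel) / c" for n
      proof -
        have "(\<integral>t. cis (of_int k * t) \<partial>D n) = (\<integral>t. (d n t / c) *\<^sub>R cis (of_int k * t) \<partial>lborel)"
          unfolding D_def
          by (intro integral_density borel_measurable_continuous_onI continuous_intros)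
             (use d0 c in \<open>auto intro!: borel_measurable_continuous_onI continuous_intros\<close>)
        also have "\<dots> = (\<integral>t. (d n t *\<^sub>R cis (of_int k * t)) / c \<partial>lborel)"
          by (intro Bochner_Integration.integral_cong refl) (simp add: scaleR_conv_of_real)
        finally show ?thesis by simp
      qed
      moreover have "(\<lambda>n. (\<integral>t. d (r n) t *\<^sub>R cis (of_int k * t) \<partial>lborel) / c) \<longlonglongrightarrow> p k / c"
        using LIMSEQ_subseq_LIMSEQ[OF lim_p r, of k] c by (intro tendsto_divide) (auto simp: o_def)
      ultimately show ?thesis using LIMSEQ_unique by auto
    qed
    have cis_m: "cis \<in> measurable M ?T"
    proof (rule measurable_restrict_space2)
      have "cis \<in> borel_measurable borel"
        by (intro borel_measurable_continuous_onI continuous_intros)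
      then show "cis \<in> borel_measurable M" by (simp cong: measurable_cong_sets)
    qed auto
    define \<nu> where "\<nu> = density (distr M ?T cis) (\<lambda>_. ennreal c)"
    have pw_m: "(\<lambda>z. z powi k) \<in> borel_measurable ?T" for k
      by (intro borel_measurable_continuous_on_restrict continuous_intros) auto
    show ?thesis
    proof (rule that[of \<nu>])
      show "sets \<nu> = sets ?T" by (simp add: \<nu>_def)
      have e: "emeasure \<nu> (space \<nu>) = ennreal c"
      proof -
        have sp: "space \<nu> = space (distr M ?T cis)" by (simp add: \<nu>_def)
        have "emeasure \<nu> (space \<nu>) = ennreal c * emeasure (distr M ?T cis) (space (distr M ?T cis))"
          unfolding sp unfolding \<nu>_def by (rule emeasure_density_const) (rule sets.top)
        also have "emeasure (distr M ?T cis) (space (distr M ?T cis)) = 1"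
          using M.prob_space_distr[OF cis_m] by (rule prob_space.emeasure_space_1)
        finally show ?thesis by simp
      qed
      then show "emeasure \<nu> (space \<nu>) = ennreal (Re (p 0))" by (simp add: c_def)
      show "finite_measure \<nu>" by (rule finite_measureI) (simp add: e)
      show "integral\<^sup>L \<nu> (\<lambda>z. z powi k) = p k" for k
      proof -
        have "integral\<^sup>L \<nu> (\<lambda>z. z powi k) = (\<integral>z. c *\<^sub>R (z powi k) \<partial>distr M ?T cis)"
          unfolding \<nu>_def using pw_m c by (intro integral_density) auto
        also have "\<dots> = (\<integral>t. c *\<^sub>R (cis t powi k) \<partial>M)"
          using pw_m by (intro integral_distr cis_m) auto
        also have "\<dots> = c *\<^sub>R (\<integral>t. cis (of_int k * t) \<partial>M)"
          by (simp add: cis_power_int)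
        finally show ?thesis using c by (simp add: Mk scaleR_conv_of_real)
      qed
    qed
  qed
qed

section \<open>The symmetry in the polar decomposition of a self-adjoint operator\<close>

lemma hermitianI:
  assumes A: "A \<in> bounded_ops" and "\<And>x y. inner (A x) y = inner x (A y)"
  shows "hermitian A"
proof -
  have "cinner (A x) y = cinner x (A y)" for x y
    using assms(2) bounded_opsD[OF A, of \<i> x] by (metis cinner_eq_inner)
  then show ?thesis using A by (simp add: hermitian_def adjoint_pair_def)
qed

text \<open>An operator that commutes with a self-adjoint one leaves the kernel of the latter invariant, and so
  does its adjoint; hence it commutes with the projection onto the kernel. This places the projection in every von
  Neumann algebra that contains the operator.\<close>

lemma kernel_projection:
  fixes D :: "'h::complex_hilbert oper"
  assumes D: "hermitian D"
  obtains P where "hermitian P" "\<And>x. D (P x) = 0" "\<And>x. D x = 0 \<Longrightarrow> P x = x"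
    "\<And>A. A \<in> bounded_ops \<Longrightarrow> A o\<^sub>L D = D o\<^sub>L A \<Longrightarrow> A o\<^sub>L P = P o\<^sub>L A"
proof -
  define K where "K = {x. D x = 0}"
  have DC: "D (c *\<^sub>C x) = c *\<^sub>C D x" for c x using D by (simp add: hermitian_def bounded_opsD)
  have cl: "closed K" unfolding K_def by (intro closed_Collect_eq continuous_intros)
  have sub: "subspace K" by (auto simp: K_def subspace_def blinfun.add_right blinfun.scaleR_right)
  have KC: "c *\<^sub>C x \<in> K" if "x \<in> K" for c x using that by (simp add: K_def DC)
  define isp where "isp x y \<longleftrightarrow> y \<in> K \<and> (\<forall>z\<in>K. inner (x - y) z = 0)" for x y
  have ex: "\<exists>y. isp x y" for x
    using orthogonal_decomposition[OF cl sub, of x] unfolding isp_def by metis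
  have uniq: "y = y'" if "isp x y" "isp x y'" for x y y'
  proof -
    have "y - y' \<in> K" using that sub by (auto simp: isp_def intro: subspace_diff)
    then have "inner (x - y') (y - y') = 0" "inner (x - y) (y - y') = 0" using that by (auto simp: isp_def)
    then have "inner (y - y') (y - y') = 0" by (simp add: inner_diff_left)
    then show ?thesis by simp
  qed
  obtain p where p: "\<And>x. isp x (p x)" using ex by metis
  have pe: "p x = y" if "isp x y" for x y using uniq[OF p that] .
  have addp: "p (x + y) = p x + p y" for x y
  proof (rule pe)
    have "inner (x + y - (p x + p y)) z = inner (x - p x) z + inner (y - p y) z" for z
      by (simp add: inner_diff_left inner_add_left)
    then show "isp (x + y) (p x + p y)" using p[of x] p[of y] sub by (auto simp: isp_def intro: subspace_add)
  qed
  have scalC: "p (c *\<^sub>C x) = c *\<^sub>C p x" for c x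
  proof (rule pe)
    have "inner (c *\<^sub>C x - c *\<^sub>C p x) z = inner (x - p x) (cnj c *\<^sub>C z)" for z
      by (simp add: scaleC_diff_right[symmetric] inner_eq_Re_cinner cinner_scaleC_left cinner_scaleC_right)
    then show "isp (c *\<^sub>C x) (c *\<^sub>C p x)" using p[of x] KC by (auto simp: isp_def)
  qed
  have np: "norm (p x) \<le> norm x" for x
  proof -
    have "inner (x - p x) (p x) = 0" using p[of x] by (auto simp: isp_def)
    then have "(norm (p x))\<^sup>2 = inner x (p x)" by (simp add: inner_diff_left power2_norm_eq_inner)
    also have "\<dots> \<le> norm x * norm (p x)" by (rule norm_cauchy_schwarz)
    finally show ?thesis by (cases "p x = 0") (auto simp: power2_eq_square)
  qed
  have bl: "bounded_linear p"
    by (rule bounded_linear_intro[where K = 1]) (auto simp: addp scaleR_scaleC scalC np)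
  define P where "P = Blinfun p"
  have Pp: "P x = p x" for x by (simp add: P_def bounded_linear_Blinfun_apply[OF bl])
  show ?thesis
  proof (rule that[of P])
    show "hermitian P"
    proof (rule hermitianI)
      show "P \<in> bounded_ops" by (rule bounded_opsI) (simp add: Pp scalC)
      fix x y
      have "inner (p x) (y - p y) = 0" "inner (x - p x) (p y) = 0"
        using p[of x] p[of y] by (auto simp: isp_def inner_commute)
      then show "inner (P x) y = inner x (P y)" by (simp add: Pp inner_diff_left inner_diff_right)
    qed
    show "D (P x) = 0" for x using p[of x] by (simp add: isp_def K_def Pp)
    show "P x = x" if "D x = 0" for x
      unfolding Pp using that by (intro pe) (simp add: isp_def K_def)
    fix A :: "'h oper" assume A: "A \<in> bounded_ops" "A o\<^sub>L D = D o\<^sub>L A"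
    have ap: "adjoint_pair A (adj A)" by (rule adjoint_pair_adj[OF A(1)])
    have DD: "adjoint_pair D D" using D by (simp add: hermitian_def)
    have "adjoint_pair (A o\<^sub>L D) (D o\<^sub>L adj A)" "adjoint_pair (D o\<^sub>L A) (adj A o\<^sub>L D)"
      by (intro adjoint_pair_comp ap DD)+
    then have c2: "D o\<^sub>L adj A = adj A o\<^sub>L D" using A(2) adjoint_pair_unique by metis
    have "p (A x) = A (p x)" for x
    proof (rule pe)
      have "D (A (p x)) = A (D (p x))" using A(2) by (metis blinfun_apply_blinfun_compose)
      then have 1: "A (p x) \<in> K" using p[of x] by (simp add: isp_def K_def)
      have "inner (A x - A (p x)) z = 0" if z: "z \<in> K" for z
      proof -
        have "D (adj A z) = adj A (D z)" using c2 by (metis blinfun_apply_blinfun_compose)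
        then have "adj A z \<in> K" using z by (simp add: K_def)
        moreover have "inner (A x - A (p x)) z = inner (x - p x) (adj A z)"
          using ap by (simp add: blinfun.diff_right[symmetric] inner_eq_Re_cinner adjoint_pairD)
        ultimately show ?thesis using p[of x] by (simp add: isp_def)
      qed
      then show "isp (A x) (A (p x))" using 1 by (simp add: isp_def)
    qed
    then show "A o\<^sub>L P = P o\<^sub>L A" by (intro blinfun_eqI) (simp add: Pp)
  qed
qed

text \<open>With \<open>G = \<bar>S\<bar>\<close> the kernel of \<open>G + S\<close> is the subspace on which \<open>S \<le> 0\<close>, and on its orthogonal complement
  \<open>G = S\<close>: for \<open>w\<close> in the complement, \<open>(G - S) w\<close> is annihilated by \<open>G + S\<close> and yet orthogonal to the kernel.
  The symmetry \<open>1 - 2 P\<close> is therefore the sign of \<open>S\<close>.\<close>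

lemma sign_projection:
  assumes S: "hermitian S" and G: "hermitian G" and SG: "S o\<^sub>L G = G o\<^sub>L S" and sq: "G o\<^sub>L G = S o\<^sub>L S"
  obtains P where "hermitian P" "P o\<^sub>L P = P" "(id_blinfun - 2 *\<^sub>R P) o\<^sub>L S = G"
    "\<And>A. A \<in> bounded_ops \<Longrightarrow> A o\<^sub>L G = G o\<^sub>L A \<Longrightarrow> A o\<^sub>L S = S o\<^sub>L A \<Longrightarrow> A o\<^sub>L P = P o\<^sub>L A"
proof -
  define D where "D = G + S"
  have D: "hermitian D" unfolding D_def by (intro herm G S)
  obtain P where P: "hermitian P" "\<And>x. D (P x) = 0" "\<And>x. D x = 0 \<Longrightarrow> P x = x"
    "\<And>A. A \<in> bounded_ops \<Longrightarrow> A o\<^sub>L D = D o\<^sub>L A \<Longrightarrow> A o\<^sub>L P = P o\<^sub>L A"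
    using kernel_projection[OF D] by blast
  have comm: "A o\<^sub>L P = P o\<^sub>L A" if "A \<in> bounded_ops" "A o\<^sub>L G = G o\<^sub>L A" "A o\<^sub>L S = S o\<^sub>L A" for A
    using that by (intro P(4)) (simp_all add: D_def op_distrib)
  have PP: "P (P x) = P x" for x by (rule P(3)[OF P(2)])
  have cS: "S (P x) = P (S x)" for x
    using comm[of S] S SG by (metis blinfun_apply_blinfun_compose hermitian_def)
  have cG: "G (P x) = P (G x)" for x
    using comm[of G] G SG by (metis blinfun_apply_blinfun_compose hermitian_def)
  have SGx: "S (G x) = G (S x)" for x using SG by (metis blinfun_apply_blinfun_compose)
  have sqx: "G (G x) = S (S x)" for x using sq by (metis blinfun_apply_blinfun_compose)
  have "S x - 2 *\<^sub>R P (S x) = G x" for x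
  proof -
    define k where "k = P x"
    define w where "w = x - k"
    have x: "x = w + k" by (simp add: w_def)
    have gk: "G k = - S k" using P(2)[of x] by (simp add: D_def k_def blinfun.add_left add_eq_0_iff)
    have pw: "P w = 0" by (simp add: w_def k_def blinfun.diff_right PP)
    define u where "u = G w - S w"
    have "D u = 0" by (simp add: D_def u_def blinfun.add_left blinfun.diff_right SGx sqx)
    then have "P u = u" by (rule P(3))
    moreover have "P u = 0" by (simp add: u_def blinfun.diff_right pw flip: cG cS)
    ultimately have gw: "G w = S w" by (simp add: u_def)
    have "P (S x) = S k" by (simp add: k_def cS)
    then show ?thesis unfolding x by (simp add: blinfun.add_right gk gw scaleR_2)
  qed
  then have "(id_blinfun - 2 *\<^sub>R P) o\<^sub>L S = G"
    by (intro blinfun_eqI) (simp add: blinfun.diff_left blinfun.scaleR_left)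
  moreover have "P o\<^sub>L P = P" by (rule blinfun_eqI) (simp add: PP)
  ultimately show ?thesis using that[of P] P(1) comm by blast
qed

section \<open>Scalar estimates\<close>

lemma continuous_on_difference_quotient:
  fixes f :: "real \<Rightarrow> real"
  assumes f: "continuous_on A f" "(f has_real_derivative d) (at 0)" "f 0 = 0"
  shows "continuous_on A (\<lambda>u. if u = 0 then d else f u / u)" (is "continuous_on A ?q")
  unfolding continuous_on_eq_continuous_within
proof
  fix u assume u: "u \<in> A"
  show "continuous (at u within A) ?q"
  proof (cases "u = 0")
    case True
    have "((\<lambda>h. f h / h) \<longlongrightarrow> d) (at 0)" using f(2,3) by (simp add: DERIV_def)
    moreover have "\<forall>\<^sub>F h in at 0. f h / h = ?q h" by (simp add: eventually_at_filter)
    ultimately have "(?q \<longlongrightarrow> d) (at 0)" by (rule Lim_transform_eventually)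
    then have "(?q \<longlongrightarrow> ?q 0) (at 0)" by simp
    then show ?thesis unfolding True continuous_within by (rule tendsto_within_subset) simp
  next
    case False
    have "(f \<longlongrightarrow> f u) (at u within A)" using f(1) u by (simp add: continuous_on_def)
    then have "((\<lambda>u. f u / u) \<longlongrightarrow> f u / u) (at u within A)"
      using False by (intro tendsto_divide tendsto_ident_at)
    then have "((\<lambda>u. f u / u) \<longlongrightarrow> ?q u) (at u within A)" using False by simp
    moreover have "\<forall>\<^sub>F v in at u within A. f v / v = ?q v"
      unfolding eventually_at using False by (intro exI[of _ "\<bar>u\<bar>"]) (auto simp: dist_real_def)
    ultimately show ?thesis unfolding continuous_within by (rule Lim_transform_eventually)
  qed
qed

text \<open>Real and imaginary parts of the second-order Taylor estimate for \<open>e\<^sup>i\<^sup>y\<close>.\<close>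

lemma cos_sin_approx:
  "\<bar>cos y - 1\<bar> \<le> y\<^sup>2 / 2" "\<bar>sin y - y\<bar> \<le> y\<^sup>2 / 2" for y :: real
proof -
  have "cmod (iexp y - (\<Sum>k\<le>1. (\<i> * y)^k / fact k)) \<le> \<bar>y\<bar>^(Suc 1) / fact (Suc 1)"
    by (rule iexp_approx1)
  then have *: "cmod (iexp y - 1 - \<i> * y) \<le> y\<^sup>2 / 2" by (simp add: numeral_2_eq_2 algebra_simps)
  have "\<bar>Re (iexp y - 1 - \<i> * y)\<bar> \<le> y\<^sup>2 / 2" "\<bar>Im (iexp y - 1 - \<i> * y)\<bar> \<le> y\<^sup>2 / 2"
    using * abs_Re_le_cmod abs_Im_le_cmod order_trans by blast+
  then show "\<bar>cos y - 1\<bar> \<le> y\<^sup>2 / 2" "\<bar>sin y - y\<bar> \<le> y\<^sup>2 / 2"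
    by (simp_all add: cis_conv_exp[symmetric])
qed

lemma abs_cos_minus_one_le: "\<bar>cos y - 1\<bar> \<le> \<bar>y :: real\<bar>"
proof -
  have "cmod (iexp y - (\<Sum>k\<le>0. (\<i> * y)^k / fact k)) \<le> \<bar>y\<bar>^(Suc 0) / fact (Suc 0)"
    by (rule iexp_approx1)
  then have "cmod (iexp y - 1) \<le> \<bar>y\<bar>" by simp
  then have "\<bar>Re (iexp y - 1)\<bar> \<le> \<bar>y\<bar>" using abs_Re_le_cmod order_trans by blast
  then show ?thesis by (simp add: cis_conv_exp[symmetric])
qed

text \<open>Jordan's inequality, from concavity of the sine. Its constant is the \<open>\<pi>/2\<close> in the bound for the total
  variation.\<close>

lemma arcsin_le: assumes "0 \<le> r" "r \<le> 1" shows "arcsin r \<le> pi / 2 * r"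
proof -
  have "concave_on {0..pi/2} sin"
  proof (rule f''_le0_imp_concave)
    show "convex {0..pi/2}" by simp
    show "DERIV sin x :> cos x" for x :: real by (auto intro!: derivative_eq_intros)
    show "DERIV cos x :> - sin x" for x :: real by (auto intro!: derivative_eq_intros)
    show "- sin x \<le> 0" if "x \<in> {0..pi/2}" for x :: real using that by (simp add: sin_ge_zero)
  qed
  then have "(1 - r) * sin 0 + r * sin (pi/2) \<le> sin ((1 - r) *\<^sub>R 0 + r *\<^sub>R (pi/2))"
    by (rule concave_onD) (use assms in auto)
  then have "r \<le> sin (r * (pi / 2))" by simp
  then have "arcsin r \<le> arcsin (sin (r * (pi/2)))" using assms by (intro arcsin_le_arcsin) auto
  also have "\<dots> = r * (pi/2)"
  proof (rule arcsin_sin)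
    have "0 \<le> r * (pi/2)" using assms by simp
    then show "- (pi/2) \<le> r * (pi/2)" using pi_gt_zero by linarith
    show "r * (pi/2) \<le> pi/2" using assms mult_right_mono[of r 1 "pi/2"] by simp
  qed
  finally show ?thesis by (simp add: mult.commute)
qed

text \<open>The inverse of \<open>\<theta> \<mapsto> sin\<^sup>2 (\<theta>/2)\<close> on \<open>[0, \<pi>]\<close>. For a point \<open>e\<^sup>i\<^sup>t\<close> of the circle with \<open>\<bar>t\<bar> \<le> \<pi>\<close> it recovers
  \<open>\<bar>t\<bar>\<close> from \<open>x = (2 - e\<^sup>i\<^sup>t - e\<^sup>-\<^sup>i\<^sup>t)/4\<close>.\<close>

definition \<theta> :: "real \<Rightarrow> real" where "\<theta> x = 2 * arcsin (sqrt x)"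

lemma sqrt_unit: "x \<in> {0..1} \<Longrightarrow> 0 \<le> sqrt x \<and> - 1 \<le> sqrt x \<and> sqrt x \<le> 1"
proof -
  assume "x \<in> {0..1}"
  then have "0 \<le> sqrt x" "sqrt x \<le> 1" by auto
  then show ?thesis by linarith
qed

lemma \<theta>_cont: "continuous_on {0..1} \<theta>"
proof -
  have "continuous_on {0..1} (\<lambda>x. arcsin (sqrt x))"
    by (rule continuous_on_arcsin) (use sqrt_unit in \<open>auto intro: continuous_intros\<close>)
  then show ?thesis unfolding \<theta>_def[abs_def] by (intro continuous_on_mult continuous_on_const)
qed

lemma \<theta>_range: assumes "x \<in> {0..1}" shows "0 \<le> \<theta> x \<and> \<theta> x \<le> pi"
proof -
  have "arcsin 0 \<le> arcsin (sqrt x)" using sqrt_unit[OF assms] by (intro arcsin_le_arcsin) auto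
  moreover have "arcsin (sqrt x) \<le> pi / 2" using sqrt_unit[OF assms] arcsin_bounded by blast
  ultimately show ?thesis by (simp add: \<theta>_def)
qed

lemma sin_half_\<theta>: "x \<in> {0..1} \<Longrightarrow> sin (\<theta> x / 2) = sqrt x"
  using sqrt_unit[of x] by (simp add: \<theta>_def)

lemma cos_\<theta>: assumes "x \<in> {0..1}" shows "cos (\<theta> x) = 1 - 2 * x"
proof -
  have "cos (2 * (\<theta> x / 2)) = 1 - 2 * (sin (\<theta> x / 2))\<^sup>2" by (rule cos_double_sin)
  then show ?thesis using assms by (simp add: sin_half_\<theta>)
qed

section \<open>Ideals of a von Neumann algebra\<close>

locale normed_ideal_trace =
  fixes B I :: "'h::complex_hilbert oper set" and N :: "'h oper \<Rightarrow> real" and \<tau> :: "'h oper \<Rightarrow> complex"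
  assumes vn: "von_neumann_algebra B" and ideal: "normed_ideal B I N"
    and trace: "trace_on B I \<tau>" and pos: "positive_trace I \<tau>" and bdd: "bounded_trace I N \<tau>"
begin

lemma B_bounded: "A \<in> B \<Longrightarrow> A \<in> bounded_ops" using vn by (auto simp: von_neumann_algebra_def)
lemma B_adj: "A \<in> B \<Longrightarrow> adj A \<in> B" using vn by (auto simp: von_neumann_algebra_def)
lemma B_memI: "A \<in> bounded_ops \<Longrightarrow> (\<And>Y. Y \<in> commutant B \<Longrightarrow> A o\<^sub>L Y = Y o\<^sub>L A) \<Longrightarrow> A \<in> B"
  using vn by (auto simp: von_neumann_algebra_def commutant_def)
lemma commutantD: "Y \<in> commutant B \<Longrightarrow> A \<in> B \<Longrightarrow> Y o\<^sub>L A = A o\<^sub>L Y" by (simp add: commutant_def)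
lemma commutant_bounded: "Y \<in> commutant B \<Longrightarrow> Y \<in> bounded_ops" by (simp add: commutant_def)

named_theorems inB

lemma B_id [inB]: "id_blinfun \<in> B" by (rule B_memI) (simp_all add: bops)
lemma B_comp [inB]: "A \<in> B \<Longrightarrow> C \<in> B \<Longrightarrow> A o\<^sub>L C \<in> B"
  by (rule B_memI) (auto simp: bops B_bounded, metis commutantD op_comp_assoc)
lemma B_add [inB]: "A \<in> B \<Longrightarrow> C \<in> B \<Longrightarrow> A + C \<in> B"
  by (rule B_memI) (simp_all add: bops B_bounded op_distrib, metis commutantD)
lemma B_diff [inB]: "A \<in> B \<Longrightarrow> C \<in> B \<Longrightarrow> A - C \<in> B"
  by (rule B_memI) (simp_all add: bops B_bounded op_distrib, metis commutantD)
lemma B_scaleC [inB]: "A \<in> B \<Longrightarrow> c *\<^sub>o A \<in> B"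
  by (rule B_memI)
    (simp_all add: bops B_bounded scaleC_op_comp_left scaleC_op_comp_right commutant_bounded, metis commutantD)
lemma B_scaleR [inB]: "A \<in> B \<Longrightarrow> r *\<^sub>R A \<in> B" by (simp add: scaleR_op_conv inB)

lemma I_B: "X \<in> I \<Longrightarrow> X \<in> B"
  using ideal by (auto simp: normed_ideal_def two_sided_ideal_def)
lemma I_0: "0 \<in> I" using ideal by (simp add: normed_ideal_def two_sided_ideal_def)
lemma I_add: "X \<in> I \<Longrightarrow> Y \<in> I \<Longrightarrow> X + Y \<in> I"
  using ideal by (simp add: normed_ideal_def two_sided_ideal_def)
lemma I_scaleC: "X \<in> I \<Longrightarrow> c *\<^sub>o X \<in> I"
  using ideal by (simp add: normed_ideal_def two_sided_ideal_def)
lemma I_scaleR: "X \<in> I \<Longrightarrow> r *\<^sub>R X \<in> I" by (simp add: scaleR_op_conv I_scaleC)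
lemma I_minus: "X \<in> I \<Longrightarrow> - X \<in> I" using I_scaleC[of X "-1"] by (simp add: scaleC_op_minus_left)
lemma I_diff: "X \<in> I \<Longrightarrow> Y \<in> I \<Longrightarrow> X - Y \<in> I" using I_add[of X "- Y"] I_minus by simp
lemma I_left: "A \<in> B \<Longrightarrow> X \<in> I \<Longrightarrow> A o\<^sub>L X \<in> I"
  using ideal by (simp add: normed_ideal_def two_sided_ideal_def)
lemma I_right: "A \<in> B \<Longrightarrow> X \<in> I \<Longrightarrow> X o\<^sub>L A \<in> I"
  using ideal by (simp add: normed_ideal_def two_sided_ideal_def)
lemma I_sum: "(\<And>i. i \<in> F \<Longrightarrow> X i \<in> I) \<Longrightarrow> sum X F \<in> I"
  by (induction F rule: infinite_finite_induct) (simp_all add: I_0 I_add)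

lemmas inI = I_0 I_add I_scaleC I_scaleR I_minus I_diff I_left I_right I_sum

lemma N_nonneg: "X \<in> I \<Longrightarrow> 0 \<le> N X"
  using ideal by (simp add: normed_ideal_def ideal_norm_def norm_on_def)
lemma N_zero_iff: "X \<in> I \<Longrightarrow> N X = 0 \<longleftrightarrow> X = 0"
  using ideal by (simp add: normed_ideal_def ideal_norm_def norm_on_def)
lemma N_scaleC: "X \<in> I \<Longrightarrow> N (c *\<^sub>o X) = cmod c * N X"
  using ideal by (simp add: normed_ideal_def ideal_norm_def norm_on_def)
lemma N_add: "X \<in> I \<Longrightarrow> Y \<in> I \<Longrightarrow> N (X + Y) \<le> N X + N Y"
  using ideal by (simp add: normed_ideal_def ideal_norm_def norm_on_def)
lemma N_sum: "(\<And>i. i \<in> F \<Longrightarrow> X i \<in> I) \<Longrightarrow> N (sum X F) \<le> (\<Sum>i\<in>F. N (X i))"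
proof (induction F rule: infinite_finite_induct)
  case (insert x F)
  then have "N (X x + sum X F) \<le> N (X x) + N (sum X F)" by (intro N_add I_sum) auto
  also have "N (sum X F) \<le> (\<Sum>i\<in>F. N (X i))" using insert by auto
  finally show ?case using insert by simp
qed (use N_zero_iff[OF I_0] in auto)
lemma N_compose: "A \<in> B \<Longrightarrow> X \<in> I \<Longrightarrow> C \<in> B \<Longrightarrow> N (A o\<^sub>L X o\<^sub>L C) \<le> norm A * N X * norm C"
  using ideal by (simp add: normed_ideal_def ideal_norm_def)
lemma N_left: assumes "A \<in> B" "X \<in> I" shows "N (A o\<^sub>L X) \<le> norm A * N X"
proof -
  have "N (A o\<^sub>L X o\<^sub>L id_blinfun) \<le> norm A * N X * norm (id_blinfun :: 'h oper)"
    by (rule N_compose) (use assms B_id in auto)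
  also have "\<dots> \<le> norm A * N X * 1"
    by (rule mult_left_mono[OF norm_blinfun_id_le]) (simp add: N_nonneg assms)
  finally show ?thesis by simp
qed
lemma N_right: assumes "A \<in> B" "X \<in> I" shows "N (X o\<^sub>L A) \<le> N X * norm A"
proof -
  have "N (id_blinfun o\<^sub>L X o\<^sub>L A) \<le> norm (id_blinfun :: 'h oper) * N X * norm A"
    by (rule N_compose) (use assms B_id in auto)
  also have "\<dots> \<le> 1 * N X * norm A"
    by (intro mult_right_mono norm_blinfun_id_le) (simp_all add: N_nonneg assms)
  finally show ?thesis by simp
qed
lemma N_right1: "A \<in> B \<Longrightarrow> X \<in> I \<Longrightarrow> norm A \<le> 1 \<Longrightarrow> N (X o\<^sub>L A) \<le> N X"
  by (rule order_trans[OF N_right]) (simp_all add: N_nonneg mult_left_le)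
lemma N_left1: "A \<in> B \<Longrightarrow> X \<in> I \<Longrightarrow> norm A \<le> 1 \<Longrightarrow> N (A o\<^sub>L X) \<le> N X"
  by (rule order_trans[OF N_left]) (simp_all add: N_nonneg mult_left_le_one_le)

lemma tau_add: "X \<in> I \<Longrightarrow> Y \<in> I \<Longrightarrow> \<tau> (X + Y) = \<tau> X + \<tau> Y"
  using trace by (simp add: trace_on_def)
lemma tau_scaleC: "X \<in> I \<Longrightarrow> \<tau> (c *\<^sub>o X) = c * \<tau> X"
  using trace by (simp add: trace_on_def)
lemma tau_commute: "X \<in> I \<Longrightarrow> A \<in> B \<Longrightarrow> \<tau> (X o\<^sub>L A) = \<tau> (A o\<^sub>L X)"
  using trace by (simp add: trace_on_def)
lemma tau_0: "\<tau> 0 = 0" using tau_scaleC[OF I_0, of 0] by simp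
lemma tau_diff: assumes "X \<in> I" "Y \<in> I" shows "\<tau> (X - Y) = \<tau> X - \<tau> Y"
  using tau_add[of "X - Y" Y] assms I_diff by simp
lemma tau_sum: "(\<And>i. i \<in> F \<Longrightarrow> X i \<in> I) \<Longrightarrow> \<tau> (sum X F) = (\<Sum>i\<in>F. \<tau> (X i))"
  by (induction F rule: infinite_finite_induct) (simp_all add: tau_0 tau_add I_sum)

definition M :: real where "M = trace_norm I N \<tau>"

lemma M_nonneg: "M \<ge> 0"
  unfolding M_def trace_norm_def
  by (rule cInf_greatest) (use bdd in \<open>auto simp: bounded_trace_def\<close>)

text \<open>The bound for every admissible constant passes to their infimum.\<close>

lemma tau_bound: assumes X: "X \<in> I" shows "cmod (\<tau> X) \<le> M * N X"
proof (cases "N X = 0")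
  case True
  then have "\<tau> X = 0" using X by (simp add: N_zero_iff tau_0)
  then show ?thesis using True by simp
next
  case False
  then have n: "N X > 0" using N_nonneg[OF X] by simp
  have "cmod (\<tau> X) / N X \<le> M"
    unfolding M_def trace_norm_def
  proof (rule cInf_greatest)
    show "{M. 0 < M \<and> (\<forall>X\<in>I. cmod (\<tau> X) \<le> M * N X)} \<noteq> {}"
      using bdd by (auto simp: bounded_trace_def)
    fix m assume "m \<in> {M. 0 < M \<and> (\<forall>X\<in>I. cmod (\<tau> X) \<le> M * N X)}"
    then show "cmod (\<tau> X) / N X \<le> m" using X n by (simp add: divide_le_eq)
  qed
  then show ?thesis using n by (simp add: divide_le_eq)
qed

lemma tau_bound_le: "X \<in> I \<Longrightarrow> N X \<le> c \<Longrightarrow> cmod (\<tau> X) \<le> M * c"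
  using tau_bound M_nonneg by (meson mult_left_mono order_trans)

lemma tau_nonneg: "X \<in> I \<Longrightarrow> nonneg_op X \<Longrightarrow> \<tau> X \<in> \<real>\<^sub>\<ge>\<^sub>0"
  using pos nonneg_op_imp_positive_op by (auto simp: positive_trace_def op_le_def)

subsection \<open>Powers\<close>

definition opow :: "'h oper \<Rightarrow> nat \<Rightarrow> 'h oper" where "opow U n = ((\<lambda>X. U o\<^sub>L X) ^^ n) id_blinfun"

lemma opow_0 [simp]: "opow U 0 = id_blinfun" by (simp add: opow_def)
lemma opow_Suc: "opow U (Suc n) = U o\<^sub>L opow U n" by (simp add: opow_def)
lemma opow_Suc2: "opow U (Suc n) = opow U n o\<^sub>L U"
proof (induction n)
  case (Suc n)
  have "opow U (Suc (Suc n)) = U o\<^sub>L (opow U n o\<^sub>L U)" by (simp only: opow_Suc[of U "Suc n"] Suc)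
  then show ?case by (simp only: opow_Suc op_comp_assoc)
qed (simp add: opow_Suc)
lemma opow_add: "opow U (m + n) = opow U m o\<^sub>L opow U n"
  by (induction m) (simp_all add: opow_Suc op_comp_assoc)
lemma opow_B: "U \<in> B \<Longrightarrow> opow U n \<in> B" by (induction n) (simp_all add: opow_Suc inB)
lemma opow_norm: "norm U \<le> 1 \<Longrightarrow> norm (opow U n) \<le> 1"
proof (induction n)
  case (Suc n)
  have "norm (opow U (Suc n)) \<le> norm U * norm (opow U n)" unfolding opow_Suc by (rule norm_blinfun_compose)
  also have "\<dots> \<le> 1 * 1" using Suc by (intro mult_mono) auto
  finally show ?case by simp
qed (simp add: norm_blinfun_id_le)

lemma opow_diff_norm:
  assumes "norm X \<le> 1" "norm Y \<le> 1"
  shows "norm (opow X n - opow Y n) \<le> n * norm (X - Y)"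
proof (induction n)
  case (Suc n)
  have "opow X (Suc n) - opow Y (Suc n) = (X o\<^sub>L (opow X n - opow Y n)) + ((X - Y) o\<^sub>L opow Y n)"
    by (simp add: opow_Suc op_distrib)
  also have "norm \<dots> \<le> norm X * norm (opow X n - opow Y n) + norm (X - Y) * norm (opow Y n)"
    by (intro order_trans[OF norm_triangle_ineq] add_mono norm_blinfun_compose)
  also have "\<dots> \<le> 1 * (n * norm (X - Y)) + norm (X - Y) * 1"
    using Suc assms by (intro add_mono mult_mono opow_norm) auto
  finally show ?case by (simp add: algebra_simps)
qed simp

lemma opow_diff_I:
  assumes "X \<in> B" "Y \<in> B" "X - Y \<in> I"
  shows "opow X n - opow Y n \<in> I"
proof (induction n)
  case (Suc n)
  have "opow X (Suc n) - opow Y (Suc n) = (X o\<^sub>L (opow X n - opow Y n)) + ((X - Y) o\<^sub>L opow Y n)"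
    by (simp add: opow_Suc op_distrib)
  then show ?case using assms Suc by (simp add: inI opow_B)
qed (simp add: I_0)

lemma opow_diff_N:
  assumes "X \<in> B" "Y \<in> B" "X - Y \<in> I" "norm X \<le> 1" "norm Y \<le> 1"
  shows "N (opow X n - opow Y n) \<le> n * N (X - Y)"
proof (induction n)
  case (Suc n)
  have D: "opow X n - opow Y n \<in> I" by (rule opow_diff_I) fact+
  have "opow X (Suc n) - opow Y (Suc n) = (X o\<^sub>L (opow X n - opow Y n)) + ((X - Y) o\<^sub>L opow Y n)"
    by (simp add: opow_Suc op_distrib)
  also have "N \<dots> \<le> N (X o\<^sub>L (opow X n - opow Y n)) + N ((X - Y) o\<^sub>L opow Y n)"
    by (intro N_add inI D assms opow_B)
  also have "\<dots> \<le> n * N (X - Y) + N (X - Y)"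
    using Suc by (intro add_mono N_right1 order_trans[OF N_left1] opow_B opow_norm D assms)
  finally show ?case by (simp add: algebra_simps)
qed (use N_zero_iff[OF I_0] in simp)

text \<open>By cyclicity of the trace, \<open>X\<^sup>n - Y\<^sup>n\<close> behaves to first order like \<open>n (X - Y) Y\<^sup>n\<^sup>-\<^sup>1\<close>.  Powers of
  \<open>Y\<close> are carried along on the right so that the induction closes.\<close>

lemma tau_opow_diff:
  assumes "X \<in> B" "Y \<in> B" "X - Y \<in> I" "norm X \<le> 1" "norm Y \<le> 1"
  shows "cmod (\<tau> ((opow X n - opow Y n) o\<^sub>L opow Y m) - of_nat n * \<tau> ((X - Y) o\<^sub>L opow Y (n + m - 1)))
    \<le> M * (of_nat n * of_nat n * (N (X - Y) * norm (X - Y)))"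
proof (induction n arbitrary: m)
  case (Suc n)
  define Z where "Z = X - Y"
  define D where "D = opow X n - opow Y n"
  have D: "D \<in> I" unfolding D_def by (rule opow_diff_I) fact+
  have Z: "Z \<in> I" unfolding Z_def by fact
  note YB = opow_B[OF assms(2)]
  have split: "(opow X (Suc n) - opow Y (Suc n)) o\<^sub>L opow Y m
      = (D o\<^sub>L opow Y (Suc m)) + (D o\<^sub>L (Z o\<^sub>L opow Y m)) + (opow Y n o\<^sub>L (Z o\<^sub>L opow Y m))"
    by (simp add: D_def Z_def op_distrib opow_Suc[of Y m] opow_Suc2[of X n] opow_Suc2[of Y n])
  have "\<tau> (opow Y n o\<^sub>L (Z o\<^sub>L opow Y m)) = \<tau> ((Z o\<^sub>L opow Y m) o\<^sub>L opow Y n)"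
    by (rule tau_commute[symmetric]) (intro inI YB Z)+
  also have "\<dots> = \<tau> (Z o\<^sub>L opow Y (n + m))" by (simp add: op_comp_assoc add.commute flip: opow_add)
  finally have t: "\<tau> ((opow X (Suc n) - opow Y (Suc n)) o\<^sub>L opow Y m)
      = \<tau> (D o\<^sub>L opow Y (Suc m)) + \<tau> (D o\<^sub>L (Z o\<^sub>L opow Y m)) + \<tau> (Z o\<^sub>L opow Y (n + m))"
    unfolding split using D Z YB I_B by (simp add: tau_add inI)
  have IH: "cmod (\<tau> (D o\<^sub>L opow Y (Suc m)) - of_nat n * \<tau> (Z o\<^sub>L opow Y (n + m)))
      \<le> M * (of_nat n * of_nat n * (N Z * norm Z))"
    using Suc.IH[of "Suc m"] by (simp add: D_def Z_def)
  have ZB: "Z o\<^sub>L opow Y m \<in> I" by (intro inI YB Z)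
  have "N (D o\<^sub>L (Z o\<^sub>L opow Y m)) \<le> norm D * N (Z o\<^sub>L opow Y m)"
    using D ZB I_B by (intro N_left) auto
  also have "\<dots> \<le> (n * norm Z) * N Z"
    using assms unfolding D_def Z_def
    by (intro mult_mono opow_diff_norm N_right1 N_nonneg I_right opow_B opow_norm) auto
  finally have r: "cmod (\<tau> (D o\<^sub>L (Z o\<^sub>L opow Y m))) \<le> M * (n * norm Z * N Z)"
    using D ZB I_B by (intro tau_bound_le inI) auto
  have "cmod (\<tau> ((opow X (Suc n) - opow Y (Suc n)) o\<^sub>L opow Y m) - of_nat (Suc n) * \<tau> (Z o\<^sub>L opow Y (n + m)))
     = cmod ((\<tau> (D o\<^sub>L opow Y (Suc m)) - of_nat n * \<tau> (Z o\<^sub>L opow Y (n + m))) + \<tau> (D o\<^sub>L (Z o\<^sub>L opow Y m)))"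
    unfolding t by (simp add: algebra_simps)
  also have "\<dots> \<le> M * (of_nat n * of_nat n * (N Z * norm Z)) + M * (n * norm Z * N Z)"
    by (rule order_trans[OF norm_triangle_ineq add_mono[OF IH r]])
  also have "\<dots> = M * ((real n * real n + real n) * (N Z * norm Z))" by (simp add: algebra_simps)
  also have "\<dots> \<le> M * (of_nat (Suc n) * of_nat (Suc n) * (N Z * norm Z))"
    using M_nonneg N_nonneg[OF Z] by (intro mult_left_mono mult_right_mono) (auto simp: algebra_simps)
  finally show ?case by (simp add: Z_def)
qed (simp add: tau_0)

end

section \<open>The one-parameter group through a unitary\<close>

text \<open>A unitary \<open>W\<close> that differs from the identity by an element of the ideal. The aim is a self-adjoint \<open>A\<close>
  in the ideal with \<open>W = e\<^sup>i\<^sup>A\<close> and with \<open>\<bar>A\<bar>\<close> controlled by \<open>W - 1\<close>. The argument function on the circle jumps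
  at \<open>-1\<close>, so \<open>A\<close> is not a continuous function of \<open>W\<close>; but \<open>\<bar>A\<bar>\<close> is one, and only the sign of \<open>A\<close> needs the
  von Neumann algebra.\<close>

locale unitary_in_coset = normed_ideal_trace B I N \<tau>
  for B I :: "'h::complex_hilbert oper set" and N :: "'h oper \<Rightarrow> real" and \<tau> :: "'h oper \<Rightarrow> complex" +
  fixes W W' :: "'h oper"
  assumes WB: "W \<in> B" and W'B: "W' \<in> B" and WW': "adjoint_pair W W'"
    and W_right: "W o\<^sub>L W' = id_blinfun" and W_left: "W' o\<^sub>L W = id_blinfun"
    and W_I: "W - id_blinfun \<in> I"
begin

text \<open>With \<open>W = e\<^sup>i\<^sup>A\<close> this is \<open>sin\<^sup>2 (A/2)\<close>.\<close>

definition X where "X = (1/4) *\<^sub>R ((2 *\<^sub>R id_blinfun - W) - W')"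

lemma X_B: "X \<in> B" unfolding X_def by (intro inB WB W'B)

sublocale interval_op X
proof
  have "nonneg_op ((id_blinfun - W') o\<^sub>L id_blinfun o\<^sub>L (id_blinfun - W))"
    by (intro nonneg_op_conj adjp WW' nonneg_op_id B_bounded inB WB W'B)
  moreover have "((id_blinfun - W') o\<^sub>L id_blinfun o\<^sub>L (id_blinfun - W)) = (2 *\<^sub>R id_blinfun - W) - W'"
    by (simp add: op_distrib W_left scaleR_2)
  ultimately show "nonneg_op X" unfolding X_def by (intro nonneg_op_scaleR) simp_all
  have "nonneg_op ((id_blinfun + W') o\<^sub>L id_blinfun o\<^sub>L (id_blinfun + W))"
    by (intro nonneg_op_conj adjp WW' nonneg_op_id B_bounded inB WB W'B)
  moreover have "id_blinfun - X = (1/4) *\<^sub>R ((id_blinfun + W') o\<^sub>L id_blinfun o\<^sub>L (id_blinfun + W))"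
  proof -
    have "4 *\<^sub>R (id_blinfun - X) = (id_blinfun + W') o\<^sub>L id_blinfun o\<^sub>L (id_blinfun + W)"
    proof -
      have "4 *\<^sub>R (id_blinfun - X) = 4 *\<^sub>R id_blinfun - ((2 *\<^sub>R id_blinfun - W) - W')"
        by (simp add: X_def scaleR_diff_right)
      also have "\<dots> = 2 *\<^sub>R id_blinfun + W + W'"
        using scaleR_add_left[of 2 2 "id_blinfun :: 'h oper"] by (simp add: algebra_simps)
      finally show ?thesis by (simp add: op_distrib W_left scaleR_2)
    qed
    then show ?thesis by (metis (no_types) divide_self_if scaleR_one scaleR_scaleR times_divide_eq_left zero_neq_numeral mult_1)
  qed
  ultimately show "nonneg_op (id_blinfun - X)" by (simp add: nonneg_op_scaleR)
qed

lemma fcalc_B: "continuous_on {0..1} f \<Longrightarrow> fcalc f \<in> B"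
  by (rule B_memI)
    (use fcalc_hermitian hermitian_def fcalc_commute commutantD X_B in \<open>metis\<close>)+

text \<open>The imaginary part of \<open>W\<close> and its absolute value.\<close>

definition S where "S = (- \<i> / 2) *\<^sub>o (W - W')"
definition G where "G = fcalc (\<lambda>x. sin (\<theta> x))"

lemma cont_sin [continuous_intros]: "continuous_on {0..1} (\<lambda>x. sin (t * \<theta> x))"
  and cont_cos [continuous_intros]: "continuous_on {0..1} (\<lambda>x. cos (t * \<theta> x))"
  and cont_sin1 [continuous_intros]: "continuous_on {0..1} (\<lambda>x. sin (\<theta> x))"
  and cont_sin2 [continuous_intros]: "continuous_on {0..1} (\<lambda>x. sin (\<theta> x / 2))"
  by (intro continuous_intros \<theta>_cont; simp)+

lemma S_hermitian: "hermitian S"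
proof -
  have "adjoint_pair S (cnj (- \<i> / 2) *\<^sub>o (W' - W))"
    unfolding S_def by (intro adjoint_pair_scaleC adjp WW' adjoint_pair_sym[OF WW'])
  moreover have "cnj (- \<i> / 2) *\<^sub>o (W' - W) = S"
    using scaleC_op_minus[of "- \<i> / 2" "W' - W"] by (simp add: S_def flip: scaleC_op_minus_left)
  moreover have "S \<in> B" unfolding S_def by (intro inB WB W'B)
  ultimately show ?thesis by (simp add: hermitian_def B_bounded)
qed

lemma S_B: "S \<in> B" unfolding S_def by (intro inB WB W'B)

lemma X_comm: assumes "A \<in> bounded_ops" "A o\<^sub>L W = W o\<^sub>L A" "A o\<^sub>L W' = W' o\<^sub>L A" shows "A o\<^sub>L X = X o\<^sub>L A" "A o\<^sub>L S = S o\<^sub>L A"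
  using assms by (simp_all add: X_def S_def op_distrib scaleC_op_comp_left scaleC_op_comp_right)

lemma SX: "S o\<^sub>L X = X o\<^sub>L S"
  using X_comm(1)[OF B_bounded[OF S_B]]
  by (simp add: S_def scaleC_op_comp_left scaleC_op_comp_right B_bounded WB W'B op_distrib W_left W_right)

lemma SG: "S o\<^sub>L G = G o\<^sub>L S"
  unfolding G_def by (intro fcalc_commute continuous_intros SX)

lemma four_X: "4 *\<^sub>R X = (2 *\<^sub>R id_blinfun - W) - W'" by (simp add: X_def)

lemma GG: "G o\<^sub>L G = S o\<^sub>L S"
proof -
  have "G o\<^sub>L G = fcalc (\<lambda>x. sin (\<theta> x) * sin (\<theta> x))"
    unfolding G_def by (rule fcalc_mult[symmetric]) (intro continuous_intros)+
  also have "\<dots> = fcalc (\<lambda>x. 4 * x - (4 * x) * (1 * x))"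
  proof (rule fcalc_cong)
    fix x :: real assume x: "x \<in> {0..1}"
    have "sin (\<theta> x) * sin (\<theta> x) = 1 - (cos (\<theta> x))\<^sup>2" by (simp add: sin_squared_eq flip: power2_eq_square)
    then show "sin (\<theta> x) * sin (\<theta> x) = 4 * x - (4 * x) * (1 * x)"
      using cos_\<theta>[OF x] by (simp add: power2_eq_square algebra_simps)
  qed
  also have "\<dots> = fcalc (\<lambda>x. 4 * x) - fcalc (\<lambda>x. (4 * x) * (1 * x))"
    by (intro fcalc_diff continuous_intros)
  also have "fcalc (\<lambda>x. (4 * x) * (1 * x)) = fcalc (\<lambda>x. 4 * x) o\<^sub>L fcalc (\<lambda>x. 1 * x)"
    by (intro fcalc_mult continuous_intros)
  also have "fcalc (\<lambda>x. 4 * x) = 4 *\<^sub>R X" using fcalc_scaleR[of "\<lambda>x. x" 4] by (simp add: fcalc_ident)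
  also have "fcalc (\<lambda>x. 1 * x) = X" by (simp add: fcalc_ident)
  finally have *: "G o\<^sub>L G = 4 *\<^sub>R X - (4 *\<^sub>R X o\<^sub>L X)" .
  have two: "2 *\<^sub>o C = C + C" for C :: "'h oper"
    by (metis one_add_one scaleC_op_add_left scaleC_op_one)
  have "4 *\<^sub>R (G o\<^sub>L G) = 4 *\<^sub>R (4 *\<^sub>R X) - (4 *\<^sub>R X o\<^sub>L 4 *\<^sub>R X)"
    unfolding * by (simp add: scaleR_diff_right op_distrib)
  also have "\<dots> = 2 *\<^sub>R id_blinfun - (W o\<^sub>L W) - (W' o\<^sub>L W')"
    unfolding four_X
    using scaleR_add_left[of 2 2 "id_blinfun :: 'h oper"] scaleR_add_left[of 2 2 W] scaleR_add_left[of 2 2 W']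
    by (simp add: op_distrib W_left W_right scaleR_2 algebra_simps)
  also have "\<dots> = 4 *\<^sub>R (S o\<^sub>L S)"
    by (simp add: S_def scaleC_op_comp_left scaleC_op_comp_right B_bounded WB W'B inB scaleR_op_conv scaleC_op_scaleC
        op_distrib W_left W_right scaleC_op_minus_left scaleC_op_diff scaleC_op_add)
      (simp add: scaleC_op_minus_left two algebra_simps)
  finally show ?thesis by simp
qed

definition P where "P = (SOME P. hermitian P \<and> P o\<^sub>L P = P \<and> (id_blinfun - 2 *\<^sub>R P) o\<^sub>L S = G \<and>
    (\<forall>A. A \<in> bounded_ops \<longrightarrow> A o\<^sub>L G = G o\<^sub>L A \<longrightarrow> A o\<^sub>L S = S o\<^sub>L A \<longrightarrow> A o\<^sub>L P = P o\<^sub>L A))"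

lemma P_hermitian: "hermitian P" and P_idem: "P o\<^sub>L P = P"
  and P_sign: "(id_blinfun - 2 *\<^sub>R P) o\<^sub>L S = G"
  and P_comm: "A \<in> bounded_ops \<Longrightarrow> A o\<^sub>L G = G o\<^sub>L A \<Longrightarrow> A o\<^sub>L S = S o\<^sub>L A \<Longrightarrow> A o\<^sub>L P = P o\<^sub>L A"
proof -
  have "\<exists>P. hermitian P \<and> P o\<^sub>L P = P \<and> (id_blinfun - 2 *\<^sub>R P) o\<^sub>L S = G \<and>
    (\<forall>A. A \<in> bounded_ops \<longrightarrow> A o\<^sub>L G = G o\<^sub>L A \<longrightarrow> A o\<^sub>L S = S o\<^sub>L A \<longrightarrow> A o\<^sub>L P = P o\<^sub>L A)"
    by (rule sign_projection[OF S_hermitian _ SG GG])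
      (auto simp: G_def intro!: fcalc_hermitian continuous_intros)
  from someI_ex[OF this, folded P_def]
  show "hermitian P" "P o\<^sub>L P = P" "(id_blinfun - 2 *\<^sub>R P) o\<^sub>L S = G"
    "A \<in> bounded_ops \<Longrightarrow> A o\<^sub>L G = G o\<^sub>L A \<Longrightarrow> A o\<^sub>L S = S o\<^sub>L A \<Longrightarrow> A o\<^sub>L P = P o\<^sub>L A"
    by blast+
qed

lemma G_B: "G \<in> B" unfolding G_def by (intro fcalc_B continuous_intros)

lemma P_B: "P \<in> B"
proof (rule B_memI)
  show "P \<in> bounded_ops" using P_hermitian by (simp add: hermitian_def)
  fix Y assume Y: "Y \<in> commutant B"
  show "P o\<^sub>L Y = Y o\<^sub>L P"
    using P_comm[OF commutant_bounded[OF Y] commutantD[OF Y G_B] commutantD[OF Y S_B]] by simp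
qed

text \<open>The sign of \<open>S\<close>, hence of \<open>A\<close>. On the kernel of \<open>S\<close> it takes the value \<open>-1\<close>, which amounts to the argument
  \<open>-\<pi>\<close> for the eigenvalue \<open>-1\<close> of \<open>W\<close>.\<close>

definition J where "J = id_blinfun - 2 *\<^sub>R P"

lemma J_B: "J \<in> B" unfolding J_def by (intro inB P_B)
lemma J_hermitian: "hermitian J" unfolding J_def by (intro herm P_hermitian)
lemma J_square: "J o\<^sub>L J = id_blinfun"
  by (simp add: J_def op_distrib P_idem scaleR_2)
lemma J_cancel: "J o\<^sub>L (J o\<^sub>L A) = A" by (simp add: op_comp_assoc[symmetric] J_square)
lemma S_eq: "S = J o\<^sub>L G" using P_sign by (metis J_cancel J_def)
lemma J_norm: "norm J \<le> 1"
  using J_hermitian J_square by (intro adjoint_left_inverse_norm) (auto simp: hermitian_def)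

lemma P_fcalc: assumes "continuous_on {0..1} f" shows "P o\<^sub>L fcalc f = fcalc f o\<^sub>L P"
proof -
  have XG: "X o\<^sub>L G = G o\<^sub>L X" unfolding G_def by (intro fcalc_commute continuous_intros refl)
  have "X o\<^sub>L P = P o\<^sub>L X" by (rule P_comm[OF B_bounded[OF X_B] XG SX[symmetric]])
  then show ?thesis by (intro fcalc_commute assms) simp
qed

lemma J_fcalc: "continuous_on {0..1} f \<Longrightarrow> J o\<^sub>L fcalc f = fcalc f o\<^sub>L J"
  by (simp add: J_def op_distrib P_fcalc)

text \<open>The group \<open>t \<mapsto> e\<^sup>i\<^sup>t\<^sup>A\<close> with \<open>A = J \<theta>(X)\<close>, written out by Euler's formula; \<open>J\<^sup>2 = 1\<close> makes the cosine independent
  of \<open>J\<close> and the sine linear in it.\<close>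

definition rot :: "real \<Rightarrow> 'h oper"
  where "rot t = fcalc (\<lambda>x. cos (t * \<theta> x)) + \<i> *\<^sub>o (J o\<^sub>L fcalc (\<lambda>x. sin (t * \<theta> x)))"

lemma rot_B: "rot t \<in> B"
  unfolding rot_def by (intro inB fcalc_B J_B continuous_intros)

lemma rot_0: "rot 0 = id_blinfun"
  unfolding rot_def by (simp add: fcalc_const)

lemma rot_1: "rot 1 = W"
proof -
  have "fcalc (\<lambda>x. cos (1 * \<theta> x)) = fcalc (\<lambda>x. 1 - 2 * x)" by (rule fcalc_cong) (simp add: cos_\<theta>)
  also have "\<dots> = fcalc (\<lambda>x. 1) - fcalc (\<lambda>x. 2 * x)" by (intro fcalc_diff continuous_intros)
  also have "\<dots> = id_blinfun - 2 *\<^sub>R X" using fcalc_scaleR[of "\<lambda>x. x" 2] by (simp add: fcalc_ident fcalc_const)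
  also have "2 *\<^sub>R X = (1/2) *\<^sub>R (4 *\<^sub>R X)" by simp
  also have "id_blinfun - (1/2) *\<^sub>R (4 *\<^sub>R X) = (1/2) *\<^sub>R W + (1/2) *\<^sub>R W'"
    unfolding four_X by (simp add: scaleR_diff_right)
  finally have "rot 1 = ((1/2) *\<^sub>R W + (1/2) *\<^sub>R W') + \<i> *\<^sub>o S"
    by (simp add: rot_def S_eq G_def)
  also have "\<i> *\<^sub>o S = (1/2) *\<^sub>R W - (1/2) *\<^sub>R W'"
    by (simp add: S_def scaleC_op_scaleC scaleC_op_diff scaleR_op_conv)
  also have "((1/2) *\<^sub>R W + (1/2) *\<^sub>R W') + ((1/2) *\<^sub>R W - (1/2) *\<^sub>R W') = (1/2 + 1/2) *\<^sub>R W"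
    unfolding scaleR_add_left by simp
  finally show ?thesis by simp
qed

lemma rot_add: "rot (s + t) = rot s o\<^sub>L rot t"
proof -
  let ?c = "\<lambda>t. fcalc (\<lambda>x. cos (t * \<theta> x))" and ?s = "\<lambda>t. fcalc (\<lambda>x. sin (t * \<theta> x))"
  have c: "?c (s + t) = (?c s o\<^sub>L ?c t) - (?s s o\<^sub>L ?s t)"
  proof -
    have "?c (s + t) = fcalc (\<lambda>x. cos (s * \<theta> x) * cos (t * \<theta> x) - sin (s * \<theta> x) * sin (t * \<theta> x))"
      by (rule fcalc_cong) (simp add: distrib_right cos_add)
    also have "\<dots> = fcalc (\<lambda>x. cos (s * \<theta> x) * cos (t * \<theta> x)) - fcalc (\<lambda>x. sin (s * \<theta> x) * sin (t * \<theta> x))"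
      by (intro fcalc_diff continuous_intros)
    finally show ?thesis by (simp add: fcalc_mult cont_sin cont_cos)
  qed
  have s: "?s (s + t) = (?s s o\<^sub>L ?c t) + (?c s o\<^sub>L ?s t)"
  proof -
    have "?s (s + t) = fcalc (\<lambda>x. sin (s * \<theta> x) * cos (t * \<theta> x) + cos (s * \<theta> x) * sin (t * \<theta> x))"
      by (rule fcalc_cong) (simp add: distrib_right sin_add)
    also have "\<dots> = fcalc (\<lambda>x. sin (s * \<theta> x) * cos (t * \<theta> x)) + fcalc (\<lambda>x. cos (s * \<theta> x) * sin (t * \<theta> x))"
      by (intro fcalc_add continuous_intros)
    finally show ?thesis by (simp add: fcalc_mult cont_sin cont_cos)
  qed
  have cb: "?c u \<in> bounded_ops" "?s u \<in> bounded_ops" "J \<in> bounded_ops" for u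
    by (intro B_bounded fcalc_B continuous_intros J_B)+
  have J1: "?c s o\<^sub>L (J o\<^sub>L A) = J o\<^sub>L (?c s o\<^sub>L A)" "?s s o\<^sub>L (J o\<^sub>L A) = J o\<^sub>L (?s s o\<^sub>L A)" for A
    by (simp_all add: op_comp_assoc[symmetric] J_fcalc cont_sin cont_cos)
  have "rot s o\<^sub>L rot t = (?c s o\<^sub>L ?c t) + \<i> *\<^sub>o (J o\<^sub>L (?c s o\<^sub>L ?s t))
      + (\<i> *\<^sub>o (J o\<^sub>L (?s s o\<^sub>L ?c t)) - (?s s o\<^sub>L ?s t))"
    unfolding rot_def
    by (simp add: op_distrib scaleC_op_comp_left scaleC_op_comp_right cb bops J1 J_cancel scaleC_op_scaleC scaleC_op_minus_left scaleC_op_add)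
  also have "\<dots> = rot (s + t)"
    unfolding rot_def c s by (simp add: op_distrib scaleC_op_add)
  finally show ?thesis by simp
qed

lemma rot_minus: "rot (- t) = fcalc (\<lambda>x. cos (t * \<theta> x)) - \<i> *\<^sub>o (J o\<^sub>L fcalc (\<lambda>x. sin (t * \<theta> x)))"
proof -
  have "fcalc (\<lambda>x. sin (- t * \<theta> x)) = fcalc (\<lambda>x. (-1) * sin (t * \<theta> x))" by (rule fcalc_cong) simp
  also have "\<dots> = (-1) *\<^sub>R fcalc (\<lambda>x. sin (t * \<theta> x))" by (intro fcalc_scaleR continuous_intros)
  finally show ?thesis by (simp add: rot_def op_distrib scaleC_op_minus)
qed

lemma rot_adjoint: "adjoint_pair (rot t) (rot (- t))"
proof -
  have h: "adjoint_pair (fcalc f) (fcalc f)" if "continuous_on {0..1} f" for f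
    using fcalc_hermitian[OF that] by (simp add: hermitian_def)
  have "adjoint_pair (J o\<^sub>L fcalc (\<lambda>x. sin (t * \<theta> x))) (fcalc (\<lambda>x. sin (t * \<theta> x)) o\<^sub>L J)"
    using J_hermitian by (intro adjoint_pair_comp h continuous_intros) (simp add: hermitian_def)
  then have "adjoint_pair (J o\<^sub>L fcalc (\<lambda>x. sin (t * \<theta> x))) (J o\<^sub>L fcalc (\<lambda>x. sin (t * \<theta> x)))"
    by (simp add: J_fcalc cont_sin)
  then have "adjoint_pair (rot t) (fcalc (\<lambda>x. cos (t * \<theta> x)) + cnj \<i> *\<^sub>o (J o\<^sub>L fcalc (\<lambda>x. sin (t * \<theta> x))))"
    unfolding rot_def by (intro adjoint_pair_add adjoint_pair_scaleC h cont_cos)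
  then show ?thesis by (simp add: rot_minus scaleC_op_minus_left)
qed

lemma rot_inverse: "rot t o\<^sub>L rot (- t) = id_blinfun" "rot (- t) o\<^sub>L rot t = id_blinfun"
  by (simp_all add: rot_0 flip: rot_add)

lemma rot_norm: "norm (rot t) \<le> 1"
  by (rule adjoint_left_inverse_norm[OF rot_adjoint rot_inverse(2)])

subsection \<open>The generator lies in the ideal\<close>

text \<open>The absolute value of the generator.\<close>

definition \<Theta> where "\<Theta> = fcalc \<theta>"

text \<open>Halving the angle: \<open>W - 1 = e\<^sup>i\<^sup>A\<^sup>/\<^sup>2 (e\<^sup>i\<^sup>A\<^sup>/\<^sup>2 - e\<^sup>-\<^sup>i\<^sup>A\<^sup>/\<^sup>2) = 2 i e\<^sup>i\<^sup>A\<^sup>/\<^sup>2 J sin (\<bar>A\<bar>/2)\<close>, so \<open>sin (\<bar>A\<bar>/2)\<close> is a multiple of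
  \<open>W - 1\<close> by a contraction of the algebra.\<close>

lemma R_I: "fcalc (\<lambda>x. sin (\<theta> x / 2)) \<in> I" (is "?R \<in> I")
  and R_N: "N (fcalc (\<lambda>x. sin (\<theta> x / 2))) \<le> N (W - id_blinfun) / 2"
proof -
  have "W - id_blinfun = rot (1/2) o\<^sub>L (rot (1/2) - rot (- (1/2)))"
    by (simp add: op_distrib rot_0 rot_1 flip: rot_add)
  also have "rot (1/2) - rot (- (1/2)) = 2 *\<^sub>R (\<i> *\<^sub>o (J o\<^sub>L ?R))"
    unfolding rot_minus by (simp add: rot_def scaleR_2)
  finally have "rot (- (1/2)) o\<^sub>L (W - id_blinfun) = 2 *\<^sub>R (\<i> *\<^sub>o (J o\<^sub>L ?R))"
    by (simp only: op_comp_assoc[symmetric] rot_inverse op_id)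
  then have "J o\<^sub>L (rot (- (1/2)) o\<^sub>L (W - id_blinfun)) = (2 * \<i>) *\<^sub>o ?R"
    by (simp add: op_distrib scaleR_op_conv scaleC_op_scaleC scaleC_op_comp_right B_bounded J_B J_cancel)
  then have R: "?R = (- \<i> / 2) *\<^sub>o (J o\<^sub>L (rot (- (1/2)) o\<^sub>L (W - id_blinfun)))"
    by (simp add: scaleC_op_scaleC)
  have i1: "rot (- (1/2)) o\<^sub>L (W - id_blinfun) \<in> I" by (intro inI rot_B W_I)
  have i2: "J o\<^sub>L (rot (- (1/2)) o\<^sub>L (W - id_blinfun)) \<in> I" by (intro I_left J_B i1)
  show "?R \<in> I" unfolding R by (intro I_scaleC i2)
  have "N (J o\<^sub>L (rot (- (1/2)) o\<^sub>L (W - id_blinfun))) \<le> N (W - id_blinfun)"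
    by (intro order_trans[OF N_left1[OF J_B i1 J_norm]] N_left1 rot_B W_I rot_norm)
  then show "N ?R \<le> N (W - id_blinfun) / 2" by (subst R) (simp add: N_scaleC i2)
qed

text \<open>A continuous multiple of an element of the ideal is again in the ideal; the difference
  quotient provides the multiplier.\<close>

lemma fcalc_compose_I:
  assumes g: "continuous_on {0..1} g" "fcalc g \<in> I" and D: "g ` {0..1} \<subseteq> D"
    and f: "continuous_on D f" "(f has_real_derivative d) (at 0)" "f 0 = 0"
    and c: "\<And>u. u \<in> D \<Longrightarrow> \<bar>f u\<bar> \<le> c * \<bar>u\<bar>" "\<bar>d\<bar> \<le> c"
  shows "fcalc (\<lambda>x. f (g x)) \<in> I" "N (fcalc (\<lambda>x. f (g x))) \<le> c * N (fcalc g)"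
proof -
  let ?q = "\<lambda>u. if u = 0 then d else f u / u"
  have q: "continuous_on {0..1} (\<lambda>x. ?q (g x))"
    by (rule continuous_on_compose2[OF continuous_on_difference_quotient[OF f] g(1) D])
  have "fcalc (\<lambda>x. f (g x)) = fcalc (\<lambda>x. ?q (g x) * g x)"
    by (rule fcalc_cong) (auto simp: f(3))
  then have eq: "fcalc (\<lambda>x. f (g x)) = fcalc (\<lambda>x. ?q (g x)) o\<^sub>L fcalc g"
    using fcalc_mult[OF q g(1)] by simp
  show "fcalc (\<lambda>x. f (g x)) \<in> I" unfolding eq by (intro I_left fcalc_B q g)
  have "norm (fcalc (\<lambda>x. ?q (g x))) \<le> c"
  proof (rule fcalc_norm_le[OF q])
    fix x :: real assume "x \<in> {0..1}"
    then have "\<bar>f (g x)\<bar> \<le> c * \<bar>g x\<bar>" using D by (intro c) auto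
    then show "\<bar>?q (g x)\<bar> \<le> c" using c(2) by (auto simp: divide_le_eq)
  qed
  then have "norm (fcalc (\<lambda>x. ?q (g x))) * N (fcalc g) \<le> c * N (fcalc g)"
    by (intro mult_right_mono N_nonneg g)
  then show "N (fcalc (\<lambda>x. f (g x))) \<le> c * N (fcalc g)"
    unfolding eq using N_left[OF fcalc_B[OF q] g(2)] by linarith
qed

text \<open>The function \<open>2 arcsin u / u\<close> is continuous on \<open>[0, 1]\<close> and bounded by \<open>\<pi>\<close>; applied to \<open>u = sin (\<bar>A\<bar>/2)\<close> it
  bounds \<open>\<bar>A\<bar>\<close> in the ideal norm.\<close>

lemma \<Theta>_I: "\<Theta> \<in> I" and \<Theta>_N: "N \<Theta> \<le> pi / 2 * N (W - id_blinfun)"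
proof -
  have eq: "\<Theta> = fcalc (\<lambda>x. 2 * arcsin (sin (\<theta> x / 2)))"
    unfolding \<Theta>_def by (rule fcalc_cong) (simp add: sin_half_\<theta>, simp add: \<theta>_def)
  have range: "(\<lambda>x. sin (\<theta> x / 2)) ` {0..1} \<subseteq> {0..1}" by (auto simp: sin_half_\<theta>)
  have cont: "continuous_on {0..1} (\<lambda>u::real. 2 * arcsin u)"
    by (intro continuous_intros continuous_on_arcsin) auto
  have deriv: "((\<lambda>u. 2 * arcsin u) has_real_derivative 2) (at 0)"
    by (auto intro!: derivative_eq_intros)
  have bound: "\<bar>2 * arcsin u\<bar> \<le> pi * \<bar>u\<bar>" if "u \<in> {0..1}" for u :: real
    using that arcsin_le[of u] arcsin_le_arcsin[of 0 u] by auto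
  have "\<bar>2\<bar> \<le> pi" using pi_ge_two by simp
  note * = fcalc_compose_I[OF cont_sin2 R_I range cont deriv _ bound this]
  show "\<Theta> \<in> I" unfolding eq by (rule *) auto
  have "N \<Theta> \<le> pi * N (fcalc (\<lambda>x. sin (\<theta> x / 2)))" unfolding eq by (rule *) auto
  also have "\<dots> \<le> pi * (N (W - id_blinfun) / 2)" by (intro mult_left_mono R_N) auto
  finally show "N \<Theta> \<le> pi / 2 * N (W - id_blinfun)" by simp
qed

lemma \<theta>_image: "\<theta> ` {0..1} \<subseteq> {0..pi}" using \<theta>_range by auto

definition A where "A = J o\<^sub>L \<Theta>"

lemma A_I: "A \<in> I" unfolding A_def by (intro I_left J_B \<Theta>_I)

text \<open>A second-order Taylor estimate in the ideal norm; the remainders \<open>cos (h u) - 1\<close> and \<open>sin (h u) - h u\<close> are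
  \<open>O(h\<^sup>2)\<close> multiples of \<open>u\<close> on \<open>[0, \<pi>]\<close>.\<close>

lemma rot_first_order:
  "rot h - id_blinfun - (\<i> * h) *\<^sub>o A \<in> I"
  "N (rot h - id_blinfun - (\<i> * h) *\<^sub>o A) \<le> pi * N \<Theta> * h\<^sup>2"
proof -
  let ?f = "\<lambda>u. cos (h * u) - 1" and ?g = "\<lambda>u. sin (h * u) - h * u"
  have b: "y\<^sup>2 / 2 \<le> pi / 2 * h\<^sup>2 * \<bar>u\<bar>" if "y = h * u" "u \<in> {0..pi}" for y u
  proof -
    have "u * u \<le> pi * u" using that by (intro mult_right_mono) auto
    then have "h\<^sup>2 * (u * u) \<le> h\<^sup>2 * (pi * u)" by (intro mult_left_mono) auto
    then show ?thesis using that by (simp add: power_mult_distrib power2_eq_square algebra_simps)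
  qed
  have f: "fcalc (\<lambda>x. ?f (\<theta> x)) \<in> I" "N (fcalc (\<lambda>x. ?f (\<theta> x))) \<le> (pi / 2 * h\<^sup>2) * N \<Theta>"
  proof -
    have 1: "continuous_on {0..pi} ?f" by (intro continuous_intros)
    have 2: "(?f has_real_derivative 0) (at 0)" by (auto intro!: derivative_eq_intros)
    have 3: "\<bar>?f u\<bar> \<le> (pi / 2 * h\<^sup>2) * \<bar>u\<bar>" if "u \<in> {0..pi}" for u
      using cos_sin_approx(1)[of "h * u"] b[OF refl that] by (rule order_trans)
    show "fcalc (\<lambda>x. ?f (\<theta> x)) \<in> I" "N (fcalc (\<lambda>x. ?f (\<theta> x))) \<le> (pi / 2 * h\<^sup>2) * N \<Theta>"
      unfolding \<Theta>_def by (rule fcalc_compose_I[OF \<theta>_cont \<Theta>_I[unfolded \<Theta>_def] \<theta>_image 1 2 _ 3]; simp)+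
  qed
  have g: "fcalc (\<lambda>x. ?g (\<theta> x)) \<in> I" "N (fcalc (\<lambda>x. ?g (\<theta> x))) \<le> (pi / 2 * h\<^sup>2) * N \<Theta>"
  proof -
    have 1: "continuous_on {0..pi} ?g" by (intro continuous_intros)
    have 2: "(?g has_real_derivative 0) (at 0)" by (auto intro!: derivative_eq_intros)
    have 3: "\<bar>?g u\<bar> \<le> (pi / 2 * h\<^sup>2) * \<bar>u\<bar>" if "u \<in> {0..pi}" for u
      using cos_sin_approx(2)[of "h * u"] b[OF refl that] by (rule order_trans)
    show "fcalc (\<lambda>x. ?g (\<theta> x)) \<in> I" "N (fcalc (\<lambda>x. ?g (\<theta> x))) \<le> (pi / 2 * h\<^sup>2) * N \<Theta>"
      unfolding \<Theta>_def by (rule fcalc_compose_I[OF \<theta>_cont \<Theta>_I[unfolded \<Theta>_def] \<theta>_image 1 2 _ 3]; simp)+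
  qed
  have cc: "continuous_on {0..1} (\<lambda>x. h * \<theta> x)" by (intro continuous_intros \<theta>_cont)
  have "fcalc (\<lambda>x. ?f (\<theta> x)) = fcalc (\<lambda>x. cos (h * \<theta> x)) - id_blinfun"
    using fcalc_diff[OF cont_cos[of h] continuous_on_const[of _ 1]] by (simp add: fcalc_const)
  moreover have "fcalc (\<lambda>x. ?g (\<theta> x)) = fcalc (\<lambda>x. sin (h * \<theta> x)) - h *\<^sub>R \<Theta>"
    using fcalc_diff[OF cont_sin[of h] cc] by (simp add: fcalc_scaleR \<theta>_cont \<Theta>_def)
  ultimately have eq: "rot h - id_blinfun - (\<i> * h) *\<^sub>o A = fcalc (\<lambda>x. ?f (\<theta> x)) + \<i> *\<^sub>o (J o\<^sub>L fcalc (\<lambda>x. ?g (\<theta> x)))"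
    by (simp add: rot_def A_def op_distrib scaleC_op_diff scaleR_op_conv scaleC_op_scaleC scaleC_op_comp_right B_bounded J_B)
  have j: "J o\<^sub>L fcalc (\<lambda>x. ?g (\<theta> x)) \<in> I" by (intro I_left J_B g)
  show "rot h - id_blinfun - (\<i> * h) *\<^sub>o A \<in> I" unfolding eq by (intro I_add I_scaleC f j)
  have "N (fcalc (\<lambda>x. ?f (\<theta> x)) + \<i> *\<^sub>o (J o\<^sub>L fcalc (\<lambda>x. ?g (\<theta> x)))) \<le>
      N (fcalc (\<lambda>x. ?f (\<theta> x))) + N (\<i> *\<^sub>o (J o\<^sub>L fcalc (\<lambda>x. ?g (\<theta> x))))"
    by (intro N_add I_scaleC f j)
  also have "N (\<i> *\<^sub>o (J o\<^sub>L fcalc (\<lambda>x. ?g (\<theta> x)))) \<le> N (fcalc (\<lambda>x. ?g (\<theta> x)))"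
    by (simp add: N_scaleC j N_left1 J_B g J_norm)
  finally show "N (rot h - id_blinfun - (\<i> * h) *\<^sub>o A) \<le> pi * N \<Theta> * h\<^sup>2"
    unfolding eq using f g by (simp add: algebra_simps)
qed

lemma rot_Lipschitz_N: "rot h - id_blinfun \<in> I" "N (rot h - id_blinfun) \<le> 2 * \<bar>h\<bar> * N \<Theta>"
proof -
  let ?f = "\<lambda>u. cos (h * u) - 1" and ?g = "\<lambda>u. sin (h * u)"
  have f: "fcalc (\<lambda>x. ?f (\<theta> x)) \<in> I" "N (fcalc (\<lambda>x. ?f (\<theta> x))) \<le> \<bar>h\<bar> * N \<Theta>"
  proof -
    have 1: "continuous_on {0..pi} ?f" by (intro continuous_intros)
    have 2: "(?f has_real_derivative 0) (at 0)" by (auto intro!: derivative_eq_intros)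
    have 3: "\<bar>?f u\<bar> \<le> \<bar>h\<bar> * \<bar>u\<bar>" if "u \<in> {0..pi}" for u
      using abs_cos_minus_one_le[of "h * u"] by (simp only: abs_mult)
    show "fcalc (\<lambda>x. ?f (\<theta> x)) \<in> I" "N (fcalc (\<lambda>x. ?f (\<theta> x))) \<le> \<bar>h\<bar> * N \<Theta>"
      unfolding \<Theta>_def by (rule fcalc_compose_I[OF \<theta>_cont \<Theta>_I[unfolded \<Theta>_def] \<theta>_image 1 2 _ 3]; simp)+
  qed
  have g: "fcalc (\<lambda>x. ?g (\<theta> x)) \<in> I" "N (fcalc (\<lambda>x. ?g (\<theta> x))) \<le> \<bar>h\<bar> * N \<Theta>"
  proof -
    have 1: "continuous_on {0..pi} ?g" by (intro continuous_intros)
    have 2: "(?g has_real_derivative h) (at 0)" by (auto intro!: derivative_eq_intros)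
    have 3: "\<bar>?g u\<bar> \<le> \<bar>h\<bar> * \<bar>u\<bar>" if "u \<in> {0..pi}" for u
      using abs_sin_x_le_abs_x[of "h * u"] by (simp only: abs_mult)
    show "fcalc (\<lambda>x. ?g (\<theta> x)) \<in> I" "N (fcalc (\<lambda>x. ?g (\<theta> x))) \<le> \<bar>h\<bar> * N \<Theta>"
      unfolding \<Theta>_def by (rule fcalc_compose_I[OF \<theta>_cont \<Theta>_I[unfolded \<Theta>_def] \<theta>_image 1 2 _ 3]; simp)+
  qed
  have "fcalc (\<lambda>x. ?f (\<theta> x)) = fcalc (\<lambda>x. cos (h * \<theta> x)) - id_blinfun"
    using fcalc_diff[OF cont_cos[of h] continuous_on_const[of _ 1]] by (simp add: fcalc_const)
  then have eq: "rot h - id_blinfun = fcalc (\<lambda>x. ?f (\<theta> x)) + \<i> *\<^sub>o (J o\<^sub>L fcalc (\<lambda>x. ?g (\<theta> x)))"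
    by (simp add: rot_def)
  have j: "J o\<^sub>L fcalc (\<lambda>x. ?g (\<theta> x)) \<in> I" by (intro I_left J_B g)
  show "rot h - id_blinfun \<in> I" unfolding eq by (intro I_add I_scaleC f j)
  have "N (fcalc (\<lambda>x. ?f (\<theta> x)) + \<i> *\<^sub>o (J o\<^sub>L fcalc (\<lambda>x. ?g (\<theta> x)))) \<le>
      N (fcalc (\<lambda>x. ?f (\<theta> x))) + N (\<i> *\<^sub>o (J o\<^sub>L fcalc (\<lambda>x. ?g (\<theta> x))))"
    by (intro N_add I_scaleC f j)
  also have "N (\<i> *\<^sub>o (J o\<^sub>L fcalc (\<lambda>x. ?g (\<theta> x)))) \<le> N (fcalc (\<lambda>x. ?g (\<theta> x)))"
    by (simp add: N_scaleC j N_left1 J_B g J_norm)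
  finally show "N (rot h - id_blinfun) \<le> 2 * \<bar>h\<bar> * N \<Theta>"
    unfolding eq using f g by (simp add: algebra_simps)
qed

lemma rot_Lipschitz: "norm (rot h - id_blinfun) \<le> 2 * pi * \<bar>h\<bar>"
proof -
  have le: "\<bar>h * \<theta> x\<bar> \<le> \<bar>h\<bar> * pi" if "x \<in> {0..1}" for x
    using \<theta>_range[OF that] by (simp add: abs_mult mult_left_mono)
  have "norm (fcalc (\<lambda>x. cos (h * \<theta> x) - 1)) \<le> \<bar>h\<bar> * pi"
    by (rule fcalc_norm_le; intro continuous_intros order_trans[OF abs_cos_minus_one_le le])
  moreover have s: "norm (fcalc (\<lambda>x. sin (h * \<theta> x))) \<le> \<bar>h\<bar> * pi"
    by (rule fcalc_norm_le; intro continuous_intros order_trans[OF abs_sin_x_le_abs_x le])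
  moreover have "fcalc (\<lambda>x. cos (h * \<theta> x) - 1) = fcalc (\<lambda>x. cos (h * \<theta> x)) - id_blinfun"
    using fcalc_diff[OF cont_cos[of h] continuous_on_const[of _ 1]] by (simp add: fcalc_const)
  moreover have "norm (\<i> *\<^sub>o (J o\<^sub>L fcalc (\<lambda>x. sin (h * \<theta> x)))) \<le> 1 * norm (fcalc (\<lambda>x. sin (h * \<theta> x)))"
    unfolding norm_scaleC_op norm_ii mult_1_left[of "norm (J o\<^sub>L _)"]
    by (rule order_trans[OF norm_blinfun_compose]) (intro mult_right_mono J_norm norm_ge_zero)
  ultimately show ?thesis
    using norm_triangle_ineq[of "fcalc (\<lambda>x. cos (h * \<theta> x)) - id_blinfun" "\<i> *\<^sub>o (J o\<^sub>L fcalc (\<lambda>x. sin (h * \<theta> x)))"]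
    by (simp add: rot_def algebra_simps)
qed

lemma \<Theta>_nonneg: "nonneg_op \<Theta>" unfolding \<Theta>_def using \<theta>_range by (intro fcalc_nonneg \<theta>_cont) auto

definition \<Theta>_neg where "\<Theta>_neg = P o\<^sub>L \<Theta>"
definition \<Theta>_pos where "\<Theta>_pos = (id_blinfun - P) o\<^sub>L \<Theta>"

lemma \<Theta>_parts: "\<Theta>_neg \<in> I" "\<Theta>_pos \<in> I" "nonneg_op \<Theta>_neg" "nonneg_op \<Theta>_pos"
  "\<Theta> = \<Theta>_pos + \<Theta>_neg" "A = \<Theta>_pos - \<Theta>_neg"
proof -
  show "\<Theta>_neg \<in> I" "\<Theta>_pos \<in> I" unfolding \<Theta>_neg_def \<Theta>_pos_def by (intro I_left inB P_B \<Theta>_I)+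
  have c: "P o\<^sub>L \<Theta> = \<Theta> o\<^sub>L P" unfolding \<Theta>_def by (rule P_fcalc[OF \<theta>_cont])
  have PP: "P o\<^sub>L (P o\<^sub>L C) = P o\<^sub>L C" for C by (simp add: P_idem flip: op_comp_assoc)
  have n: "\<Theta>_neg = P o\<^sub>L \<Theta> o\<^sub>L P" unfolding \<Theta>_neg_def by (metis c P_idem op_comp_assoc)
  have p: "\<Theta>_pos = (id_blinfun - P) o\<^sub>L \<Theta> o\<^sub>L (id_blinfun - P)"
    by (simp add: \<Theta>_pos_def op_distrib c[symmetric] PP)
  show "nonneg_op \<Theta>_neg" unfolding n by (intro nonneg_op_sandwich P_hermitian \<Theta>_nonneg)
  show "nonneg_op \<Theta>_pos" unfolding p by (intro nonneg_op_sandwich herm P_hermitian \<Theta>_nonneg)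
  show "\<Theta> = \<Theta>_pos + \<Theta>_neg" by (simp add: \<Theta>_pos_def \<Theta>_neg_def op_distrib)
  show "A = \<Theta>_pos - \<Theta>_neg" by (simp add: A_def J_def \<Theta>_pos_def \<Theta>_neg_def op_distrib scaleR_2)
qed

end

section \<open>The path of unitaries\<close>

text \<open>A path of unitaries from \<open>U0\<close> to \<open>W U0\<close> inside the algebra, along which traces of powers can be
  differentiated.\<close>

locale unitary_path = unitary_in_coset B I N \<tau> W W'
  for B I :: "'h::complex_hilbert oper set" and N :: "'h oper \<Rightarrow> real" and \<tau> :: "'h oper \<Rightarrow> complex"
    and W W' :: "'h oper" +
  fixes U0 U0' :: "'h oper"
  assumes U0_B: "U0 \<in> B" and U0'_B: "U0' \<in> B" and U0_adj: "adjoint_pair U0 U0'"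
    and U0_right: "U0 o\<^sub>L U0' = id_blinfun" and U0_left: "U0' o\<^sub>L U0 = id_blinfun"
begin

definition U where "U s = rot s o\<^sub>L U0"
definition U' where "U' s = U0' o\<^sub>L rot (- s)"

text \<open>Integer powers of \<open>U s\<close>, with the inverse given explicitly, so that \<open>unitary_powi\<close> and with it \<open>adj\<close> are
  needed at the end points of the path only.\<close>

definition upow :: "int \<Rightarrow> real \<Rightarrow> 'h oper"
  where "upow k s = (if 0 \<le> k then opow (U s) (nat k) else opow (U' s) (nat (- k)))"

lemma B_sum: "(\<And>i. i \<in> F \<Longrightarrow> f i \<in> B) \<Longrightarrow> sum f F \<in> B"
  by (induction F rule: infinite_finite_induct) (simp_all add: inB I_B[OF I_0])

lemma U_B: "U s \<in> B" "U' s \<in> B" unfolding U_def U'_def by (intro inB rot_B U0_B U0'_B)+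

lemma U_adj: "adjoint_pair (U s) (U' s)"
  unfolding U_def U'_def by (intro adjoint_pair_comp rot_adjoint U0_adj)

lemma U_inverse: "U s o\<^sub>L U' s = id_blinfun" "U' s o\<^sub>L U s = id_blinfun"
proof -
  have "U s o\<^sub>L U' s = rot s o\<^sub>L (U0 o\<^sub>L U0') o\<^sub>L rot (- s)" by (simp add: U_def U'_def op_comp_assoc)
  then show "U s o\<^sub>L U' s = id_blinfun" by (simp add: U0_right rot_inverse)
  have "U' s o\<^sub>L U s = U0' o\<^sub>L (rot (- s) o\<^sub>L rot s) o\<^sub>L U0" by (simp add: U_def U'_def op_comp_assoc)
  then show "U' s o\<^sub>L U s = id_blinfun" by (simp add: U0_left rot_inverse)
qed

lemma U_norm: "norm (U s) \<le> 1" "norm (U' s) \<le> 1"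
  using adjoint_left_inverse_norm[OF U_adj U_inverse(2)]
    adjoint_left_inverse_norm[OF adjoint_pair_sym[OF U_adj] U_inverse(1)] .

lemma upow_B: "upow k s \<in> B" by (simp add: upow_def opow_B U_B)
lemma upow_norm: "norm (upow k s) \<le> 1" by (simp add: upow_def opow_norm U_norm)
lemma upow_0: "upow 0 s = id_blinfun" by (simp add: upow_def)

lemma U_step: "U t - U s = (rot (t - s) - id_blinfun) o\<^sub>L U s"
  and U'_step: "U' t - U' s = U' s o\<^sub>L (rot (s - t) - id_blinfun)"
proof -
  have "rot (t - s) o\<^sub>L rot s = rot t" "rot (- s) o\<^sub>L rot (s - t) = rot (- t)" by (simp_all flip: rot_add)
  then show "U t - U s = (rot (t - s) - id_blinfun) o\<^sub>L U s" "U' t - U' s = U' s o\<^sub>L (rot (s - t) - id_blinfun)"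
    by (simp_all add: U_def U'_def op_distrib) (simp add: op_comp_assoc[symmetric])
qed

lemma U_diff:
  "U t - U s \<in> I" "N (U t - U s) \<le> 2 * \<bar>t - s\<bar> * N \<Theta>" "norm (U t - U s) \<le> 2 * pi * \<bar>t - s\<bar>"
proof -
  show "U t - U s \<in> I" unfolding U_step by (intro I_right U_B rot_Lipschitz_N)
  show "N (U t - U s) \<le> 2 * \<bar>t - s\<bar> * N \<Theta>" unfolding U_step
    by (rule order_trans[OF N_right1 rot_Lipschitz_N(2)]) (intro U_B rot_Lipschitz_N(1) U_norm)+
  have "norm (U t - U s) \<le> norm (rot (t - s) - id_blinfun) * norm (U s)"
    unfolding U_step by (rule norm_blinfun_compose)
  also have "\<dots> \<le> norm (rot (t - s) - id_blinfun)" using U_norm by (simp add: mult_left_le)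
  finally show "norm (U t - U s) \<le> 2 * pi * \<bar>t - s\<bar>" using rot_Lipschitz[of "t - s"] by linarith
qed

lemma U'_diff:
  "U' t - U' s \<in> I" "N (U' t - U' s) \<le> 2 * \<bar>t - s\<bar> * N \<Theta>" "norm (U' t - U' s) \<le> 2 * pi * \<bar>t - s\<bar>"
proof -
  show "U' t - U' s \<in> I" unfolding U'_step by (intro I_left U_B rot_Lipschitz_N)
  have "N (U' t - U' s) \<le> 2 * \<bar>s - t\<bar> * N \<Theta>" unfolding U'_step
    by (rule order_trans[OF N_left1 rot_Lipschitz_N(2)]) (intro U_B rot_Lipschitz_N(1) U_norm)+
  then show "N (U' t - U' s) \<le> 2 * \<bar>t - s\<bar> * N \<Theta>" by (simp add: abs_minus_commute)
  have "norm (U' t - U' s) \<le> norm (U' s) * norm (rot (s - t) - id_blinfun)"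
    unfolding U'_step by (rule norm_blinfun_compose)
  also have "\<dots> \<le> norm (rot (s - t) - id_blinfun)" using U_norm by (simp add: mult_left_le_one_le)
  finally show "norm (U' t - U' s) \<le> 2 * pi * \<bar>t - s\<bar>" using rot_Lipschitz[of "s - t"]
    by (simp add: abs_minus_commute)
qed

lemma upow_diff_I: "upow k t - upow k s \<in> I"
  unfolding upow_def by (simp add: opow_diff_I U_B U_diff U'_diff)

lemma upow_diff_norm: "norm (upow k t - upow k s) \<le> (2 * pi * \<bar>k\<bar>) * \<bar>t - s\<bar>"
proof -
  have *: "n * norm (C - D) \<le> (2 * pi * n) * \<bar>t - s\<bar>" if "norm (C - D) \<le> 2 * pi * \<bar>t - s\<bar>"
    for n :: nat and C D :: "'h oper"
    using mult_left_mono[OF that, of n] by (simp add: mult_ac)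
  show ?thesis
  proof (cases "0 \<le> k")
    case True
    then show ?thesis
      using order_trans[OF opow_diff_norm[OF U_norm(1) U_norm(1)] *[OF U_diff(3)], of "nat k"]
      by (simp add: upow_def)
  next
    case False
    then show ?thesis
      using order_trans[OF opow_diff_norm[OF U_norm(2) U_norm(2)] *[OF U'_diff(3)], of "nat (-k)"]
      by (simp add: upow_def)
  qed
qed

lemma upow_diff_N: "N (upow k t - upow k s) \<le> \<bar>k\<bar> * (2 * \<bar>t - s\<bar> * N \<Theta>)"
proof (cases "0 \<le> k")
  case True
  have "N (upow k t - upow k s) \<le> nat k * N (U t - U s)"
    using True opow_diff_N[OF U_B(1) U_B(1) U_diff(1)[of t s] U_norm(1) U_norm(1), of "nat k"] by (simp add: upow_def)
  also have "\<dots> \<le> nat k * (2 * \<bar>t - s\<bar> * N \<Theta>)" by (intro mult_left_mono U_diff) simp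
  finally show ?thesis using True by simp
next
  case False
  have "N (upow k t - upow k s) \<le> nat (-k) * N (U' t - U' s)"
    using False opow_diff_N[OF U_B(2) U_B(2) U'_diff(1)[of t s] U_norm(2) U_norm(2), of "nat (-k)"] by (simp add: upow_def)
  also have "\<dots> \<le> nat (-k) * (2 * \<bar>t - s\<bar> * N \<Theta>)" by (intro mult_left_mono U'_diff) simp
  finally show ?thesis using False by simp
qed

text \<open>The error is an element of the ideal, so boundedness of the trace applies to it.\<close>

lemma tau_first_order:
  assumes C: "C \<in> B" "norm C \<le> 1"
  shows "cmod (\<tau> ((rot h - id_blinfun) o\<^sub>L C) - \<i> * h * \<tau> (A o\<^sub>L C)) \<le> M * (pi * N \<Theta> * h\<^sup>2)"
proof -
  define E where "E = rot h - id_blinfun - (\<i> * h) *\<^sub>o A"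
  have E: "E \<in> I" "N E \<le> pi * N \<Theta> * h\<^sup>2" unfolding E_def by (rule rot_first_order)+
  have "(rot h - id_blinfun) o\<^sub>L C = (E o\<^sub>L C) + (\<i> * h) *\<^sub>o (A o\<^sub>L C)"
    by (simp add: E_def op_distrib scaleC_op_comp_left)
  then have "\<tau> ((rot h - id_blinfun) o\<^sub>L C) - \<i> * h * \<tau> (A o\<^sub>L C) = \<tau> (E o\<^sub>L C)"
    using E A_I C by (simp add: tau_add tau_scaleC inI)
  also have "cmod \<dots> \<le> M * (pi * N \<Theta> * h\<^sup>2)"
    using E C by (intro tau_bound_le I_right order_trans[OF N_right1 E(2)]) auto
  finally show ?thesis .
qed

text \<open>Both \<open>U\<close> and its inverse are handled at once: \<open>Y\<close> moves to \<open>Z\<close> by a multiplicative factor on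
  either side, which the trace cannot distinguish.\<close>

lemma tau_opow_first_order:
  assumes XY: "Z \<in> B" "Y \<in> B" "norm Z \<le> 1" "norm Y \<le> 1"
    and step: "Z - Y = (rot h - id_blinfun) o\<^sub>L Y \<or> Z - Y = Y o\<^sub>L (rot h - id_blinfun)"
    and est: "N (Z - Y) \<le> 2 * \<bar>h\<bar> * N \<Theta>" "norm (Z - Y) \<le> 2 * pi * \<bar>h\<bar>"
  shows "cmod (\<tau> (opow Z n - opow Y n) - n * (\<i> * h * \<tau> (A o\<^sub>L opow Y n)))
    \<le> (M * (4 * pi * N \<Theta>) * n^2 + n * (M * (pi * N \<Theta>))) * h\<^sup>2"
proof (cases n)
  case (Suc m)
  have R: "rot h - id_blinfun \<in> I" by (rule rot_Lipschitz_N)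
  have diffI: "Z - Y \<in> I" using step XY R by (auto simp: inI)
  have Yn: "opow Y n \<in> B" "norm (opow Y n) \<le> 1" using XY by (auto simp: opow_B opow_norm)
  have "\<tau> ((Z - Y) o\<^sub>L opow Y m) = \<tau> ((rot h - id_blinfun) o\<^sub>L opow Y n)"
    using step
  proof
    assume "Z - Y = (rot h - id_blinfun) o\<^sub>L Y"
    then show ?thesis by (simp add: op_comp_assoc Suc opow_Suc)
  next
    assume *: "Z - Y = Y o\<^sub>L (rot h - id_blinfun)"
    have "\<tau> (Y o\<^sub>L ((rot h - id_blinfun) o\<^sub>L opow Y m)) = \<tau> (((rot h - id_blinfun) o\<^sub>L opow Y m) o\<^sub>L Y)"
      using XY R by (intro tau_commute[symmetric] I_right opow_B)
    then show ?thesis unfolding * by (simp only: op_comp_assoc Suc opow_Suc2)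
  qed
  then have 1: "cmod (\<tau> ((Z - Y) o\<^sub>L opow Y m) - \<i> * h * \<tau> (A o\<^sub>L opow Y n)) \<le> M * (pi * N \<Theta> * h\<^sup>2)"
    using tau_first_order[OF Yn] by simp
  have 2: "cmod (\<tau> (opow Z n - opow Y n) - n * \<tau> ((Z - Y) o\<^sub>L opow Y m)) \<le> M * (real n * real n * (N (Z - Y) * norm (Z - Y)))"
    using tau_opow_diff[OF XY(1,2) diffI XY(3,4), of n 0] unfolding Suc by (simp del: of_nat_Suc)
  have "N (Z - Y) * norm (Z - Y) \<le> (2 * \<bar>h\<bar> * N \<Theta>) * (2 * pi * \<bar>h\<bar>)"
    by (intro mult_mono est) (auto simp: N_nonneg \<Theta>_I)
  also have "\<dots> = 4 * pi * N \<Theta> * h\<^sup>2" by (simp add: power2_eq_square)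
  finally have 3: "M * (real n * real n * (N (Z - Y) * norm (Z - Y))) \<le> M * (real n * real n * (4 * pi * N \<Theta> * h\<^sup>2))"
    using M_nonneg by (intro mult_left_mono) auto
  have "cmod (n * (\<tau> ((Z - Y) o\<^sub>L opow Y m) - \<i> * h * \<tau> (A o\<^sub>L opow Y n))) \<le> n * (M * (pi * N \<Theta> * h\<^sup>2))"
    unfolding norm_mult using 1 by (simp add: mult_left_mono)
  then have "cmod ((\<tau> (opow Z n - opow Y n) - n * \<tau> ((Z - Y) o\<^sub>L opow Y m))
      + n * (\<tau> ((Z - Y) o\<^sub>L opow Y m) - \<i> * h * \<tau> (A o\<^sub>L opow Y n)))
      \<le> M * (real n * real n * (4 * pi * N \<Theta> * h\<^sup>2)) + n * (M * (pi * N \<Theta> * h\<^sup>2))"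
    using 2 3 by (intro norm_triangle_le) linarith
  then show ?thesis by (simp add: algebra_simps power2_eq_square)
qed (simp add: tau_0)

lemma tau_upow_first_order:
  obtains C where "\<And>s t. cmod (\<tau> (upow k t - upow k s) - complex_of_real (t - s) * (\<i> * k * \<tau> (A o\<^sub>L upow k s))) \<le> C * (t - s)\<^sup>2"
proof (cases "0 \<le> k")
  case True
  show ?thesis
  proof (rule that)
    fix s t
    show "cmod (\<tau> (upow k t - upow k s) - complex_of_real (t - s) * (\<i> * k * \<tau> (A o\<^sub>L upow k s)))
      \<le> (M * (4 * pi * N \<Theta>) * (real (nat k))^2 + nat k * (M * (pi * N \<Theta>))) * (t - s)\<^sup>2"
      using tau_opow_first_order[OF U_B(1) U_B(1) U_norm(1) U_norm(1) disjI1[OF U_step] U_diff(2,3)[of t s], of "nat k"] True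
      by (simp add: upow_def mult_ac)
  qed
next
  case False
  show ?thesis
  proof (rule that)
    fix s t
    have d: "N (U' t - U' s) \<le> 2 * \<bar>s - t\<bar> * N \<Theta>" "norm (U' t - U' s) \<le> 2 * pi * \<bar>s - t\<bar>"
      using U'_diff(2,3)[of t s] by (simp_all add: abs_minus_commute)
    have "of_nat (nat (-k)) * (\<i> * complex_of_real (s - t) * w) = complex_of_real (t - s) * (\<i> * k * w)" for w
      using False by (simp add: algebra_simps)
    then show "cmod (\<tau> (upow k t - upow k s) - complex_of_real (t - s) * (\<i> * k * \<tau> (A o\<^sub>L upow k s)))
      \<le> (M * (4 * pi * N \<Theta>) * (real (nat (-k)))^2 + nat (-k) * (M * (pi * N \<Theta>))) * (t - s)\<^sup>2"
      using tau_opow_first_order[OF U_B(2) U_B(2) U_norm(2) U_norm(2) disjI2[OF U'_step] d, of "nat (-k)"] False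
      by (simp add: upow_def power2_commute)
  qed
qed

text \<open>The Fourier coefficients of the average over the path of the functionals \<open>f \<mapsto> \<tau> (T f(U\<^sub>s))\<close>. A trace
  need not be normal, so for a single \<open>s\<close> spectral projections in place of \<open>f(U\<^sub>s)\<close> would only give a finitely
  additive measure; a measure is obtained from positive definiteness instead.\<close>

definition moment :: "'h oper \<Rightarrow> int \<Rightarrow> complex"
  where "moment T k = integral {0..1} (\<lambda>s. \<tau> (T o\<^sub>L upow k s))"

lemma tau_upow_continuous: assumes T: "T \<in> I" shows "continuous_on K (\<lambda>s. \<tau> (T o\<^sub>L upow k s))"
proof -
  let ?L = "M * (N T * (2 * pi * \<bar>k\<bar>))"
  have "?L-lipschitz_on K (\<lambda>s. \<tau> (T o\<^sub>L upow k s))"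
  proof (rule lipschitz_onI)
    fix t s
    have d: "upow k t - upow k s \<in> B" by (intro inB upow_B)
    have "dist (\<tau> (T o\<^sub>L upow k t)) (\<tau> (T o\<^sub>L upow k s)) = cmod (\<tau> (T o\<^sub>L (upow k t - upow k s)))"
      unfolding dist_norm using T by (subst tau_diff[symmetric]) (simp_all add: op_distrib I_right upow_B)
    also have "\<dots> \<le> M * (N T * (2 * pi * \<bar>k\<bar> * \<bar>t - s\<bar>))"
      using T d by (intro tau_bound_le I_right order_trans[OF N_right] mult_left_mono upow_diff_norm N_nonneg)
    finally show "dist (\<tau> (T o\<^sub>L upow k t)) (\<tau> (T o\<^sub>L upow k s)) \<le> ?L * dist t s"
      by (simp add: dist_real_def mult_ac)
  qed (use T M_nonneg N_nonneg in simp)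
  then show ?thesis by (rule lipschitz_on_continuous_on)
qed

text \<open>The derivative of \<open>\<tau> (U\<^sub>s\<^sup>k - U\<^sub>0\<^sup>k)\<close> is \<open>i k \<tau> (A U\<^sub>s\<^sup>k)\<close>; the fundamental theorem of calculus integrates it
  over the path.\<close>

lemma tau_upow_difference: "\<tau> (upow k 1 - upow k 0) = \<i> * k * (moment \<Theta>_pos k - moment \<Theta>_neg k)"
proof -
  obtain C where C: "\<And>s t. cmod (\<tau> (upow k t - upow k s) - complex_of_real (t - s) * (\<i> * k * \<tau> (A o\<^sub>L upow k s))) \<le> C * (t - s)\<^sup>2"
    using tau_upow_first_order by blast
  define F where "F s = \<tau> (upow k s - upow k 0)" for s
  define D where "D s = \<i> * k * \<tau> (A o\<^sub>L upow k s)" for s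
  have der: "(F has_vector_derivative D s) (at s within {0..1})" for s
    unfolding has_vector_derivative_def has_derivative_within
  proof (intro conjI bounded_linear_scaleR_left)
    have "((\<lambda>t. C * \<bar>t - s\<bar>) \<longlongrightarrow> C * \<bar>s - s\<bar>) (at s within {0..1})" by (intro tendsto_intros)
    then have C0: "((\<lambda>t. C * \<bar>t - s\<bar>) \<longlongrightarrow> 0) (at s within {0..1})" by simp
    show "((\<lambda>t. (1 / norm (t - s)) *\<^sub>R (F t - (F s + (t - s) *\<^sub>R D s))) \<longlongrightarrow> 0) (at s within {0..1})"
    proof (rule Lim_null_comparison[OF _ C0], intro always_eventually allI)
      fix t
      have "F t - F s = \<tau> (upow k t - upow k s)"
        unfolding F_def by (subst tau_diff[symmetric]) (simp_all add: upow_diff_I)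
      then have "norm (F t - (F s + (t - s) *\<^sub>R D s)) \<le> C * (t - s)\<^sup>2"
        using C[of t s] by (simp add: D_def scaleR_conv_of_real algebra_simps)
      then have "norm ((1 / norm (t - s)) *\<^sub>R (F t - (F s + (t - s) *\<^sub>R D s))) \<le> (1 / \<bar>t - s\<bar>) * (C * (t - s)\<^sup>2)"
        by (simp add: mult_left_mono divide_right_mono)
      also have "\<dots> = C * \<bar>t - s\<bar>"
        using power2_abs[of "t - s"] by (cases "t = s") (simp_all add: power2_eq_square field_simps del: power2_abs)
      finally show "norm ((1 / norm (t - s)) *\<^sub>R (F t - (F s + (t - s) *\<^sub>R D s))) \<le> C * \<bar>t - s\<bar>" .
    qed
  qed
  have "(D has_integral (F 1 - F 0)) {0..1}"
    by (rule fundamental_theorem_of_calculus) (use der in auto)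
  moreover have "F 0 = 0" by (simp add: F_def tau_0)
  ultimately have "F 1 = integral {0..1} D" by (simp add: integral_unique)
  also have "\<dots> = integral {0..1} (\<lambda>s. \<i> * k * (\<tau> (\<Theta>_pos o\<^sub>L upow k s) - \<tau> (\<Theta>_neg o\<^sub>L upow k s)))"
    unfolding D_def using \<Theta>_parts(1,2)
    by (simp add: \<Theta>_parts(6) op_distrib tau_diff I_right upow_B)
  also have "\<dots> = \<i> * k * integral {0..1} (\<lambda>s. \<tau> (\<Theta>_pos o\<^sub>L upow k s) - \<tau> (\<Theta>_neg o\<^sub>L upow k s))"
    by (rule integral_mult_right)
  also have "integral {0..1} (\<lambda>s. \<tau> (\<Theta>_pos o\<^sub>L upow k s) - \<tau> (\<Theta>_neg o\<^sub>L upow k s)) = moment \<Theta>_pos k - moment \<Theta>_neg k"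
    unfolding moment_def
    by (intro Henstock_Kurzweil_Integration.integral_diff integrable_continuous_interval tau_upow_continuous \<Theta>_parts)
  finally show ?thesis by (simp add: F_def)
qed

lemma moment_0: assumes "T \<in> I" shows "moment T 0 = \<tau> T"
  by (simp add: moment_def upow_0)

lemma upow_split: "upow (int j - int l) s = opow (U s) j o\<^sub>L opow (U' s) l"
proof (induction j arbitrary: l)
  case 0
  then show ?case by (auto simp: upow_def)
next
  case (Suc j)
  show ?case
  proof (cases l)
    case 0
    then show ?thesis by (simp add: upow_def nat_add_distrib)
  next
    case (Suc m)
    have "opow (U s) (Suc j) o\<^sub>L opow (U' s) (Suc m) = opow (U s) j o\<^sub>L ((U s o\<^sub>L U' s) o\<^sub>L opow (U' s) m)"
      by (simp add: opow_Suc2[of "U s" j] opow_Suc[of "U' s" m] op_comp_assoc)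
    then show ?thesis using Suc.IH[of m] by (simp add: Suc U_inverse)
  qed
qed

lemma opow_adj: "adjoint_pair (opow (U s) n) (opow (U' s) n)"
proof (induction n)
  case (Suc n)
  then show ?case unfolding opow_Suc[of "U s" n] opow_Suc2[of "U' s" n] by (intro adjoint_pair_comp U_adj)
qed (simp add: adjp)

lemma adjoint_pair_sum: "(\<And>i. i \<in> F \<Longrightarrow> adjoint_pair (f i) (g i)) \<Longrightarrow> adjoint_pair (sum f F) (sum g F)"
  by (induction F rule: infinite_finite_induct) (simp_all add: adjp)

text \<open>With \<open>Q = \<Sum>j. c\<^sub>j U\<^sub>s\<^sup>j\<close> the Toeplitz form of the integrand is \<open>\<tau> (T Q Q\<^sup>*) = \<tau> (Q\<^sup>* T Q)\<close>, by cyclicity, and the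
  trace is positive.\<close>

lemma moment_positive_definite:
  assumes T: "T \<in> I" "nonneg_op T"
  shows "positive_definite (moment T)"
  unfolding positive_definite_def
proof (intro allI)
  fix n :: nat and c :: "nat \<Rightarrow> complex"
  define g where "g s = (\<Sum>j<n. \<Sum>l<n. c j * cnj (c l) * \<tau> (T o\<^sub>L upow (int j - int l) s))" for s
  have g_pos: "g s \<in> \<real>\<^sub>\<ge>\<^sub>0" for s
  proof -
    define Q where "Q = (\<Sum>j<n. c j *\<^sub>o opow (U s) j)"
    define Q' where "Q' = (\<Sum>l<n. cnj (c l) *\<^sub>o opow (U' s) l)"
    have QB: "Q \<in> B" "Q' \<in> B" unfolding Q_def Q'_def by (intro B_sum inB opow_B U_B)+
    have adj: "adjoint_pair Q Q'" unfolding Q_def Q'_def by (intro adjoint_pair_sum adjoint_pair_scaleC opow_adj)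
    have TU: "T o\<^sub>L opow (U s) j \<in> I" for j by (intro I_right opow_B U_B T)
    have "(T o\<^sub>L Q) o\<^sub>L Q' = (\<Sum>l<n. \<Sum>j<n. (c j * cnj (c l)) *\<^sub>o (T o\<^sub>L upow (int j - int l) s))"
      unfolding Q_def Q'_def upow_split opc.sum_right opc.sum_left
      using I_B[OF T(1)]
      by (simp add: scaleC_op_comp_left scaleC_op_comp_right B_bounded inB opow_B U_B op_comp_assoc scaleC_op_scaleC)
    also have "\<dots> = (\<Sum>j<n. \<Sum>l<n. (c j * cnj (c l)) *\<^sub>o (T o\<^sub>L upow (int j - int l) s))"
      by (rule sum.swap)
    finally have "\<tau> ((T o\<^sub>L Q) o\<^sub>L Q') = g s"
      unfolding g_def using T by (simp add: tau_sum tau_scaleC I_sum I_scaleC I_right upow_B)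
    moreover have "\<tau> ((T o\<^sub>L Q) o\<^sub>L Q') = \<tau> (Q' o\<^sub>L T o\<^sub>L Q)"
      unfolding op_comp_assoc[of Q' T Q] using T QB by (intro tau_commute I_right)
    moreover have "nonneg_op (Q' o\<^sub>L T o\<^sub>L Q)" by (intro nonneg_op_conj adj T B_bounded QB)
    then have "\<tau> (Q' o\<^sub>L T o\<^sub>L Q) \<in> \<real>\<^sub>\<ge>\<^sub>0" using T QB by (intro tau_nonneg I_left I_right)
    ultimately show ?thesis by simp
  qed
  have gc: "continuous_on {0..1} g"
    unfolding g_def[abs_def] by (intro continuous_intros tau_upow_continuous T)
  have int: "(\<lambda>s. z * \<tau> (T o\<^sub>L upow k s)) integrable_on {0..1}" for z k
    by (intro integrable_continuous_interval continuous_intros tau_upow_continuous T)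
  have "integral {0..1} g = (\<Sum>j<n. \<Sum>l<n. c j * cnj (c l) * moment T (int j - int l))"
    unfolding g_def[abs_def] moment_def
    by (simp add: Henstock_Kurzweil_Integration.integral_sum integrable_sum int)
  moreover have "integral {0..1} g \<in> \<real>\<^sub>\<ge>\<^sub>0"
  proof -
    have geq: "g = (\<lambda>s. of_real (Re (g s)))"
      using g_pos by (auto simp: fun_eq_iff complex_eq_iff complex_nonneg_Reals_iff)
    have Re_int: "(\<lambda>s. Re (g s)) integrable_on {0..1}"
      by (intro integrable_continuous_interval continuous_intros gc)
    have "integral {0..1} g = integral {0..1} (of_real \<circ> (\<lambda>s. Re (g s)))"
      using arg_cong[OF geq, of "integral {0..1}"] by (simp add: o_def)
    also have "\<dots> = of_real (integral {0..1} (\<lambda>s. Re (g s)))"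
      by (rule integral_linear[OF Re_int bounded_linear_of_real])
    finally have "integral {0..1} g = of_real (integral {0..1} (\<lambda>s. Re (g s)))" .
    moreover have "integral {0..1} (\<lambda>s. Re (g s)) \<ge> 0"
      using g_pos by (intro Henstock_Kurzweil_Integration.integral_nonneg Re_int)
        (auto simp: complex_nonneg_Reals_iff)
    ultimately show ?thesis by simp
  qed
  ultimately show "(\<Sum>j<n. \<Sum>l<n. c j * cnj (c l) * moment T (int j - int l)) \<in> \<real>\<^sub>\<ge>\<^sub>0" by simp
qed

end

section \<open>Complex measures with a density\<close>

text \<open>The supremum over subsets of \<open>E\<close> is attained at the part of \<open>E\<close> where the density is positive.\<close>

lemma positive_part_density:
  fixes h :: "'a \<Rightarrow> real"
  assumes h: "integrable \<rho> h"
  shows "positive_part \<rho> (\<lambda>E. set_lebesgue_integral \<rho> E h) = density \<rho> (\<lambda>x. ennreal (h x))"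
proof -
  have [measurable]: "h \<in> borel_measurable \<rho>" using h by simp
  have int: "integrable \<rho> (\<lambda>x. indicator A x * h x)" if "A \<in> sets \<rho>" for A
    using integrable_mult_indicator[OF that h] by simp
  have SUP: "(SUP A \<in> {A \<in> sets \<rho>. A \<subseteq> E}. ennreal (set_lebesgue_integral \<rho> A h))
      = (\<integral>\<^sup>+x. ennreal (h x) * indicator E x \<partial>\<rho>)" if E: "E \<in> sets \<rho>" for E
  proof (rule antisym)
    show "(SUP A \<in> {A \<in> sets \<rho>. A \<subseteq> E}. ennreal (set_lebesgue_integral \<rho> A h))
      \<le> (\<integral>\<^sup>+x. ennreal (h x) * indicator E x \<partial>\<rho>)"
    proof (rule SUP_least)
      fix A assume A: "A \<in> {A \<in> sets \<rho>. A \<subseteq> E}"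
      have i: "integrable \<rho> (\<lambda>x. max 0 (indicator A x * h x))"
        using int[of A] A by (intro integrable_max) auto
      have "set_lebesgue_integral \<rho> A h \<le> (\<integral>x. max 0 (indicator A x * h x) \<partial>\<rho>)"
        unfolding set_lebesgue_integral_def using int[of A] A i
        by (intro integral_mono) auto
      then have "ennreal (set_lebesgue_integral \<rho> A h) \<le> ennreal (\<integral>x. max 0 (indicator A x * h x) \<partial>\<rho>)"
        by (rule ennreal_leI)
      also have "\<dots> = (\<integral>\<^sup>+x. ennreal (max 0 (indicator A x * h x)) \<partial>\<rho>)"
        by (rule nn_integral_eq_integral[symmetric]) (use i in auto)
      also have "\<dots> \<le> (\<integral>\<^sup>+x. ennreal (h x) * indicator E x \<partial>\<rho>)"
        using A by (intro nn_integral_mono) (auto simp: indicator_def)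
      finally show "ennreal (set_lebesgue_integral \<rho> A h) \<le> (\<integral>\<^sup>+x. ennreal (h x) * indicator E x \<partial>\<rho>)" .
    qed
    define A where "A = E \<inter> {x \<in> space \<rho>. h x > 0}"
    have A: "A \<in> sets \<rho>" "A \<subseteq> E" using E by (auto simp: A_def)
    have "(\<integral>\<^sup>+x. ennreal (h x) * indicator E x \<partial>\<rho>) = (\<integral>\<^sup>+x. ennreal (indicator A x * h x) \<partial>\<rho>)"
      by (intro nn_integral_cong) (auto simp: A_def indicator_def ennreal_neg)
    also have "\<dots> = ennreal (set_lebesgue_integral \<rho> A h)"
      unfolding set_lebesgue_integral_def real_scaleR_def
      by (rule nn_integral_eq_integral[OF int[OF A(1)]]) (auto simp: A_def indicator_def)
    also have "\<dots> \<le> (SUP A \<in> {A \<in> sets \<rho>. A \<subseteq> E}. ennreal (set_lebesgue_integral \<rho> A h))"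
      using A by (intro SUP_upper) auto
    finally show "(\<integral>\<^sup>+x. ennreal (h x) * indicator E x \<partial>\<rho>)
      \<le> (SUP A \<in> {A \<in> sets \<rho>. A \<subseteq> E}. ennreal (set_lebesgue_integral \<rho> A h))" .
  qed
  show ?thesis
    unfolding positive_part_def density_def
    by (rule measure_of_eq[OF sets.space_closed]) (simp add: sets.sigma_sets_eq SUP)
qed

lemma integrable_scaleR_bounded:
  fixes k :: "'a \<Rightarrow> real" and g :: "'a \<Rightarrow> complex"
  assumes k: "integrable \<rho> k" and g: "g \<in> borel_measurable \<rho>"
    and b: "\<And>x. x \<in> space \<rho> \<Longrightarrow> cmod (g x) \<le> K"
  shows "integrable \<rho> (\<lambda>x. k x *\<^sub>R g x)"
proof (rule Bochner_Integration.integrable_bound)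
  show "integrable \<rho> (\<lambda>x. K * norm (k x))" using k by simp
  show "AE x in \<rho>. norm (k x *\<^sub>R g x) \<le> norm (K * norm (k x))"
  proof (rule AE_I2)
    fix x assume x: "x \<in> space \<rho>"
    have "\<bar>k x\<bar> * cmod (g x) \<le> \<bar>k x\<bar> * \<bar>K\<bar>" using b[OF x] by (intro mult_left_mono) auto
    then show "norm (k x *\<^sub>R g x) \<le> norm (K * norm (k x))" by (simp add: abs_mult mult.commute)
  qed
  show "(\<lambda>x. k x *\<^sub>R g x) \<in> borel_measurable \<rho>" using k g by measurable
qed

lemma integral_positive_part_difference:
  fixes h :: "'a \<Rightarrow> real" and g :: "'a \<Rightarrow> complex"
  assumes h: "integrable \<rho> h" and g [measurable]: "g \<in> borel_measurable \<rho>"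
    and b: "\<And>x. x \<in> space \<rho> \<Longrightarrow> cmod (g x) \<le> K"
  shows "integral\<^sup>L (positive_part \<rho> (\<lambda>E. set_lebesgue_integral \<rho> E h)) g
      - integral\<^sup>L (positive_part \<rho> (\<lambda>E. - set_lebesgue_integral \<rho> E h)) g = (\<integral>x. h x *\<^sub>R g x \<partial>\<rho>)"
proof -
  have [measurable]: "h \<in> borel_measurable \<rho>" using h by simp
  have p: "integral\<^sup>L (positive_part \<rho> (\<lambda>E. set_lebesgue_integral \<rho> E k)) g = (\<integral>x. max 0 (k x) *\<^sub>R g x \<partial>\<rho>)"
    if k: "integrable \<rho> k" for k
  proof -
    have [measurable]: "k \<in> borel_measurable \<rho>" using k by simp
    have "positive_part \<rho> (\<lambda>E. set_lebesgue_integral \<rho> E k) = density \<rho> (\<lambda>x. ennreal (max 0 (k x)))"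
      unfolding positive_part_density[OF k] by simp
    then show ?thesis by (simp only:) (rule integral_density, auto)
  qed
  have neg: "- set_lebesgue_integral \<rho> E h = set_lebesgue_integral \<rho> E (\<lambda>x. - h x)" for E
    by (simp add: set_lebesgue_integral_def)
  have int: "integrable \<rho> (\<lambda>x. max 0 (k x) *\<^sub>R g x)" if k: "integrable \<rho> k" for k
    using k by (intro integrable_scaleR_bounded[OF _ g b] integrable_max) auto
  have nh: "integrable \<rho> (\<lambda>x. - h x)" using h by simp
  have "(\<integral>x. max 0 (h x) *\<^sub>R g x \<partial>\<rho>) - (\<integral>x. max 0 (- h x) *\<^sub>R g x \<partial>\<rho>)
      = (\<integral>x. max 0 (h x) *\<^sub>R g x - max 0 (- h x) *\<^sub>R g x \<partial>\<rho>)"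
    by (rule Bochner_Integration.integral_diff[symmetric, OF int[OF h] int[OF nh]])
  also have "\<dots> = (\<integral>x. h x *\<^sub>R g x \<partial>\<rho>)"
    by (intro Bochner_Integration.integral_cong refl) (auto simp: max_def)
  finally show ?thesis unfolding neg p[OF h] p[OF nh] .
qed

lemma complex_integral_density:
  fixes c g :: "'a \<Rightarrow> complex"
  assumes c: "integrable \<rho> c" and g: "g \<in> borel_measurable \<rho>"
    and b: "\<And>x. x \<in> space \<rho> \<Longrightarrow> cmod (g x) \<le> K"
  shows "complex_integral \<rho> (\<lambda>E. set_lebesgue_integral \<rho> E c) g = (\<integral>x. c x * g x \<partial>\<rho>)"
proof -
  have cc: "integrable \<rho> (\<lambda>x. Re (c x))" "integrable \<rho> (\<lambda>x. Im (c x))" using c by simp_all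
  have si: "integrable \<rho> (\<lambda>x. indicator E x *\<^sub>R c x)" if "E \<in> sets \<rho>" for E
    by (rule integrable_mult_indicator[OF that c])
  have re: "positive_part \<rho> (\<lambda>E. s * Re (set_lebesgue_integral \<rho> E c)) = positive_part \<rho> (\<lambda>E. s * set_lebesgue_integral \<rho> E (\<lambda>x. Re (c x)))"
    and im: "positive_part \<rho> (\<lambda>E. s * Im (set_lebesgue_integral \<rho> E c)) = positive_part \<rho> (\<lambda>E. s * set_lebesgue_integral \<rho> E (\<lambda>x. Im (c x)))" for s
  proof -
    have "Re (set_lebesgue_integral \<rho> E c) = set_lebesgue_integral \<rho> E (\<lambda>x. Re (c x))"
      "Im (set_lebesgue_integral \<rho> E c) = set_lebesgue_integral \<rho> E (\<lambda>x. Im (c x))" if "E \<in> sets \<rho>" for E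
      unfolding set_lebesgue_integral_def
      by (simp_all add: integral_Re[OF si[OF that], symmetric] integral_Im[OF si[OF that], symmetric])
    then show "positive_part \<rho> (\<lambda>E. s * Re (set_lebesgue_integral \<rho> E c)) = positive_part \<rho> (\<lambda>E. s * set_lebesgue_integral \<rho> E (\<lambda>x. Re (c x)))"
      "positive_part \<rho> (\<lambda>E. s * Im (set_lebesgue_integral \<rho> E c)) = positive_part \<rho> (\<lambda>E. s * set_lebesgue_integral \<rho> E (\<lambda>x. Im (c x)))"
      unfolding positive_part_def
      by (intro measure_of_eq[OF sets.space_closed] SUP_cong refl; simp)+
  qed
  note int = integrable_scaleR_bounded[OF _ g b]
  have "complex_integral \<rho> (\<lambda>E. set_lebesgue_integral \<rho> E c) g
      = (\<integral>x. Re (c x) *\<^sub>R g x \<partial>\<rho>) + \<i> * (\<integral>x. Im (c x) *\<^sub>R g x \<partial>\<rho>)"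
    unfolding complex_integral_def
    using integral_positive_part_difference[OF cc(1) g b] integral_positive_part_difference[OF cc(2) g b]
      re[of 1] re[of "-1"] im[of 1] im[of "-1"] by simp
  also have "\<dots> = (\<integral>x. Re (c x) *\<^sub>R g x \<partial>\<rho>) + (\<integral>x. \<i> * (Im (c x) *\<^sub>R g x) \<partial>\<rho>)"
    by (simp only: integral_mult_right_zero)
  also have "\<dots> = (\<integral>x. Re (c x) *\<^sub>R g x + \<i> * (Im (c x) *\<^sub>R g x) \<partial>\<rho>)"
    by (intro Bochner_Integration.integral_add[symmetric] integrable_mult_right int cc)
  also have "\<dots> = (\<integral>x. c x * g x \<partial>\<rho>)"
  proof (intro Bochner_Integration.integral_cong refl)
    fix x
    have "c x * g x = (of_real (Re (c x)) + \<i> * of_real (Im (c x))) * g x" by (metis complex_eq)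
    then show "Re (c x) *\<^sub>R g x + \<i> * (Im (c x) *\<^sub>R g x) = c x * g x"
      by (simp add: scaleR_conv_of_real distrib_right mult.assoc)
  qed
  finally show ?thesis .
qed

lemma complex_measure_density:
  assumes c: "integrable \<rho> (c :: 'a \<Rightarrow> complex)"
  shows "complex_measure \<rho> (\<lambda>E. set_lebesgue_integral \<rho> E c)"
  unfolding complex_measure_def
proof (intro allI impI)
  fix A :: "nat \<Rightarrow> 'a set" assume A: "range A \<subseteq> sets \<rho> \<and> disjoint_family A"
  have Am: "A i \<in> sets \<rho>" for i using A by auto
  have si: "set_integrable \<rho> E c" if "E \<in> sets \<rho>" for E
    unfolding set_integrable_def by (rule integrable_mult_indicator[OF that c])
  have "(\<lambda>n. set_lebesgue_integral \<rho> (\<Union>i<n. A i) c) \<longlonglongrightarrow> set_lebesgue_integral \<rho> (\<Union>n. \<Union>i<n. A i) c"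
    using Am by (intro set_integral_cont_up si incseq_SucI) (auto intro: less_SucI)
  moreover have "(\<Union>n. \<Union>i<n. A i) = (\<Union>n. A n)" by auto
  moreover have "set_lebesgue_integral \<rho> (\<Union>i<n. A i) c = (\<Sum>i<n. set_lebesgue_integral \<rho> (A i) c)" for n
    using A Am si by (intro set_integral_finite_Union) (auto simp: disjoint_family_on_def)
  ultimately show "(\<lambda>n. set_lebesgue_integral \<rho> (A n) c) sums set_lebesgue_integral \<rho> (\<Union>n. A n) c"
    by (simp add: sums_def)
qed

lemma sum_measure:
  assumes "finite_measure \<nu>1" "finite_measure \<nu>2" "sets \<nu>1 = sets M" "sets \<nu>2 = sets M"
  obtains \<rho> where "finite_measure \<rho>" "sets \<rho> = sets M"
    "\<And>A. A \<in> sets M \<Longrightarrow> emeasure \<rho> A = emeasure \<nu>1 A + emeasure \<nu>2 A"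
proof -
  define \<rho> where "\<rho> = measure_of (space M) (sets M) (\<lambda>A. emeasure \<nu>1 A + emeasure \<nu>2 A)"
  have sets: "sets \<rho> = sets M" by (simp add: \<rho>_def)
  have em: "emeasure \<rho> A = emeasure \<nu>1 A + emeasure \<nu>2 A" if "A \<in> sets M" for A
  proof (rule emeasure_measure_of[OF \<rho>_def])
    show "sets M \<subseteq> Pow (space M)" by (rule sets.space_closed)
    show "positive (sets \<rho>) (\<lambda>A. emeasure \<nu>1 A + emeasure \<nu>2 A)" by (simp add: positive_def)
    show "countably_additive (sets \<rho>) (\<lambda>A. emeasure \<nu>1 A + emeasure \<nu>2 A)"
      unfolding countably_additive_def
    proof (intro allI impI)
      fix F :: "nat \<Rightarrow> _" assume "range F \<subseteq> sets \<rho>" "disjoint_family F"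
      then show "(\<Sum>i. emeasure \<nu>1 (F i) + emeasure \<nu>2 (F i)) = emeasure \<nu>1 (\<Union>i. F i) + emeasure \<nu>2 (\<Union>i. F i)"
        using assms(3,4) sets by (subst suminf_add[symmetric]) (simp_all add: suminf_emeasure)
    qed
  qed (use that sets in simp)
  have sp: "space \<rho> = space \<nu>1" "space \<rho> = space \<nu>2" "space \<rho> = space M"
    using sets assms(3,4) by (metis sets_eq_imp_space_eq)+
  have "finite_measure \<rho>"
  proof (rule finite_measureI)
    have "emeasure \<rho> (space \<rho>) = emeasure \<nu>1 (space \<nu>1) + emeasure \<nu>2 (space \<nu>2)"
      using em[of "space M"] sp by simp
    then show "emeasure \<rho> (space \<rho>) \<noteq> \<infinity>"
      using assms(1,2) by (simp add: finite_measure.emeasure_finite)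
  qed
  then show ?thesis using that sets em by blast
qed

text \<open>A complex measure assembled from two finite positive measures: the density with respect to
  their sum is \<open>w\<close> times a difference of Radon--Nikodym derivatives.\<close>

theorem weighted_difference_measure:
  fixes w :: "'a \<Rightarrow> complex"
  assumes fin: "finite_measure \<nu>1" "finite_measure \<nu>2" and sets: "sets \<nu>1 = sets M" "sets \<nu>2 = sets M"
    and w [measurable]: "w \<in> borel_measurable M" and w1: "\<And>x. x \<in> space M \<Longrightarrow> cmod (w x) \<le> 1"
  obtains \<mu> where "complex_measure M \<mu>"
    "total_variation M \<mu> \<le> emeasure \<nu>1 (space M) + emeasure \<nu>2 (space M)"
    "\<And>g K. g \<in> borel_measurable M \<Longrightarrow> (\<And>x. x \<in> space M \<Longrightarrow> cmod (g x) \<le> K) \<Longrightarrow>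
      complex_integral M \<mu> g = (\<integral>x. w x * g x \<partial>\<nu>1) - (\<integral>x. w x * g x \<partial>\<nu>2)"
proof -
  obtain \<rho> where \<rho>: "finite_measure \<rho>" "sets \<rho> = sets M"
    and em: "\<And>A. A \<in> sets M \<Longrightarrow> emeasure \<rho> A = emeasure \<nu>1 A + emeasure \<nu>2 A"
    using sum_measure[OF fin sets] by blast
  interpret \<rho>: finite_measure \<rho> by fact
  have sp: "space \<rho> = space M" using \<rho>(2) by (rule sets_eq_imp_space_eq)
  have [measurable_cong]: "sets \<rho> = sets M" by fact
  have RN: "\<exists>a. a \<in> borel_measurable M \<and> (\<forall>x. 0 \<le> a x) \<and> \<nu> = density \<rho> (\<lambda>x. ennreal (a x)) \<and> integrable \<rho> a"
    if \<nu>: "finite_measure \<nu>" "sets \<nu> = sets M" "\<And>A. A \<in> sets M \<Longrightarrow> emeasure \<nu> A \<le> emeasure \<rho> A" for \<nu>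
  proof -
    have ac: "absolutely_continuous \<rho> \<nu>"
      unfolding absolutely_continuous_def
    proof
      fix A assume "A \<in> null_sets \<rho>"
      then have "A \<in> sets M" "emeasure \<rho> A = 0" using \<rho>(2) by auto
      then show "A \<in> null_sets \<nu>" using \<nu>(2) \<nu>(3)[of A] by (auto simp: null_sets_def)
    qed
    have s: "sets \<nu> = sets \<rho>" using \<nu>(2) \<rho>(2) by simp
    obtain D where D: "D \<in> borel_measurable \<rho>" "AE x in \<rho>. RN_deriv \<rho> \<nu> x = ennreal (D x)" "\<And>x. 0 \<le> D x"
      using \<rho>.real_RN_deriv[OF \<nu>(1) ac s] by blast
    have "\<nu> = density \<rho> (RN_deriv \<rho> \<nu>)" by (rule \<rho>.density_RN_deriv[OF ac s, symmetric])
    also have "\<dots> = density \<rho> (\<lambda>x. ennreal (D x))" using D by (intro density_cong) auto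
    finally have eq: "\<nu> = density \<rho> (\<lambda>x. ennreal (D x))" .
    have "integrable \<rho> D"
    proof (rule integrableI_nonneg[OF D(1)])
      have "(\<integral>\<^sup>+x. ennreal (D x) \<partial>\<rho>) = emeasure \<nu> (space \<rho>)"
        unfolding eq using D(1) by (subst emeasure_density) (auto intro!: nn_integral_cong)
      also have "\<dots> < \<infinity>" using finite_measure.emeasure_finite[OF \<nu>(1), of "space \<rho>"] by (simp add: less_top)
      finally show "(\<integral>\<^sup>+x. ennreal (D x) \<partial>\<rho>) < \<infinity>" .
    qed (use D(3) in auto)
    moreover have "D \<in> borel_measurable M" using D(1) by measurable
    ultimately show ?thesis using D(3) eq by blast
  qed
  obtain a where a [measurable]: "a \<in> borel_measurable M" and a0: "\<And>x. 0 \<le> a x"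
    and a1: "\<nu>1 = density \<rho> (\<lambda>x. ennreal (a x))" and ai: "integrable \<rho> a"
    using RN[OF fin(1) sets(1)] em by auto
  obtain b where b [measurable]: "b \<in> borel_measurable M" and b0: "\<And>x. 0 \<le> b x"
    and b1: "\<nu>2 = density \<rho> (\<lambda>x. ennreal (b x))" and bi: "integrable \<rho> b"
    using RN[OF fin(2) sets(2)] em by auto
  define c where "c x = w x * of_real (a x - b x)" for x
  have c_meas [measurable]: "c \<in> borel_measurable M" unfolding c_def[abs_def] by measurable
  have c_le: "cmod (c x) \<le> a x + b x" if "x \<in> space M" for x
  proof -
    have "cmod (c x) = cmod (w x) * \<bar>a x - b x\<bar>" by (simp only: c_def norm_mult norm_of_real)
    also have "\<dots> \<le> 1 * \<bar>a x - b x\<bar>" using w1[OF that] by (intro mult_right_mono) auto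
    also have "\<dots> \<le> a x + b x" using a0[of x] b0[of x] by simp
    finally show ?thesis .
  qed
  have ci: "integrable \<rho> c"
  proof (rule Bochner_Integration.integrable_bound)
    show "integrable \<rho> (\<lambda>x. a x + b x)" using ai bi by simp
    show "c \<in> borel_measurable \<rho>" by measurable
    show "AE x in \<rho>. norm (c x) \<le> norm (a x + b x)"
      using c_le a0 b0 sp by (intro AE_I2) (simp add: abs_of_nonneg)
  qed
  define \<mu> where "\<mu> E = set_lebesgue_integral \<rho> E c" for E
  have cong_pp: "positive_part M f = positive_part \<rho> f" for f
    unfolding positive_part_def sp \<rho>(2) ..
  show ?thesis
  proof (rule that[of \<mu>])
    show "complex_measure M \<mu>"
      using complex_measure_density[OF ci] unfolding complex_measure_def \<mu>_def \<rho>(2) .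
    have \<mu>_le: "ennreal (cmod (\<mu> E)) \<le> emeasure \<rho> E" if E: "E \<in> sets M" for E
    proof -
      have i: "integrable \<rho> (\<lambda>x. indicator E x * (a x + b x))"
        using integrable_mult_indicator[of E \<rho> "\<lambda>x. a x + b x"] E \<rho>(2) ai bi by simp
      have "cmod (\<mu> E) \<le> (\<integral>x. norm (indicator E x *\<^sub>R c x) \<partial>\<rho>)"
        unfolding \<mu>_def set_lebesgue_integral_def by (rule integral_norm_bound)
      also have "\<dots> \<le> (\<integral>x. indicator E x * (a x + b x) \<partial>\<rho>)"
      proof (rule integral_mono)
        show "integrable \<rho> (\<lambda>x. norm (indicator E x *\<^sub>R c x))"
          using integrable_mult_indicator[of E \<rho> c] E \<rho>(2) ci by (intro integrable_norm) simp
        show "norm (indicator E x *\<^sub>R c x) \<le> indicator E x * (a x + b x)" if "x \<in> space \<rho>" for x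
          using c_le[of x] that sp by (auto simp: indicator_def)
      qed (rule i)
      finally have "ennreal (cmod (\<mu> E)) \<le> ennreal (\<integral>x. indicator E x * (a x + b x) \<partial>\<rho>)" by (rule ennreal_leI)
      also have "\<dots> = (\<integral>\<^sup>+x. ennreal (indicator E x * (a x + b x)) \<partial>\<rho>)"
        using a0 b0 by (intro nn_integral_eq_integral[symmetric] i AE_I2) simp
      also have "\<dots> = (\<integral>\<^sup>+x. ennreal (a x) * indicator E x + ennreal (b x) * indicator E x \<partial>\<rho>)"
        using a0 b0 by (intro nn_integral_cong) (auto simp: indicator_def)
      also have "\<dots> = emeasure \<nu>1 E + emeasure \<nu>2 E"
        using E \<rho>(2) unfolding a1 b1 by (subst nn_integral_add) (auto simp: emeasure_density)
      also have "\<dots> = emeasure \<rho> E" using em[OF E] by simp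
      finally show ?thesis .
    qed
    show "total_variation M \<mu> \<le> emeasure \<nu>1 (space M) + emeasure \<nu>2 (space M)"
      unfolding total_variation_def
    proof (rule SUP_least)
      fix \<P> assume P: "\<P> \<in> {\<P>. finite \<P> \<and> \<P> \<subseteq> sets M \<and> disjoint \<P>}"
      have "(\<Sum>E\<in>\<P>. ennreal (cmod (\<mu> E))) \<le> (\<Sum>E\<in>\<P>. emeasure \<rho> E)"
        using P by (intro sum_mono \<mu>_le) auto
      also have "\<dots> = emeasure \<rho> (\<Union>E\<in>\<P>. E)"
        using P \<rho>(2) by (intro sum_emeasure) (auto simp: disjoint_family_on_def disjoint_def)
      also have "\<dots> \<le> emeasure \<rho> (space \<rho>)" by (rule emeasure_space)
      finally show "(\<Sum>E\<in>\<P>. ennreal (cmod (\<mu> E))) \<le> emeasure \<nu>1 (space M) + emeasure \<nu>2 (space M)"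
        using em[of "space M"] sp by simp
    qed
    fix g K assume g [measurable]: "g \<in> borel_measurable M" and gK: "\<And>x. x \<in> space M \<Longrightarrow> cmod (g x) \<le> K"
    have g\<rho>: "g \<in> borel_measurable \<rho>" by measurable
    have "complex_integral M \<mu> g = (\<integral>x. c x * g x \<partial>\<rho>)"
      using complex_integral_density[OF ci g\<rho>, of K] gK sp
      unfolding complex_integral_def cong_pp \<mu>_def by simp
    also have "\<dots> = (\<integral>x. a x *\<^sub>R (w x * g x) - b x *\<^sub>R (w x * g x) \<partial>\<rho>)"
      by (intro Bochner_Integration.integral_cong refl) (simp add: c_def scaleR_conv_of_real algebra_simps)
    also have "\<dots> = (\<integral>x. a x *\<^sub>R (w x * g x) \<partial>\<rho>) - (\<integral>x. b x *\<^sub>R (w x * g x) \<partial>\<rho>)"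
    proof -
      have "cmod (w x * g x) \<le> 1 * \<bar>K\<bar>" if "x \<in> space \<rho>" for x
        unfolding norm_mult using that sp w1[of x] gK[of x] by (intro mult_mono) auto
      then show ?thesis
        by (intro Bochner_Integration.integral_diff integrable_scaleR_bounded ai bi) simp_all
    qed
    also have "(\<integral>x. a x *\<^sub>R (w x * g x) \<partial>\<rho>) = (\<integral>x. w x * g x \<partial>\<nu>1)"
      unfolding a1 using a0 by (intro integral_density[symmetric]) auto
    also have "(\<integral>x. b x *\<^sub>R (w x * g x) \<partial>\<rho>) = (\<integral>x. w x * g x \<partial>\<nu>2)"
      unfolding b1 using b0 by (intro integral_density[symmetric]) auto
    finally show "complex_integral M \<mu> g = (\<integral>x. w x * g x \<partial>\<nu>1) - (\<integral>x. w x * g x \<partial>\<nu>2)" .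
  qed
qed

section \<open>Series over the integers\<close>

lemma filterlim_symmetric_intervals:
  "filterlim (\<lambda>n. {- int n..int n}) (finite_subsets_at_top UNIV) sequentially"
  unfolding filterlim_finite_subsets_at_top
proof (intro allI impI)
  fix X :: "int set" assume "finite X \<and> X \<subseteq> UNIV"
  then have b: "\<bar>x\<bar> \<le> (\<Sum>x\<in>X. \<bar>x\<bar>)" if "x \<in> X" for x
    using member_le_sum[of x X abs] that by simp
  have "X \<subseteq> {- int n..int n}" if "n \<ge> nat (\<Sum>x\<in>X. \<bar>x\<bar>)" for n
  proof
    fix x assume "x \<in> X"
    then show "x \<in> {- int n..int n}" using b[of x] that by auto
  qed
  then show "\<forall>\<^sub>F n in sequentially. finite {- int n..int n} \<and> X \<subseteq> {- int n..int n} \<and> {- int n..int n} \<subseteq> UNIV"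
    unfolding eventually_sequentially by auto
qed

lemma has_sum_symmetric:
  fixes f :: "int \<Rightarrow> 'a::{comm_monoid_add, topological_space}"
  shows "(f has_sum s) UNIV \<Longrightarrow> (\<lambda>n. sum f {- int n..int n}) \<longlonglongrightarrow> s"
  unfolding has_sum_def by (rule filterlim_compose[OF _ filterlim_symmetric_intervals])

text \<open>The weight \<open>k (k - 1)\<close> vanishes only at \<open>0\<close> and \<open>1\<close> and otherwise dominates both \<open>1\<close> and \<open>\<bar>k\<bar>\<close>.\<close>

lemma fun_class_summable:
  assumes "f \<in> \<F>"
  shows "(\<lambda>k. cmod (fourier_coeff f k)) summable_on UNIV"
    "(\<lambda>k. \<bar>real_of_int k\<bar> * cmod (fourier_coeff f k)) summable_on UNIV"
proof -
  let ?c = "\<lambda>k. cmod (fourier_coeff f k)"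
  define g where "g k = cmod (of_int (k * (k - 1)) * fourier_coeff f k) + (if k \<in> {0, 1} then ?c k else 0)" for k :: int
  have s1: "(\<lambda>k::int. cmod (of_int (k * (k - 1)) * fourier_coeff f k)) summable_on UNIV"
    using assms by (simp add: fun_class_def)
  have "?c summable_on {0, 1}" by (rule summable_on_finite) simp
  then have s2: "(\<lambda>k. if k \<in> {0, 1} then ?c k else 0) summable_on UNIV"
    by (rule summable_on_cong_neutral[THEN iffD1, rotated -1]) auto
  have g: "g summable_on UNIV" unfolding g_def[abs_def] by (rule summable_on_add[OF s1 s2])
  have le: "?c k \<le> g k" "\<bar>real_of_int k\<bar> * ?c k \<le> g k" for k
  proof -
    consider "k = 0" | "k = 1" | "k \<noteq> 0" "k \<noteq> 1" by blast
    then have "?c k \<le> g k \<and> \<bar>real_of_int k\<bar> * ?c k \<le> g k"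
    proof cases
      case 3
      then have "1 \<le> \<bar>k\<bar>" "1 \<le> \<bar>k - 1\<bar>" by linarith+
      then have k: "1 \<le> \<bar>real_of_int k\<bar>" "1 \<le> \<bar>real_of_int (k - 1)\<bar>" by (metis of_int_1_le_iff of_int_abs)+
      have gk: "g k = \<bar>real_of_int k\<bar> * \<bar>real_of_int (k - 1)\<bar> * ?c k"
        using 3 by (simp only: g_def norm_mult norm_of_int of_int_mult abs_mult) simp
      have "\<bar>real_of_int k\<bar> * 1 \<le> \<bar>real_of_int k\<bar> * \<bar>real_of_int (k - 1)\<bar>" using k by (intro mult_left_mono) auto
      then have "\<bar>real_of_int k\<bar> * ?c k \<le> g k" unfolding gk by (intro mult_right_mono) auto
      moreover have "1 * ?c k \<le> \<bar>real_of_int k\<bar> * ?c k" using k by (intro mult_right_mono) auto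
      ultimately show ?thesis by simp
    qed (simp_all add: g_def)
    then show "?c k \<le> g k" "\<bar>real_of_int k\<bar> * ?c k \<le> g k" by auto
  qed
  show "?c summable_on UNIV" "(\<lambda>k. \<bar>real_of_int k\<bar> * ?c k) summable_on UNIV"
    by (rule summable_on_comparison_test[OF g]; simp add: le)+
qed

lemma norm_unit_power_int: "z \<in> \<T> \<Longrightarrow> cmod (z powi k) = 1"
  by (simp add: norm_power_int)

lemma circle_deriv_partial_sums:
  assumes f: "f \<in> \<F>"
  defines "g \<equiv> \<lambda>n z. \<Sum>k\<in>{- int n..int n}. of_int k * fourier_coeff f k * z powi (k - 1)"
  shows "\<And>z. z \<in> \<T> \<Longrightarrow> (\<lambda>n. g n z) \<longlonglongrightarrow> circle_deriv f z"
    "\<exists>K. \<forall>n. \<forall>z\<in>\<T>. cmod (g n z) \<le> K"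
proof -
  let ?b = "\<lambda>k. \<bar>real_of_int k\<bar> * cmod (fourier_coeff f k)"
  have nb: "norm (of_int k * fourier_coeff f k * z powi (k - 1)) = ?b k" if "z \<in> \<T>" for z k
    using norm_unit_power_int[OF that] by (simp add: norm_mult)
  show "(\<lambda>n. g n z) \<longlonglongrightarrow> circle_deriv f z" if z: "z \<in> \<T>" for z
  proof -
    have "(\<lambda>k. norm (of_int k * fourier_coeff f k * z powi (k - 1))) summable_on UNIV"
      unfolding nb[OF z] by (rule fun_class_summable[OF f])
    then have "(\<lambda>k. of_int k * fourier_coeff f k * z powi (k - 1)) summable_on UNIV"
      by (rule abs_summable_summable)
    then show ?thesis unfolding g_def circle_deriv_def
      by (intro has_sum_symmetric has_sum_infsum)
  qed
  show "\<exists>K. \<forall>n. \<forall>z\<in>\<T>. cmod (g n z) \<le> K"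
  proof (intro exI allI ballI)
    fix n z assume z: "z \<in> \<T>"
    have "cmod (g n z) \<le> (\<Sum>k\<in>{- int n..int n}. ?b k)"
      unfolding g_def by (rule order_trans[OF norm_sum]) (simp only: nb[OF z])
    also have "\<dots> \<le> infsum ?b UNIV"
      by (rule finite_sum_le_infsum[OF fun_class_summable(2)[OF f]]) auto
    finally show "cmod (g n z) \<le> infsum ?b UNIV" .
  qed
qed

lemma fun_calc_LIMSEQ:
  fixes Z :: "int \<Rightarrow> 'h::complex_hilbert oper"
  assumes f: "f \<in> \<F>" and Z: "\<And>k. unitary_powi U k = Z k" "\<And>k. norm (Z k) \<le> 1"
  shows "(\<lambda>n. \<Sum>k\<in>{- int n..int n}. fourier_coeff f k *\<^sub>o Z k) \<longlonglongrightarrow> fun_calc f U"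
proof -
  have "(\<lambda>k. norm (fourier_coeff f k *\<^sub>o Z k)) summable_on UNIV"
  proof (rule summable_on_comparison_test[OF fun_class_summable(1)[OF f]])
    show "norm (fourier_coeff f k *\<^sub>o Z k) \<le> cmod (fourier_coeff f k)" for k
      using Z(2)[of k] by (simp add: norm_scaleC_op mult_left_le)
  qed simp
  then have "(\<lambda>k. fourier_coeff f k *\<^sub>o Z k) summable_on UNIV" by (rule abs_summable_summable)
  then show ?thesis unfolding fun_calc_def Z(1) by (intro has_sum_symmetric has_sum_infsum)
qed

section \<open>The measure\<close>

context unitary_path
begin

abbreviation circle :: "complex measure" where "circle \<equiv> restrict_space borel \<T>"

text \<open>The measure is \<open>i z (\<nu>1 - \<nu>2)\<close> with \<open>\<nu>1\<close>, \<open>\<nu>2\<close> the measures of the positive and the negative part of the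
  generator. The derivative \<open>k z\<^sup>k\<^sup>-\<^sup>1\<close> times \<open>i z\<close> is \<open>i k z\<^sup>k\<close>, in agreement with \<open>tau_upow_difference\<close>. The masses add up to the trace
  of \<open>\<bar>A\<bar>\<close>. The functions \<open>h\<close> are uniformly bounded limits of trigonometric polynomials.\<close>

lemma exists_spectral_measure:
  obtains \<mu> where "complex_measure circle \<mu>"
    "\<And>(g :: nat \<Rightarrow> complex \<Rightarrow> complex) h K a.
      (\<And>n z. g n z = (\<Sum>k\<in>{- int n..int n}. of_int k * a k * z powi (k - 1))) \<Longrightarrow>
      (\<And>z. z \<in> \<T> \<Longrightarrow> (\<lambda>n. g n z) \<longlonglongrightarrow> h z) \<Longrightarrow> (\<And>n z. z \<in> \<T> \<Longrightarrow> cmod (g n z) \<le> K) \<Longrightarrow>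
      (\<lambda>n. \<Sum>k\<in>{- int n..int n}. a k * \<tau> (upow k 1 - upow k 0)) \<longlonglongrightarrow> complex_integral circle \<mu> h"
    "total_variation circle \<mu> \<le> ennreal (pi / 2 * M * N (W - id_blinfun))"
proof -
  obtain \<nu>1 where \<nu>1: "finite_measure \<nu>1" "sets \<nu>1 = sets circle"
    "\<And>k. integral\<^sup>L \<nu>1 (\<lambda>z. z powi k) = moment \<Theta>_pos k" "emeasure \<nu>1 (space \<nu>1) = ennreal (Re (moment \<Theta>_pos 0))"
    using Herglotz[OF moment_positive_definite[OF \<Theta>_parts(2,4)]] by blast
  obtain \<nu>2 where \<nu>2: "finite_measure \<nu>2" "sets \<nu>2 = sets circle"
    "\<And>k. integral\<^sup>L \<nu>2 (\<lambda>z. z powi k) = moment \<Theta>_neg k" "emeasure \<nu>2 (space \<nu>2) = ennreal (Re (moment \<Theta>_neg 0))"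
    using Herglotz[OF moment_positive_definite[OF \<Theta>_parts(1,3)]] by blast
  have spc: "space circle = \<T>" by (simp add: space_restrict_space)
  have sp: "space \<nu>1 = \<T>" "space \<nu>2 = \<T>"
    using \<nu>1(2) \<nu>2(2) spc by (metis sets_eq_imp_space_eq)+
  have w_meas: "(\<lambda>z. \<i> * z) \<in> borel_measurable circle"
    by (intro borel_measurable_continuous_on_restrict continuous_intros)
  have pw_meas: "(\<lambda>z. z powi k) \<in> borel_measurable circle" for k
    by (intro borel_measurable_continuous_on_restrict continuous_intros) auto
  obtain \<mu> where \<mu>: "complex_measure circle \<mu>"
    "total_variation circle \<mu> \<le> emeasure \<nu>1 (space circle) + emeasure \<nu>2 (space circle)"
    "\<And>g K. g \<in> borel_measurable circle \<Longrightarrow> (\<And>x. x \<in> space circle \<Longrightarrow> cmod (g x) \<le> K) \<Longrightarrow>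
      complex_integral circle \<mu> g = (\<integral>x. \<i> * x * g x \<partial>\<nu>1) - (\<integral>x. \<i> * x * g x \<partial>\<nu>2)"
    using weighted_difference_measure[OF \<nu>1(1) \<nu>2(1) \<nu>1(2) \<nu>2(2) w_meas] spc
    by (simp add: norm_mult) blast
  show ?thesis
  proof (rule that[OF \<mu>(1)])
    fix g :: "nat \<Rightarrow> complex \<Rightarrow> complex" and h K and a :: "int \<Rightarrow> complex"
    assume g: "\<And>n z. g n z = (\<Sum>k\<in>{- int n..int n}. of_int k * a k * z powi (k - 1))"
      and gh: "\<And>z. z \<in> \<T> \<Longrightarrow> (\<lambda>n. g n z) \<longlonglongrightarrow> h z" and gK: "\<And>n z. z \<in> \<T> \<Longrightarrow> cmod (g n z) \<le> K"
    have gm: "g n \<in> borel_measurable circle" for n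
      unfolding g[abs_def] by (intro borel_measurable_sum borel_measurable_times borel_measurable_const pw_meas)
    have hm: "h \<in> borel_measurable circle"
      by (rule borel_measurable_LIMSEQ_metric[where f = g, OF gm]) (simp add: spc gh)
    have hK: "cmod (h z) \<le> K" if "z \<in> \<T>" for z
      by (rule LIMSEQ_le_const2[OF tendsto_norm[OF gh[OF that]]]) (use gK[OF that] in auto)
    have lim: "(\<lambda>n. \<integral>x. \<i> * x * g n x \<partial>\<nu>) \<longlonglongrightarrow> (\<integral>x. \<i> * x * h x \<partial>\<nu>)"
      if \<nu>: "finite_measure \<nu>" "sets \<nu> = sets circle" "space \<nu> = \<T>" for \<nu>
    proof (rule integral_dominated_convergence[where w = "\<lambda>_. K"])
      have mc: "borel_measurable \<nu> = borel_measurable circle" by (rule measurable_cong_sets[OF \<nu>(2) refl])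
      show "(\<lambda>x. \<i> * x * h x) \<in> borel_measurable \<nu>" "(\<lambda>x. \<i> * x * g n x) \<in> borel_measurable \<nu>" for n
        unfolding mc by (intro borel_measurable_times[OF w_meas] hm gm)+
      show "integrable \<nu> (\<lambda>_. K)" by (rule finite_measure.integrable_const[OF \<nu>(1)])
      show "AE x in \<nu>. (\<lambda>n. \<i> * x * g n x) \<longlonglongrightarrow> \<i> * x * h x"
        using \<nu>(3) by (intro AE_I2 tendsto_mult tendsto_const gh) simp
      show "AE x in \<nu>. norm (\<i> * x * g n x) \<le> K" for n
        using \<nu>(3) gK by (intro AE_I2) (simp add: norm_mult)
    qed
    have mom: "(\<integral>x. \<i> * x * g n x \<partial>\<nu>) = (\<Sum>k\<in>{- int n..int n}. \<i> * of_int k * a k * (\<integral>x. x powi k \<partial>\<nu>))"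
      if \<nu>: "finite_measure \<nu>" "sets \<nu> = sets circle" "space \<nu> = \<T>" for \<nu> n
    proof -
      have int: "integrable \<nu> (\<lambda>x. x powi k)" for k
      proof (rule finite_measure.integrable_const_bound[OF \<nu>(1)])
        show "AE x in \<nu>. norm (x powi k) \<le> 1" using \<nu>(3) by (intro AE_I2) (simp add: norm_unit_power_int)
        show "(\<lambda>x. x powi k) \<in> borel_measurable \<nu>"
          using pw_meas[of k] measurable_cong_sets[OF \<nu>(2) refl] by blast
      qed
      have "(\<integral>x. \<i> * x * g n x \<partial>\<nu>) = (\<integral>x. (\<Sum>k\<in>{- int n..int n}. \<i> * of_int k * a k * x powi k) \<partial>\<nu>)"
      proof (rule Bochner_Integration.integral_cong[OF refl])
        fix x assume "x \<in> space \<nu>"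
        then have x0: "x \<noteq> 0" using \<nu>(3) by auto
        have "x * x powi (k - 1) = x powi k" for k
          using power_int_add_1[of x "k - 1"] x0 by (simp add: mult.commute)
        then have "\<i> * x * (of_int k * a k * x powi (k - 1)) = \<i> * of_int k * a k * x powi k" for k
          by (metis (no_types, opaque_lifting) mult.assoc mult.left_commute)
        then show "\<i> * x * g n x = (\<Sum>k\<in>{- int n..int n}. \<i> * of_int k * a k * x powi k)"
          unfolding g sum_distrib_left by (intro sum.cong refl)
      qed
      then show ?thesis using int by simp
    qed
    have "a k * \<tau> (upow k 1 - upow k 0) = \<i> * of_int k * a k * moment \<Theta>_pos k - \<i> * of_int k * a k * moment \<Theta>_neg k" for k
      unfolding tau_upow_difference by (simp add: algebra_simps)
    then have "(\<Sum>k\<in>{- int n..int n}. a k * \<tau> (upow k 1 - upow k 0)) = (\<integral>x. \<i> * x * g n x \<partial>\<nu>1) - (\<integral>x. \<i> * x * g n x \<partial>\<nu>2)" for n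
      by (simp add: mom \<nu>1 \<nu>2 sp sum_subtractf)
    moreover have "(\<lambda>n. (\<integral>x. \<i> * x * g n x \<partial>\<nu>1) - (\<integral>x. \<i> * x * g n x \<partial>\<nu>2)) \<longlonglongrightarrow> complex_integral circle \<mu> h"
      using \<mu>(3)[OF hm, of K] hK spc
      by (simp only:) (intro tendsto_diff lim \<nu>1 \<nu>2 sp)
    ultimately show "(\<lambda>n. \<Sum>k\<in>{- int n..int n}. a k * \<tau> (upow k 1 - upow k 0)) \<longlonglongrightarrow> complex_integral circle \<mu> h"
      by simp
  next
    have Re0: "Re (\<tau> \<Theta>_pos) \<ge> 0" "Re (\<tau> \<Theta>_neg) \<ge> 0"
      using tau_nonneg[OF \<Theta>_parts(2,4)] tau_nonneg[OF \<Theta>_parts(1,3)] by (auto simp: complex_nonneg_Reals_iff)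
    have "total_variation circle \<mu> \<le> ennreal (Re (\<tau> \<Theta>_pos)) + ennreal (Re (\<tau> \<Theta>_neg))"
      using \<mu>(2) \<nu>1(4) \<nu>2(4) sp spc by (simp add: moment_0 \<Theta>_parts(1,2))
    also have "\<dots> = ennreal (Re (\<tau> \<Theta>))"
      using Re0 by (subst ennreal_plus[symmetric]) (simp_all add: \<Theta>_parts(5) tau_add \<Theta>_parts(1,2))
    also have "\<dots> \<le> ennreal (pi / 2 * M * N (W - id_blinfun))"
    proof (rule ennreal_leI)
      have "Re (\<tau> \<Theta>) \<le> cmod (\<tau> \<Theta>)" by (rule complex_Re_le_cmod)
      also have "\<dots> \<le> M * (pi / 2 * N (W - id_blinfun))" by (rule tau_bound_le[OF \<Theta>_I \<Theta>_N])
      finally show "Re (\<tau> \<Theta>) \<le> pi / 2 * M * N (W - id_blinfun)" by (simp add: mult_ac)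
    qed
    finally show "total_variation circle \<mu> \<le> ennreal (pi / 2 * M * N (W - id_blinfun))" .
  qed
qed

text \<open>Only convergence in the ideal norm lets the trace be taken term by term. In a complete ideal it
  follows from \<open>N (U\<^sup>k - U\<^sub>0\<^sup>k) \<le> \<bar>k\<bar> c\<close>, and the two limits agree because the ideal norm dominates the
  operator norm.\<close>

lemma ideal_norm_convergence:
  assumes f: "f \<in> \<F>" and U1: "\<And>k. unitary_powi H1 k = upow k 1" and U0: "\<And>k. unitary_powi H0 k = upow k 0"
    and adm: "trace_admissible I N H1 H0 f"
  defines "Y \<equiv> fun_calc f H1 - fun_calc f H0"
  defines "D \<equiv> \<lambda>n. \<Sum>k\<in>{- int n..int n}. fourier_coeff f k *\<^sub>o (upow k 1 - upow k 0)"
  shows "Y \<in> I" "(\<lambda>n. N (D n - Y)) \<longlonglongrightarrow> 0"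
proof -
  let ?c = "fourier_coeff f"
  have DI: "D n \<in> I" for n unfolding D_def by (intro I_sum I_scaleC upow_diff_I)
  have "Y \<in> I \<and> (\<lambda>n. N (D n - Y)) \<longlonglongrightarrow> 0"
    using adm unfolding trace_admissible_def
  proof
    assume "ideal_has_sum I N (\<lambda>k. ?c k *\<^sub>o (unitary_powi H1 k - unitary_powi H0 k)) (fun_calc f H1 - fun_calc f H0)"
    then have Y: "Y \<in> I" and lim: "((\<lambda>F. N ((\<Sum>k\<in>F. ?c k *\<^sub>o (upow k 1 - upow k 0)) - Y)) \<longlongrightarrow> 0) (finite_subsets_at_top UNIV)"
      by (simp_all add: ideal_has_sum_def U1 U0 Y_def)
    show ?thesis using Y filterlim_compose[OF lim filterlim_symmetric_intervals] by (simp add: D_def)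
  next
    assume cp: "complete_ideal I N"
    let ?b = "\<lambda>k. \<bar>real_of_int k\<bar> * cmod (?c k) * (2 * N \<Theta>)"
    have "?b summable_on UNIV" by (intro summable_on_cmult_left fun_class_summable f)
    then have "(\<lambda>n. \<Sum>k\<in>{- int n..int n}. ?b k) \<longlonglongrightarrow> infsum ?b UNIV"
      by (intro has_sum_symmetric has_sum_infsum)
    then have Cb: "Cauchy (\<lambda>n. \<Sum>k\<in>{- int n..int n}. ?b k)" by (rule LIMSEQ_imp_Cauchy)
    have Nb: "N (?c k *\<^sub>o (upow k 1 - upow k 0)) \<le> ?b k" for k
    proof -
      have "N (?c k *\<^sub>o (upow k 1 - upow k 0)) = cmod (?c k) * N (upow k 1 - upow k 0)"
        by (rule N_scaleC[OF upow_diff_I])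
      also have "\<dots> \<le> cmod (?c k) * (\<bar>real_of_int k\<bar> * (2 * N \<Theta>))"
        using upow_diff_N[of k 1 0] by (intro mult_left_mono) simp_all
      finally show ?thesis by (simp add: mult_ac)
    qed
    have le: "N (D m - D n) \<le> \<bar>(\<Sum>k\<in>{- int m..int m}. ?b k) - (\<Sum>k\<in>{- int n..int n}. ?b k)\<bar>" if "n \<le> m" for m n
    proof -
      have sub: "{- int n..int n} \<subseteq> {- int m..int m}" using that by auto
      have "D m - D n = (\<Sum>k\<in>{- int m..int m} - {- int n..int n}. ?c k *\<^sub>o (upow k 1 - upow k 0))"
        unfolding D_def by (rule sum_diff[symmetric]) (use sub in auto)
      also have "N \<dots> \<le> (\<Sum>k\<in>{- int m..int m} - {- int n..int n}. ?b k)"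
        by (rule order_trans[OF N_sum sum_mono[OF Nb]]) (intro I_scaleC upow_diff_I)
      also have "\<dots> = (\<Sum>k\<in>{- int m..int m}. ?b k) - (\<Sum>k\<in>{- int n..int n}. ?b k)"
        by (rule sum_diff) (use sub in auto)
      finally show ?thesis by simp
    qed
    have sym: "N (D m - D n) = N (D n - D m)" for m n
      using N_scaleC[OF I_diff[OF DI[of n] DI[of m]], of "-1"] by (simp add: scaleC_op_minus_left)
    have le': "N (D m - D n) \<le> \<bar>(\<Sum>k\<in>{- int m..int m}. ?b k) - (\<Sum>k\<in>{- int n..int n}. ?b k)\<bar>" for m n
    proof (cases "n \<le> m")
      case False
      then show ?thesis using le[of m n] sym[of m n] by (simp add: abs_minus_commute)
    qed (rule le)
    have "\<forall>e>0. \<exists>n0. \<forall>m\<ge>n0. \<forall>n\<ge>n0. N (D m - D n) < e"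
    proof (intro allI impI)
      fix e :: real assume "e > 0"
      then obtain n0 where "\<forall>m\<ge>n0. \<forall>n\<ge>n0. norm ((\<Sum>k\<in>{- int m..int m}. ?b k) - (\<Sum>k\<in>{- int n..int n}. ?b k)) < e"
        using CauchyD[OF Cb] by blast
      then show "\<exists>n0. \<forall>m\<ge>n0. \<forall>n\<ge>n0. N (D m - D n) < e"
        using le_less_trans[OF le'] by (intro exI[of _ n0]) simp
    qed
    then obtain Y' where Y': "Y' \<in> I" "(\<lambda>n. N (D n - Y')) \<longlonglongrightarrow> 0"
      using cp DI unfolding complete_ideal_def by blast
    obtain K where K: "\<And>Z. Z \<in> I \<Longrightarrow> norm Z \<le> K * N Z"
      using ideal unfolding normed_ideal_def ideal_norm_def by blast
    have "(\<lambda>n. D n - Y') \<longlonglongrightarrow> 0"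
    proof (rule Lim_null_comparison)
      show "\<forall>\<^sub>F n in sequentially. norm (D n - Y') \<le> K * N (D n - Y')"
        by (intro always_eventually allI K I_diff DI Y')
      show "(\<lambda>n. K * N (D n - Y')) \<longlonglongrightarrow> 0" using tendsto_mult_right_zero[OF Y'(2)] by simp
    qed
    then have 1: "D \<longlonglongrightarrow> Y'" by (simp add: LIM_zero_iff)
    have "(\<lambda>n. (\<Sum>k\<in>{- int n..int n}. ?c k *\<^sub>o upow k 1) - (\<Sum>k\<in>{- int n..int n}. ?c k *\<^sub>o upow k 0)) \<longlonglongrightarrow> Y"
      unfolding Y_def by (intro tendsto_diff fun_calc_LIMSEQ f U1 U0 upow_norm)
    then have 2: "D \<longlonglongrightarrow> Y" by (simp add: D_def[abs_def] scaleC_op_diff sum_subtractf)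
    have "Y' = Y" by (rule LIMSEQ_unique[OF 1 2])
    then show ?thesis using Y' by simp
  qed
  then show "Y \<in> I" "(\<lambda>n. N (D n - Y)) \<longlonglongrightarrow> 0" by auto
qed

lemma tau_fun_calc:
  assumes f: "f \<in> \<F>" and U1: "\<And>k. unitary_powi H1 k = upow k 1" and U0: "\<And>k. unitary_powi H0 k = upow k 0"
    and adm: "trace_admissible I N H1 H0 f"
  shows "(\<lambda>n. \<Sum>k\<in>{- int n..int n}. fourier_coeff f k * \<tau> (upow k 1 - upow k 0))
    \<longlonglongrightarrow> \<tau> (fun_calc f H1 - fun_calc f H0)"
proof -
  let ?D = "\<lambda>n. \<Sum>k\<in>{- int n..int n}. fourier_coeff f k *\<^sub>o (upow k 1 - upow k 0)"
  let ?Y = "fun_calc f H1 - fun_calc f H0"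
  note Y = ideal_norm_convergence[OF f U1 U0 adm]
  have DI: "?D n \<in> I" for n by (intro I_sum I_scaleC upow_diff_I)
  have "(\<lambda>n. \<tau> (?D n) - \<tau> ?Y) \<longlonglongrightarrow> 0"
  proof (rule Lim_null_comparison)
    show "\<forall>\<^sub>F n in sequentially. norm (\<tau> (?D n) - \<tau> ?Y) \<le> M * N (?D n - ?Y)"
    proof (intro always_eventually allI)
      fix n
      show "norm (\<tau> (?D n) - \<tau> ?Y) \<le> M * N (?D n - ?Y)"
        unfolding tau_diff[OF DI Y(1), symmetric] by (rule tau_bound[OF I_diff[OF DI Y(1)]])
    qed
    show "(\<lambda>n. M * N (?D n - ?Y)) \<longlonglongrightarrow> 0" by (rule tendsto_mult_right_zero[OF Y(2)])
  qed
  then have "(\<lambda>n. \<tau> (?D n)) \<longlonglongrightarrow> \<tau> ?Y" by (simp add: LIM_zero_iff)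
  then show ?thesis by (simp add: tau_sum tau_scaleC I_scaleC upow_diff_I)
qed

end

theorem theorem3p13:
  fixes \<B> \<I> :: "'h::complex_hilbert oper set"
    and N :: "'h oper \<Rightarrow> real"
    and \<tau> :: "'h oper \<Rightarrow> complex"
    and H\<^sub>0 V :: "'h oper"
  assumes "vn_factor \<B>" and "sigma_finite_vn \<B>" and "semifinite_vn \<B>"
    and "normed_ideal \<B> \<I> N"
    and "trace_on \<B> \<I> \<tau>" and "positive_trace \<I> \<tau>" and "bounded_trace \<I> N \<tau>"
    and "V \<in> \<I>" and "H\<^sub>0 \<in> \<B>"
    and "unitary H\<^sub>0" and "unitary (H\<^sub>0 + V)"
  shows "\<exists>\<mu> :: complex set \<Rightarrow> complex.
    complex_measure (restrict_space borel \<T>) \<mu> \<and>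
    (\<forall>f\<in>\<F>. trace_admissible \<I> N (H\<^sub>0 + V) H\<^sub>0 f \<longrightarrow>
       \<tau> (fun_calc f (H\<^sub>0 + V) - fun_calc f H\<^sub>0)
         = complex_integral (restrict_space borel \<T>) \<mu> (circle_deriv f)) \<and>
    total_variation (restrict_space borel \<T>) \<mu> \<le> ennreal (pi / 2 * trace_norm \<I> N \<tau> * N V)"
proof -
  interpret normed_ideal_trace \<B> \<I> N \<tau>
    using assms by unfold_locales (simp_all add: vn_factor_def)
  \<comment> \<open>The path starts at \<open>H\<^sub>0\<close>, so the unitary to be connected to \<open>1\<close> is \<open>W = (H\<^sub>0 + V) H\<^sub>0\<^sup>*\<close>, and
    \<open>W - 1 = V H\<^sub>0\<^sup>*\<close> lies in the ideal.\<close>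
  define H1 where "H1 = H\<^sub>0 + V"
  have H1B: "H1 \<in> \<B>" unfolding H1_def by (intro inB assms I_B)
  note H0B = \<open>H\<^sub>0 \<in> \<B>\<close>
  have a0: "adjoint_pair H\<^sub>0 (adj H\<^sub>0)" and a1: "adjoint_pair H1 (adj H1)"
    using adjoint_pair_adj B_bounded H0B H1B by auto
  have i0: "adj H\<^sub>0 o\<^sub>L H\<^sub>0 = id_blinfun" "H\<^sub>0 o\<^sub>L adj H\<^sub>0 = id_blinfun"
    and i1: "adj H1 o\<^sub>L H1 = id_blinfun" "H1 o\<^sub>L adj H1 = id_blinfun"
    using assms(10,11) by (auto simp: unitary_def H1_def)
  have c0: "adj H\<^sub>0 o\<^sub>L (H\<^sub>0 o\<^sub>L C) = C" and c1: "adj H1 o\<^sub>L (H1 o\<^sub>L C) = C" for C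
    by (simp_all add: i0 i1 flip: op_comp_assoc)
  have Wid: "(H1 o\<^sub>L adj H\<^sub>0) - id_blinfun = V o\<^sub>L adj H\<^sub>0"
    by (simp add: H1_def op_distrib i0)
  interpret unitary_path \<B> \<I> N \<tau> "H1 o\<^sub>L adj H\<^sub>0" "H\<^sub>0 o\<^sub>L adj H1" H\<^sub>0 "adj H\<^sub>0"
  proof unfold_locales
    show "H1 o\<^sub>L adj H\<^sub>0 \<in> \<B>" "H\<^sub>0 o\<^sub>L adj H1 \<in> \<B>" "adj H\<^sub>0 \<in> \<B>"
      by (intro inB H0B H1B B_adj)+
    show "adjoint_pair (H1 o\<^sub>L adj H\<^sub>0) (H\<^sub>0 o\<^sub>L adj H1)"
      by (intro adjoint_pair_comp a1 adjoint_pair_sym[OF a0])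
    show "(H1 o\<^sub>L adj H\<^sub>0) o\<^sub>L (H\<^sub>0 o\<^sub>L adj H1) = id_blinfun"
      "(H\<^sub>0 o\<^sub>L adj H1) o\<^sub>L (H1 o\<^sub>L adj H\<^sub>0) = id_blinfun"
      by (simp_all add: op_comp_assoc c0 c1 i0 i1)
    show "(H1 o\<^sub>L adj H\<^sub>0) - id_blinfun \<in> \<I>"
      unfolding Wid by (intro I_right B_adj H0B assms)
  qed (use H0B a0 i0 in simp_all)
  have r1: "rot (- 1) = H\<^sub>0 o\<^sub>L adj H1"
    using adjoint_pair_unique[OF rot_adjoint[of 1, unfolded rot_1] WW'] .
  have ends: "U 1 = H1" "U' 1 = adj H1" "U 0 = H\<^sub>0" "U' 0 = adj H\<^sub>0"
    by (simp_all add: U_def U'_def rot_0 rot_1 r1 op_comp_assoc i0 c0)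
  have p1: "unitary_powi H1 k = upow k 1" and p0: "unitary_powi H\<^sub>0 k = upow k 0" for k
    by (simp_all add: unitary_powi_def upow_def opow_def ends)
  obtain \<mu> where \<mu>: "complex_measure circle \<mu>"
    and lim: "\<And>(g :: nat \<Rightarrow> complex \<Rightarrow> complex) h K a.
      (\<And>n z. g n z = (\<Sum>k\<in>{- int n..int n}. of_int k * a k * z powi (k - 1))) \<Longrightarrow>
      (\<And>z. z \<in> \<T> \<Longrightarrow> (\<lambda>n. g n z) \<longlonglongrightarrow> h z) \<Longrightarrow> (\<And>n z. z \<in> \<T> \<Longrightarrow> cmod (g n z) \<le> K) \<Longrightarrow>
      (\<lambda>n. \<Sum>k\<in>{- int n..int n}. a k * \<tau> (upow k 1 - upow k 0)) \<longlonglongrightarrow> complex_integral circle \<mu> h"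
    and tv: "total_variation circle \<mu> \<le> ennreal (pi / 2 * M * N ((H1 o\<^sub>L adj H\<^sub>0) - id_blinfun))"
    using exists_spectral_measure by blast
  have "\<tau> (fun_calc f H1 - fun_calc f H\<^sub>0) = complex_integral circle \<mu> (circle_deriv f)"
    if f: "f \<in> \<F>" and adm: "trace_admissible \<I> N H1 H\<^sub>0 f" for f
  proof -
    obtain K where K: "\<And>n z. z \<in> \<T> \<Longrightarrow> cmod (\<Sum>k\<in>{- int n..int n}. of_int k * fourier_coeff f k * z powi (k - 1)) \<le> K"
      using circle_deriv_partial_sums(2)[OF f] by blast
    show ?thesis
      by (rule LIMSEQ_unique[OF tau_fun_calc[OF f p1 p0 adm] lim[OF refl circle_deriv_partial_sums(1)[OF f] K]])
  qed
  moreover have "total_variation circle \<mu> \<le> ennreal (pi / 2 * trace_norm \<I> N \<tau> * N V)"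
  proof -
    have "norm (adj H\<^sub>0) \<le> 1" by (rule adjoint_left_inverse_norm[OF adjoint_pair_sym[OF a0] i0(2)])
    then have "N ((H1 o\<^sub>L adj H\<^sub>0) - id_blinfun) \<le> N V"
      unfolding Wid by (intro N_right1 B_adj H0B assms)
    then have "pi / 2 * M * N ((H1 o\<^sub>L adj H\<^sub>0) - id_blinfun) \<le> pi / 2 * M * N V"
      using M_nonneg by (intro mult_left_mono) auto
    then show ?thesis using tv by (metis M_def ennreal_leI order_trans)
  qed
  ultimately show ?thesis using \<mu> by (auto simp: H1_def)
qed

end
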